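(* Let $k,d,d'$ be positive integers with $k<d$, $d'-1\le k$, and $\frac{d'-1}{d'}>\frac kd$ (so that $(d'-1,d')\in R_{k,d}$). Then the dependency on $q_{d'-1,d'}$ cannot be completely removed from the following incidence bound for $k$-flats in $\mathbb R^d$ with $s=2$: for all $t,\varepsilon$ there are $c,C$ such that, whenever $\mathcal P$ is a set of $m$ points and $\mathcal V$ a set of $n$ $k$-flats in $\mathbb R^d$ whose incidence graph contains no $K_{2,t}$, and for each $(k',\delta')\in R_{k,d}$ every $\delta'$-dimensional variety of degree at most $c$ has a $k'$-dimensional intersection with at most $q_{k',\delta'}$ elements of $\mathcal V$, then $$I(\mathcal P,\mathcal V)\le C\left(\sum_{((k_0,d_0),\ldots,(k_u,d_u))\in S_{k,d}} m^{\frac{2k_u}{d_u+k_u}+\varepsilon}\left(n^{\frac{d}{d-k}}\prod_{j=1}^{u} q_{k_j,d_j}^{\frac{d_j}{d_j-k_j}-\frac{d_{j-1}}{d_{j-1}-k_{j-1}}}\right)^{\frac{d_u-k_u}{d_u+k_u}}+m+n\right).$$ That is, the statement obtained by deleting the hypothesis involving $q_{d'-1,d'}$ and all the terms of the sum involving $q_{d'-1,d'}$ is false: there exist a positive integer $t$ and $\varepsilon>0$ such that for all constants $c,C>0$ there exist positive integers $m,n$, a set $\mathcal P$ of $m$ points and a set $\mathcal V$ of $n$ $k$-flats in $\mathbb R^d$, and positive integers $q_{k',\delta'}$ for $(k',\delta')\in R_{k,d}\setminus\{(d'-1,d')\}$, such that the incidence graph of $\mathcal P\times\mathcal V$ contains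 no copy of $K_{2,t}$; for each $(k',\delta')\in R_{k,d}\setminus\{(d'-1,d')\}$, every $\delta'$-dimensional variety in $\mathbb R^d$ of degree at most $c$ has a $k'$-dimensional intersection with at most $q_{k',\delta'}$ elements of $\mathcal V$; and $$I(\mathcal P,\mathcal V)> C\left(\sum_{((k_0,d_0),\ldots,(k_u,d_u))\in S'} m^{\frac{2k_u}{d_u+k_u}+\varepsilon}\left(n^{\frac{d}{d-k}}\prod_{j=1}^{u} q_{k_j,d_j}^{\frac{d_j}{d_j-k_j}-\frac{d_{j-1}}{d_{j-1}-k_{j-1}}}\right)^{\frac{d_u-k_u}{d_u+k_u}}+m+n\right),$$ where $S'$ is the set of sequences in $S_{k,d}$ that do not contain the pair $(d'-1,d')$.
   Context: A variety in $\mathbb R^d$ is the common zero set in $\mathbb R^d$ of finitely many real polynomials. Its degree is the minimum integer $\Delta$ such that it can be defined as the common zero set of finitely many polynomials of degree at most $\Delta$. Its dimension is the usual dimension of a real algebraic set. A $k$-flat is a $k$-dimensional affine subspace. $I(\mathcal P,\mathcal V)$ is the number of pairs $(p,V)\in\mathcal P\times\mathcal V$ with $p\in V$. The incidence graph is the bipartite graph on $\mathcal P,\mathcal V$ with an edge for each such pair; it contains no copy of $K_{2,t}$ if no two distinct points of $\mathcal P$ are both contained in each of $t$ distinct elements of $\mathcal V$. For integers $1\le k<d$, $$R_{k,d}=\left\{(k',\delta')\in\mathbb Z^2 : 1\le k'\le k,\ 2\le \delta'\le d,\ \tfrac kd<\tfrac{k'}{\delta'}<1\right\}.$$ A sequence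 of pairs of positive integers $((k_0,d_0),\ldots,(k_u,d_u))$ ($u\ge 0$) is significant if: (i) $k_j<d_j$ for all $0\le j\le u$; (ii) $k_0\ge k_1\ge\cdots\ge k_u\ge 1$; (iii) $d_0>d_1>\cdots>d_u\ge 2$; (iv) $\frac{k_0}{d_0}<\frac{k_1}{d_1}<\cdots<\frac{k_u}{d_u}<1$. $S_{k,d}$ is the set of significant sequences with $(k_0,d_0)=(k,d)$, including the one-term sequence $((k,d))$, for which the product over $j$ is empty (equal to $1$). *)

theory Defs
  imports "HOL-Analysis.Analysis"
begin

text \<open>Polynomials in the coordinates of \<open>real ^ 'n\<close> are identified with the functions they
  induce, which loses nothing over the infinite field of reals.  An exponent vector is a function
  \<open>\<alpha> :: 'n \<Rightarrow> nat\<close>, with total degree the sum of its values.\<close>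

definition monom_fun :: "('n::finite \<Rightarrow> nat) \<Rightarrow> real ^ 'n \<Rightarrow> real" where
  "monom_fun \<alpha> x = (\<Prod>i\<in>UNIV. (x $ i) ^ \<alpha> i)"

definition exponents_upto :: "nat \<Rightarrow> ('n::finite \<Rightarrow> nat) set" where
  "exponents_upto D = {\<alpha>. (\<Sum>i\<in>UNIV. \<alpha> i) \<le> D}"

definition poly_fun_deg_le :: "nat \<Rightarrow> (real ^ 'n::finite \<Rightarrow> real) \<Rightarrow> bool" where
  "poly_fun_deg_le D f \<longleftrightarrow>
     (\<exists>a :: ('n \<Rightarrow> nat) \<Rightarrow> real. f = (\<lambda>x. \<Sum>\<alpha>\<in>exponents_upto D. a \<alpha> * monom_fun \<alpha> x))"

definition variety :: "(real ^ 'n::finite) set \<Rightarrow> bool" where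
  "variety W \<longleftrightarrow>
     (\<exists>A. finite A \<and> (\<forall>f\<in>A. real_polynomial_function f) \<and> W = {x. \<forall>f\<in>A. f x = 0})"

definition defined_in_degree :: "nat \<Rightarrow> (real ^ 'n::finite) set \<Rightarrow> bool" where
  "defined_in_degree D W \<longleftrightarrow>
     (\<exists>A. finite A \<and> (\<forall>f\<in>A. poly_fun_deg_le D f) \<and> W = {x. \<forall>f\<in>A. f x = 0})"

definition variety_degree :: "(real ^ 'n::finite) set \<Rightarrow> nat" where
  "variety_degree W = (LEAST D. defined_in_degree D W)"

definition irreducible_variety :: "(real ^ 'n::finite) set \<Rightarrow> bool" where
  "irreducible_variety W \<longleftrightarrow> variety W \<and> W \<noteq> {} \<and>
     (\<forall>W1 W2. variety W1 \<and> variety W2 \<and> W = W1 \<union> W2 \<longrightarrow> W = W1 \<or> W = W2)"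

definition has_irreducible_chain :: "(real ^ 'n::finite) set \<Rightarrow> nat \<Rightarrow> bool" where
  "has_irreducible_chain W r \<longleftrightarrow>
     (\<exists>Z :: nat \<Rightarrow> (real ^ 'n) set.
        (\<forall>i\<le>r. irreducible_variety (Z i)) \<and> (\<forall>i<r. Z i \<subset> Z (Suc i)) \<and> Z r \<subseteq> W)"

text \<open>The dimension of a real algebraic set is the Krull dimension of its ring of polynomial
  functions, that is, the supremum of the lengths \<open>r\<close> of chains
  \<open>Z\<^sub>0 \<subset> \<dots> \<subset> Z\<^sub>r\<close> of irreducible
  varieties contained in it.  The supremum is taken in \<^typ>\<open>ereal\<close> so that the empty variety
  has dimension \<open>-\<infinity>\<close>.\<close>

definition variety_dim :: "(real ^ 'n::finite) set \<Rightarrow> ereal" where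
  "variety_dim W = (SUP r\<in>{r. has_irreducible_chain W r}. ereal (real r))"

definition flat :: "nat \<Rightarrow> (real ^ 'n::finite) set \<Rightarrow> bool" where
  "flat k F \<longleftrightarrow> affine F \<and> aff_dim F = int k"

definition incidences :: "'a set \<Rightarrow> 'a set set \<Rightarrow> nat" where
  "incidences P \<V> = card {(p, F). p \<in> P \<and> F \<in> \<V> \<and> p \<in> F}"

text \<open>Orientation of the forbidden graph: two points on \<open>t\<close> common elements of \<open>\<V>\<close>.\<close>

definition K2t_free :: "nat \<Rightarrow> 'a set \<Rightarrow> 'a set set \<Rightarrow> bool" where
  "K2t_free t P \<V> \<longleftrightarrow>
     \<not> (\<exists>p\<in>P. \<exists>p'\<in>P. \<exists>T. p \<noteq> p' \<and> T \<subseteq> \<V> \<and> finite T \<and> card T = t \<and> (\<forall>F\<in>T. p \<in> F \<and> p' \<in> F))"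

definition R_set :: "nat \<Rightarrow> nat \<Rightarrow> (nat \<times> nat) set" where
  "R_set k d = {(k', \<delta>'). 1 \<le> k' \<and> k' \<le> k \<and> 2 \<le> \<delta>' \<and> \<delta>' \<le> d \<and>
     real k / real d < real k' / real \<delta>' \<and> real k' / real \<delta>' < 1}"

text \<open>The pair \<open>(k\<^sub>j, d\<^sub>j)\<close> is \<open>\<sigma> ! j\<close>, and the last index is
  \<open>u = length \<sigma> - 1\<close>.\<close>

definition significant :: "(nat \<times> nat) list \<Rightarrow> bool" where
  "significant \<sigma> \<longleftrightarrow> \<sigma> \<noteq> [] \<and>
     (\<forall>j<length \<sigma>. fst (\<sigma> ! j) < snd (\<sigma> ! j)) \<and>
     (\<forall>j. Suc j < length \<sigma> \<longrightarrow> fst (\<sigma> ! j) \<ge> fst (\<sigma> ! Suc j)) \<and> fst (last \<sigma>) \<ge> 1 \<and>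
     (\<forall>j. Suc j < length \<sigma> \<longrightarrow> snd (\<sigma> ! j) > snd (\<sigma> ! Suc j)) \<and> snd (last \<sigma>) \<ge> 2 \<and>
     (\<forall>j. Suc j < length \<sigma> \<longrightarrow>
        real (fst (\<sigma> ! j)) / real (snd (\<sigma> ! j)) < real (fst (\<sigma> ! Suc j)) / real (snd (\<sigma> ! Suc j))) \<and>
     real (fst (last \<sigma>)) / real (snd (last \<sigma>)) < 1"

definition S_set :: "nat \<Rightarrow> nat \<Rightarrow> (nat \<times> nat) list set" where
  "S_set k d = {\<sigma>. significant \<sigma> \<and> hd \<sigma> = (k, d)}"

definition codim_ratio :: "nat \<times> nat \<Rightarrow> real" where
  "codim_ratio x = real (snd x) / (real (snd x) - real (fst x))"

definition bound_term ::
  "nat \<Rightarrow> nat \<Rightarrow> (nat \<times> nat \<Rightarrow> nat) \<Rightarrow> real \<Rightarrow> (nat \<times> nat) list \<Rightarrow> real" where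
  "bound_term m n q \<epsilon> \<sigma> =
     (let k\<^sub>u = real (fst (last \<sigma>)); d\<^sub>u = real (snd (last \<sigma>)) in
       real m powr (2 * k\<^sub>u / (d\<^sub>u + k\<^sub>u) + \<epsilon>) *
       (real n powr codim_ratio (hd \<sigma>) *
        (\<Prod>j = 1..<length \<sigma>.
           real (q (\<sigma> ! j)) powr (codim_ratio (\<sigma> ! j) - codim_ratio (\<sigma> ! (j - 1)))))
       powr ((d\<^sub>u - k\<^sub>u) / (d\<^sub>u + k\<^sub>u)))"

lemma finite_exponents_upto: "finite (exponents_upto D :: ('n::finite \<Rightarrow> nat) set)"
proof (rule finite_subset)
  show "(exponents_upto D :: ('n \<Rightarrow> nat) set) \<subseteq> (UNIV :: 'n set) \<rightarrow>\<^sub>E {..D}"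
  proof
    fix \<alpha> :: "'n \<Rightarrow> nat" assume "\<alpha> \<in> exponents_upto D"
    then have "\<alpha> i \<le> D" for i
      using member_le_sum[of i UNIV \<alpha>] by (force simp: exponents_upto_def)
    then show "\<alpha> \<in> UNIV \<rightarrow>\<^sub>E {..D}" by auto
  qed
qed (simp add: finite_PiE)

lemma poly_fun_deg_le_mono:
  assumes "poly_fun_deg_le D f" "D \<le> E" shows "poly_fun_deg_le E f"
proof -
  obtain a where a: "f = (\<lambda>x. \<Sum>\<alpha>\<in>exponents_upto D. a \<alpha> * monom_fun \<alpha> x)"
    using assms by (auto simp: poly_fun_deg_le_def)
  have sub: "exponents_upto D \<subseteq> (exponents_upto E :: ('a \<Rightarrow> nat) set)"
    using assms(2) by (auto simp: exponents_upto_def)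
  have "f = (\<lambda>x. \<Sum>\<alpha>\<in>exponents_upto E. (if \<alpha> \<in> exponents_upto D then a \<alpha> else 0) * monom_fun \<alpha> x)"
    unfolding a
    by (rule ext, rule sum.mono_neutral_cong_left) (use sub finite_exponents_upto in auto)
  then show ?thesis unfolding poly_fun_deg_le_def
    by (intro exI[of _ "\<lambda>\<alpha>. if \<alpha> \<in> exponents_upto D then a \<alpha> else 0"])
qed

lemma poly_fun_deg_le_add:
  assumes "poly_fun_deg_le D f" "poly_fun_deg_le D g"
  shows "poly_fun_deg_le D (\<lambda>x. f x + g x)"
proof -
  obtain a b where "f = (\<lambda>x. \<Sum>\<alpha>\<in>exponents_upto D. a \<alpha> * monom_fun \<alpha> x)"
    "g = (\<lambda>x. \<Sum>\<alpha>\<in>exponents_upto D. b \<alpha> * monom_fun \<alpha> x)"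
    using assms by (auto simp: poly_fun_deg_le_def)
  then have "(\<lambda>x. f x + g x) = (\<lambda>x. \<Sum>\<alpha>\<in>exponents_upto D. (a \<alpha> + b \<alpha>) * monom_fun \<alpha> x)"
    by (simp add: sum.distrib distrib_right)
  then show ?thesis unfolding poly_fun_deg_le_def by (intro exI[of _ "\<lambda>\<alpha>. a \<alpha> + b \<alpha>"])
qed

lemma poly_fun_deg_le_monom:
  assumes "(\<Sum>i\<in>UNIV. \<alpha> i) \<le> D"
  shows "poly_fun_deg_le D (\<lambda>x. r * monom_fun \<alpha> x)"
proof -
  have "(\<lambda>x. r * monom_fun \<alpha> x) =
      (\<lambda>x. \<Sum>\<beta>\<in>exponents_upto D. (if \<beta> = \<alpha> then r else 0) * monom_fun \<beta> x)"
    using assms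
    by (auto simp: if_distrib[of "\<lambda>z. z * _"] sum.delta[OF finite_exponents_upto]
        exponents_upto_def[of D, THEN eqset_imp_iff] cong: if_cong)
  then show ?thesis unfolding poly_fun_deg_le_def
    by (intro exI[of _ "\<lambda>\<beta>. if \<beta> = \<alpha> then r else 0"])
qed

lemma poly_fun_deg_le_sum:
  assumes "finite A" "\<And>a. a \<in> A \<Longrightarrow> poly_fun_deg_le D (f a)"
  shows "poly_fun_deg_le D (\<lambda>x. \<Sum>a\<in>A. f a x)"
  using assms
proof (induction A rule: finite_induct)
  case empty
  then show ?case using poly_fun_deg_le_monom[of "\<lambda>_. 0" D 0] by simp
next
  case (insert a A)
  then show ?case using poly_fun_deg_le_add[of D "f a" "\<lambda>x. \<Sum>a\<in>A. f a x"] by simp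
qed

lemma poly_fun_deg_le_mult:
  assumes "poly_fun_deg_le D f" "poly_fun_deg_le E g"
  shows "poly_fun_deg_le (D + E) (\<lambda>x. f x * g x)"
proof -
  obtain a b where ab: "f = (\<lambda>x. \<Sum>\<alpha>\<in>exponents_upto D. a \<alpha> * monom_fun \<alpha> x)"
    "g = (\<lambda>x. \<Sum>\<beta>\<in>exponents_upto E. b \<beta> * monom_fun \<beta> x)"
    using assms by (auto simp: poly_fun_deg_le_def)
  have "f x * g x = (\<Sum>\<alpha>\<in>exponents_upto D. \<Sum>\<beta>\<in>exponents_upto E.
      (a \<alpha> * b \<beta>) * monom_fun (\<lambda>i. \<alpha> i + \<beta> i) x)" for x
    unfolding ab sum_product
    by (intro sum.cong refl) (simp add: monom_fun_def power_add prod.distrib)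
  then have eq: "(\<lambda>x. f x * g x) = (\<lambda>x. \<Sum>\<alpha>\<in>exponents_upto D. \<Sum>\<beta>\<in>exponents_upto E.
      (a \<alpha> * b \<beta>) * monom_fun (\<lambda>i. \<alpha> i + \<beta> i) x)" by blast
  show ?thesis unfolding eq
    by (intro poly_fun_deg_le_sum finite_exponents_upto poly_fun_deg_le_monom)
       (auto simp: exponents_upto_def sum.distrib)
qed

lemma real_polynomial_function_iff_deg:
  fixes f :: "real ^ 'n::finite \<Rightarrow> real"
  shows "real_polynomial_function f \<longleftrightarrow> (\<exists>D. poly_fun_deg_le D f)"
proof
  assume "real_polynomial_function f"
  then show "\<exists>D. poly_fun_deg_le D f"
  proof (induction rule: real_polynomial_function.induct)
    case (linear f)
    have mon: "monom_fun (\<lambda>j. if j = i then 1 else 0) x = x $ i" for i and x :: "real ^ 'n"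
      unfolding monom_fun_def by (simp add: if_distrib[of "\<lambda>e. _ ^ e"] cong: if_cong)
    have "f x = (\<Sum>i\<in>UNIV. f (axis i 1) * x $ i)" for x
    proof -
      have "f x = f (\<Sum>i\<in>UNIV. x $ i *\<^sub>R axis i 1)"
        using basis_expansion[of x] by (simp add: scalar_mult_eq_scaleR)
      also have "\<dots> = (\<Sum>i\<in>UNIV. f (axis i 1) * x $ i)"
        using linear by (simp add: linear_sum linear_scale bounded_linear.linear mult.commute)
      finally show ?thesis .
    qed
    then have eq: "f = (\<lambda>x. \<Sum>i\<in>UNIV. f (axis i 1) * monom_fun (\<lambda>j. if j = i then 1 else 0) x)"
      unfolding mon by blast
    have "poly_fun_deg_le 1
        (\<lambda>x. \<Sum>i\<in>UNIV. f (axis i 1) * monom_fun (\<lambda>j. if j = i then 1 else 0) x)"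
      by (intro poly_fun_deg_le_sum poly_fun_deg_le_monom) auto
    with eq show ?case by metis
  next
    case (const c)
    then show ?case
      using poly_fun_deg_le_monom[of "\<lambda>_. 0" 0 c] by (auto simp: monom_fun_def)
  next
    case (add f g)
    then obtain D E where "poly_fun_deg_le D f" "poly_fun_deg_le E g" by blast
    then have "poly_fun_deg_le (max D E) f" "poly_fun_deg_le (max D E) g"
      by (auto intro: poly_fun_deg_le_mono)
    then show ?case using poly_fun_deg_le_add by blast
  next
    case (mult f g)
    then show ?case using poly_fun_deg_le_mult by blast
  qed
next
  assume "\<exists>D. poly_fun_deg_le D f"
  then obtain D a where f: "f = (\<lambda>x. \<Sum>\<alpha>\<in>exponents_upto D. a \<alpha> * monom_fun \<alpha> x)"
    by (auto simp: poly_fun_deg_le_def)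
  have "real_polynomial_function (monom_fun \<alpha> :: real ^ 'n \<Rightarrow> real)" for \<alpha>
  proof -
    have "real_polynomial_function (\<lambda>x :: real ^ 'n. \<Prod>i\<in>UNIV. (x $ i) ^ \<alpha> i)"
      by (intro real_polynomial_function_prod real_polynomial_function_power
            real_polynomial_function.intros(1) bounded_linear_vec_nth) auto
    then show ?thesis by (simp add: monom_fun_def[abs_def])
  qed
  then show "real_polynomial_function f"
    unfolding f by (intro real_polynomial_function_sum finite_exponents_upto
        real_polynomial_function.intros(2,4)) auto
qed

lemma variety_iff_defined_in_degree: "variety W \<longleftrightarrow> (\<exists>D. defined_in_degree D W)"
proof
  assume "variety W"
  then obtain A where A: "finite A" "\<forall>f\<in>A. real_polynomial_function f" "W = {x. \<forall>f\<in>A. f x = 0}"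
    by (auto simp: variety_def)
  then obtain D where D: "\<forall>f\<in>A. poly_fun_deg_le (D f) f"
    unfolding real_polynomial_function_iff_deg by metis
  have "D f \<le> sum D A" if "f \<in> A" for f
    using member_le_sum[of f A D] A(1) that by simp
  then have "\<forall>f\<in>A. poly_fun_deg_le (sum D A) f"
    using D poly_fun_deg_le_mono by blast
  with A show "\<exists>D. defined_in_degree D W" by (auto simp: defined_in_degree_def)
next
  assume "\<exists>D. defined_in_degree D W"
  then show "variety W"
    unfolding variety_def defined_in_degree_def real_polynomial_function_iff_deg by blast
qed

lemma finite_S_set: "finite (S_set k d)"
proof (rule finite_subset)
  show "S_set k d \<subseteq> {\<sigma>. set \<sigma> \<subseteq> {..k} \<times> {..d} \<and> length \<sigma> \<le> Suc d}"
  proof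
    fix \<sigma> assume "\<sigma> \<in> S_set k d"
    then have s: "\<sigma> \<noteq> []" "\<sigma> ! 0 = (k, d)"
      and dec1: "\<And>j. Suc j < length \<sigma> \<Longrightarrow> fst (\<sigma> ! Suc j) \<le> fst (\<sigma> ! j)"
      and dec2: "\<And>j. Suc j < length \<sigma> \<Longrightarrow> snd (\<sigma> ! Suc j) < snd (\<sigma> ! j)"
      by (auto simp: S_set_def significant_def hd_conv_nth)
    have *: "fst (\<sigma> ! j) \<le> k \<and> snd (\<sigma> ! j) + j \<le> d" if "j < length \<sigma>" for j
      using that
    proof (induction j)
      case 0
      then show ?case by (simp add: s)
    next
      case (Suc j)
      then show ?case using dec1[of j] dec2[of j] by simp
    qed
    have "length \<sigma> \<le> Suc d"
      using *[of "length \<sigma> - 1"] s(1) by (cases \<sigma>) auto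
    moreover have "set \<sigma> \<subseteq> {..k} \<times> {..d}"
    proof
      fix x assume "x \<in> set \<sigma>"
      then obtain j where "j < length \<sigma>" "x = \<sigma> ! j" by (metis in_set_conv_nth)
      then show "x \<in> {..k} \<times> {..d}" using *[of j] by (cases "\<sigma> ! j") auto
    qed
    ultimately show "\<sigma> \<in> {\<sigma>. set \<sigma> \<subseteq> {..k} \<times> {..d} \<and> length \<sigma> \<le> Suc d}" by blast
  qed
  show "finite {\<sigma>. set \<sigma> \<subseteq> {..k} \<times> {..d} \<and> length \<sigma> \<le> Suc d}"
    by (rule finite_lists_length_le) simp
qed

end

theory Submission
  imports Defs "HOL-Computational_Algebra.Primes"
begin

text \<open>
  Choose coordinates \<open>X\<close> (\<open>d' - 1\<close> of them), one more coordinate \<open>z1\<close>, and place a grid of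
  \<open>m = K\<^sup>d\<^sup>'\<close> points in the span \<open>G\<close> of these \<open>d'\<close> coordinates.  In \<open>G\<close> take
  \<open>S\<close> families of about \<open>K\<close> parallel hyperplanes, with normals on the moment curve; two points lie
  on at most \<open>d' - 1\<close> of them (Vandermonde), and there are \<open>S m\<close> incidences.  Each hyperplane is
  extended to a \<open>k\<close>-flat whose direction is generic, namely given by rapidly growing powers of the
  offset \<open>b\<close> of the hyperplane.  As \<open>n \<approx> m\<^sup>1\<^sup>/\<^sup>d\<^sup>'\<close>, all terms of the bound are
  \<open>o(m)\<close> if \<open>q\<close> is \<open>n\<close> for the pairs of slope below \<open>(d' - 1) / d'\<close> and a constant for the
  others, so the bound fails as soon as \<open>S\<close> is large compared with \<open>C\<close>.

  The work is to show that a constant does suffice for the remaining pairs \<open>(k', \<delta>')\<close>.  For these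
  \<open>k' \<ge> d'\<close> and \<open>k' > \<delta>' - (d - k)\<close>, the expected dimension.  If \<open>W\<close> has dimension
  \<open>\<delta>'\<close> and degree at most \<open>c\<close>, then any \<open>\<delta>' + 1\<close> coordinates satisfy on \<open>W\<close> a
  polynomial relation of degree bounded in \<open>c\<close>: otherwise, by quantifier elimination with the
  coefficients of the equation of \<open>W\<close> as additional variables, a projection of \<open>W\<close> contains a box,
  and slicing yields a chain of irreducible varieties that is too long.  Hence the Hilbert function of
  \<open>W\<close> is \<open>O(D\<^sup>\<delta>\<^sup>')\<close> uniformly in \<open>W\<close>, and a dimension count produces a hypersurface of
  bounded degree in the parameter space of the flats that contains all parameters for which the
  intersection with \<open>W\<close> has dimension \<open>k'\<close>.  The curve of parameters used above meets such a
  hypersurface in boundedly many points.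
\<close>

section \<open>Sign diagrams of univariate polynomials\<close>

text \<open>The omitted weight is decisive for a reason visible in the exponents. The pair
  \<open>(d' - 1, d')\<close> has codimension ratio exactly \<open>d'\<close>; all the flats meet
  \<open>G\<close> in dimension \<open>d' - 1\<close>, so its weight would be \<open>n\<close>, and
  the sequence made of \<open>(k, d)\<close> and this pair would contribute at least about
  \<open>m\<close>. Any pair of smaller slope has ratio at most \<open>d' - 1 / d\<close>. This gap,
  multiplied by \<open>(du - ku) / (du + ku) \<ge> 1 / (2 * d)\<close>, saves the power
  \<open>1 / (2 * d^2)\<close> of \<open>K\<close>, and \<open>\<epsilon>\<close> is chosen to spend
  half of it. The obstacle is uniformity: one constant has to serve all varieties of degree at most
  \<open>c\<close>, for arbitrarily many flats, so genericity with respect to each single variety is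
  not enough. Hence all degrees are bounded in terms of \<open>c\<close> alone, and the choices come
  in this order: \<open>c\<close> fixes \<open>E\<close>, \<open>C\<close> fixes the number
  \<open>S\<close> of directions, both fix \<open>q0\<close>, and \<open>K\<close> comes last. The
  coordinates in \<open>Y\<close>, which carry the generic part of the directions, vanish on
  \<open>G\<close>, so genericity costs no incidence.\<close>

definition inc_bij :: "(real \<Rightarrow> real) \<Rightarrow> bool" where
  "inc_bij \<phi> \<longleftrightarrow> strict_mono \<phi> \<and> surj \<phi>"

text \<open>Equality of sign diagrams, encoded by a common reparametrisation of the line instead of
  a table of roots and signs.\<close>

definition sign_match :: "(real \<Rightarrow> real) \<Rightarrow> (real poly \<times> real poly) set \<Rightarrow> bool" where
  "sign_match \<phi> T \<longleftrightarrow> (\<forall>(f, g) \<in> T. \<forall>z. sgn (poly f z) = sgn (poly g (\<phi> z)))"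

lemma sign_matchD: "sign_match \<phi> T \<Longrightarrow> (f, g) \<in> T \<Longrightarrow> sgn (poly f z) = sgn (poly g (\<phi> z))"
  by (auto simp: sign_match_def)

lemma inc_bij_less_iff: "inc_bij \<phi> \<Longrightarrow> \<phi> x < \<phi> y \<longleftrightarrow> x < y"
  by (simp add: inc_bij_def strict_mono_less)

lemma inc_bij_eq_iff: "inc_bij \<phi> \<Longrightarrow> \<phi> x = \<phi> y \<longleftrightarrow> x = y"
  by (simp add: inc_bij_def strict_mono_eq)

lemma poly_sgn_const:
  fixes p :: "real poly"
  assumes "a \<le> b" "\<And>z. a \<le> z \<Longrightarrow> z \<le> b \<Longrightarrow> poly p z \<noteq> 0"
  shows "sgn (poly p a) = sgn (poly p b)"
proof (rule ccontr)
  assume "sgn (poly p a) \<noteq> sgn (poly p b)"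
  moreover have "poly p a \<noteq> 0" "poly p b \<noteq> 0" using assms by auto
  ultimately have "poly p a * poly p b < 0" and "a \<noteq> b"
    by (auto simp: sgn_if mult_less_0_iff split: if_splits)
  then obtain x where "a < x" "x < b" "poly p x = 0"
    using poly_IVT[of a b p] assms(1) by auto
  with assms(2) show False by force
qed

text \<open>Only the values of the bijection at the roots matter: a root of \<open>g\<close> between
  \<open>\<phi> z\<close> and \<open>\<psi> z\<close> would be of the form
  \<open>\<phi> c = \<psi> c\<close>, and both maps keep \<open>c\<close> on the same side of
  \<open>z\<close>.\<close>

lemma sgn_match_transfer:
  assumes \<phi>: "inc_bij \<phi>" and \<psi>: "inc_bij \<psi>" and eq: "\<And>c. c \<in> C \<Longrightarrow> \<psi> c = \<phi> c"
    and m: "\<And>z. sgn (poly f z) = sgn (poly g (\<phi> z))"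
    and roots: "\<And>z. f \<noteq> 0 \<Longrightarrow> poly f z = 0 \<Longrightarrow> z \<in> C"
  shows "sgn (poly f z) = sgn (poly g (\<psi> z))"
proof (cases "f = 0 \<or> z \<in> C")
  case True
  have "poly g w = 0" if "f = 0" for w
  proof -
    obtain y where "w = \<phi> y" using \<phi> by (auto simp: inc_bij_def surj_def)
    with m[of y] that show ?thesis by (simp add: sgn_0_0)
  qed
  with True show ?thesis using eq m by auto
next
  case False
  have no: "poly g w \<noteq> 0" if "min (\<phi> z) (\<psi> z) \<le> w" "w \<le> max (\<phi> z) (\<psi> z)" for w
  proof
    assume g: "poly g w = 0"
    obtain c where c: "w = \<phi> c" using \<phi> by (auto simp: inc_bij_def surj_def)
    with m[of c] g have "poly f c = 0" by (simp add: sgn_0_0)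
    with roots False have "c \<in> C" by blast
    with eq c have w: "w = \<psi> c" by simp
    have "c \<noteq> z" using False \<open>c \<in> C\<close> by blast
    then have "c < z \<or> z < c" by linarith
    then show False
    proof
      assume "c < z"
      then have "\<phi> c < \<phi> z" "\<psi> c < \<psi> z" using inc_bij_less_iff \<phi> \<psi> by auto
      with that c w show False by simp
    next
      assume "z < c"
      then have "\<phi> z < \<phi> c" "\<psi> z < \<psi> c" using inc_bij_less_iff \<phi> \<psi> by auto
      with that c w show False by simp
    qed
  qed
  have "sgn (poly g (min (\<phi> z) (\<psi> z))) = sgn (poly g (max (\<phi> z) (\<psi> z)))"
    by (rule poly_sgn_const) (use no in auto)
  then show ?thesis using m[of z] by (simp add: min_def max_def split: if_splits)
qed

text \<open>The points are added in increasing order: the map built so far is kept up to its last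
  point \<open>u\<close> and replaced beyond \<open>u\<close> by the line through the last two
  prescribed values.\<close>

lemma inc_bij_extend:
  assumes "finite A" "strict_mono_on A \<sigma>"
  shows "\<exists>\<psi>. inc_bij \<psi> \<and> (\<forall>a\<in>A. \<psi> a = \<sigma> a)"
  using assms
proof (induction A rule: finite_linorder_max_induct)
  case empty
  have "inc_bij (\<lambda>x. x)" by (auto simp: inc_bij_def strict_mono_def)
  then show ?case by auto
next
  case (insert b A)
  then obtain \<psi> where \<psi>: "inc_bij \<psi>" "\<forall>a\<in>A. \<psi> a = \<sigma> a"
    by (auto simp: strict_mono_on_def)
  show ?case
  proof (cases "A = {}")
    case True
    have "inc_bij (\<lambda>x. x + (\<sigma> b - b))"
      unfolding inc_bij_def surj_def strict_mono_def
      by (auto intro!: exI[of _ "y - (\<sigma> b - b)" for y])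
    with True show ?thesis by (intro exI[of _ "\<lambda>x. x + (\<sigma> b - b)"]) auto
  next
    case False
    define u where "u = Max A"
    have uA: "u \<in> A" and umax: "\<And>a. a \<in> A \<Longrightarrow> a \<le> u"
      using False insert.hyps by (auto simp: u_def)
    have ub: "u < b" using uA insert.hyps by auto
    have su: "\<psi> u = \<sigma> u" "\<sigma> u < \<sigma> b"
      using \<psi> uA ub insert.prems by (auto simp: strict_mono_on_def)
    define r where "r = (\<sigma> b - \<sigma> u) / (b - u)"
    have r: "r > 0" using su ub by (simp add: r_def)
    define \<psi>1 where "\<psi>1 = (\<lambda>x. if x \<le> u then \<psi> x else \<sigma> u + r * (x - u))"
    have psi: "\<psi> x < \<psi> y \<longleftrightarrow> x < y" for x y using inc_bij_less_iff \<psi> by blast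
    have "strict_mono \<psi>1"
    proof (rule strict_monoI)
      fix x y :: real assume "x < y"
      consider "y \<le> u" | "x \<le> u" "u < y" | "u < x" by linarith
      then show "\<psi>1 x < \<psi>1 y"
      proof cases
        case 1 then show ?thesis using \<open>x < y\<close> by (simp add: \<psi>1_def psi)
      next
        case 2
        have "\<psi> x \<le> \<psi> u" using 2 psi[of u x] by (meson not_less)
        moreover have "r * (y - u) > 0" using r 2 by simp
        ultimately show ?thesis using 2 su by (simp add: \<psi>1_def)
      next
        case 3 then show ?thesis using \<open>x < y\<close> r by (simp add: \<psi>1_def)
      qed
    qed
    moreover have "surj \<psi>1"
      unfolding surj_def
    proof
      fix y
      show "\<exists>x. y = \<psi>1 x"
      proof (cases "y \<le> \<sigma> u")
        case True
        obtain x where x: "y = \<psi> x" using \<psi> by (auto simp: inc_bij_def surj_def)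
        then have "x \<le> u" using True su psi[of u x] by (metis not_less)
        with x show ?thesis by (auto simp: \<psi>1_def)
      next
        case False
        then have "(y - \<sigma> u) / r > 0" using r by simp
        then have "y = \<psi>1 (u + (y - \<sigma> u) / r)" using r by (simp add: \<psi>1_def)
        then show ?thesis by blast
      qed
    qed
    moreover have "\<psi>1 a = \<sigma> a" if "a \<in> insert b A" for a
    proof (cases "a = b")
      case True
      then show ?thesis using ub by (simp add: \<psi>1_def r_def)
    next
      case False
      then show ?thesis using that umax \<psi> by (simp add: \<psi>1_def)
    qed
    ultimately show ?thesis by (auto simp: inc_bij_def)
  qed
qed

lemma poly_sgn_at_top:
  fixes p :: "real poly"
  shows "\<exists>U. \<forall>z\<ge>U. sgn (poly p z) = sgn (lead_coeff p)"
proof -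
  have pos: "\<exists>U. \<forall>z\<ge>U. sgn (poly q z) = 1" if "lead_coeff q > 0" for q :: "real poly"
    using poly_pinfty_gt_lc[OF that] that by (metis less_le_trans sgn_pos)
  consider "lead_coeff p > 0" | "lead_coeff p = 0" | "lead_coeff (- p) > 0" by fastforce
  then show ?thesis
  proof cases
    case 1 then show ?thesis using pos[of p] by simp
  next
    case 2 then show ?thesis by simp
  next
    case 3
    with pos[of "- p"] obtain U where "\<forall>z\<ge>U. sgn (poly (- p) z) = 1" by blast
    then have "- sgn (poly p z) = 1" if "z \<ge> U" for z using that by (metis poly_minus sgn_minus)
    then have "\<forall>z\<ge>U. sgn (poly p z) = - 1" by (metis minus_minus)
    with 3 show ?thesis by auto
  qed
qed

lemma poly_sgn_at_bot:
  fixes p :: "real poly"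
  shows "\<exists>L. \<forall>z\<le>L. sgn (poly p z) = sgn (lead_coeff p) * (- 1) ^ degree p"
proof -
  let ?q = "pcompose p [:0, -1:]"
  obtain U where U: "\<forall>z\<ge>U. sgn (poly ?q z) = sgn (lead_coeff ?q)"
    using poly_sgn_at_top by blast
  have "lead_coeff ?q = lead_coeff p * (- 1) ^ degree p"
    by (subst lead_coeff_comp) auto
  then have l: "sgn (lead_coeff ?q) = sgn (lead_coeff p) * (- 1) ^ degree p"
    by (simp add: sgn_mult minus_one_power_iff)
  have "sgn (poly p z) = sgn (lead_coeff p) * (- 1) ^ degree p" if "z \<le> - U" for z
    using U[rule_format, of "- z"] that l by (simp add: poly_pcompose)
  then show ?thesis by blast
qed

text \<open>The derivative has constant sign on the gap of \<open>C\<close> around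
  \<open>\<zeta>\<close>, so \<open>p\<close> has opposite nonzero signs at the two ends. These
  signs are shared by \<open>q\<close>, which therefore has a root in the corresponding gap.\<close>

lemma gap_root:
  fixes p q :: "real poly"
  assumes C: "finite C" and dr: "\<And>z. poly (pderiv p) z = 0 \<Longrightarrow> z \<in> C"
    and \<zeta>: "poly p \<zeta> = 0" "\<zeta> \<notin> C" and lo: "\<exists>c\<in>C. c < \<zeta>" and hi: "\<exists>c\<in>C. \<zeta> < c"
    and mono: "strict_mono_on C \<phi>"
    and s: "\<And>c. c \<in> C \<Longrightarrow> sgn (poly p c) = sgn (poly q (\<phi> c))"
  shows "\<exists>\<eta>. poly q \<eta> = 0 \<and> (\<forall>c\<in>C. (c < \<zeta> \<longrightarrow> \<phi> c < \<eta>) \<and> (\<zeta> < c \<longrightarrow> \<eta> < \<phi> c))"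
proof -
  define a where "a = Max {c\<in>C. c < \<zeta>}"
  define b where "b = Min {c\<in>C. \<zeta> < c}"
  have "a \<in> {c\<in>C. c < \<zeta>}" unfolding a_def by (rule Max_in) (use C lo in auto)
  then have a: "a \<in> C" "a < \<zeta>" by auto
  have "b \<in> {c\<in>C. \<zeta> < c}" unfolding b_def by (rule Min_in) (use C hi in auto)
  then have b: "b \<in> C" "\<zeta> < b" by auto
  have amax: "c \<le> a" if "c \<in> C" "c < \<zeta>" for c
    unfolding a_def by (rule Max_ge) (use C that in auto)
  have bmin: "b \<le> c" if "c \<in> C" "\<zeta> < c" for c
    unfolding b_def by (rule Min_le) (use C that in auto)
  have gap: "c \<notin> C" if "a < c" "c < b" for c
    using amax[of c] bmin[of c] that \<zeta>(2) by (cases c \<zeta> rule: linorder_cases) auto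
  obtain x where x: "a < x" "x < \<zeta>" "poly p \<zeta> - poly p a = (\<zeta> - a) * poly (pderiv p) x"
    using poly_MVT[OF a(2)] by blast
  obtain y where y: "\<zeta> < y" "y < b" "poly p b - poly p \<zeta> = (b - \<zeta>) * poly (pderiv p) y"
    using poly_MVT[OF b(2)] by blast
  have nz: "poly (pderiv p) z \<noteq> 0" if "a < z" "z < b" for z using gap dr that by blast
  have xy: "sgn (poly (pderiv p) x) = sgn (poly (pderiv p) y)"
    by (rule poly_sgn_const) (use nz x y in auto)
  have "poly (pderiv p) x \<noteq> 0" using nz x b by auto
  moreover have "sgn (poly p a) = - sgn (poly (pderiv p) x)"
  proof -
    have "poly p a = - ((\<zeta> - a) * poly (pderiv p) x)" using x(3) \<zeta> by simp
    then have "sgn (poly p a) = - (sgn (\<zeta> - a) * sgn (poly (pderiv p) x))"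
      by (simp only: sgn_minus sgn_mult)
    then show ?thesis using a by simp
  qed
  moreover have "sgn (poly p b) = sgn (poly (pderiv p) x)"
    using y(3) \<zeta> b xy by (simp add: sgn_mult)
  ultimately have "poly q (\<phi> a) * poly q (\<phi> b) < 0"
    using s[OF a(1)] s[OF b(1)] by (auto simp: sgn_if mult_less_0_iff split: if_splits)
  moreover have "\<phi> a < \<phi> b" using mono a b by (auto simp: strict_mono_on_def)
  ultimately obtain \<eta> where \<eta>: "\<phi> a < \<eta>" "\<eta> < \<phi> b" "poly q \<eta> = 0"
    using poly_IVT by blast
  have le: "\<phi> c \<le> \<phi> c'" if "c \<in> C" "c' \<in> C" "c \<le> c'" for c c'
    using mono that by (metis le_less strict_mono_on_def)
  have "\<phi> c < \<eta>" if "c \<in> C" "c < \<zeta>" for c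
    using le[OF that(1) a(1) amax[OF that]] \<eta> by simp
  moreover have "\<eta> < \<phi> c" if "c \<in> C" "\<zeta> < c" for c
    using le[OF b(1) that(1) bmin[OF that]] \<eta> by simp
  ultimately show ?thesis using \<eta>(3) by blast
qed

text \<open>The Cohen--Hoermander step: between consecutive roots of \<open>p'\<close> and of the members of \<open>T\<close>,
  \<open>p\<close> is monotone, so its roots there are read off from its signs at these roots.\<close>

lemma sign_match_insert:
  fixes p q :: "real poly"
  assumes \<phi>: "inc_bij \<phi>" and T: "finite T" and m: "sign_match \<phi> T"
    and pd: "(pderiv p, pderiv q) \<in> T" and deg: "degree p = degree q" "degree p \<ge> 1"
    and lc: "sgn (lead_coeff p) = sgn (lead_coeff q)"
    and root: "\<And>f g z. (f, g) \<in> T \<Longrightarrow> f \<noteq> 0 \<Longrightarrow> poly f z = 0 \<Longrightarrow> sgn (poly p z) = sgn (poly q (\<phi> z))"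
  shows "\<exists>\<psi>. inc_bij \<psi> \<and> sign_match \<psi> (insert (p, q) T)"
proof -
  define C0 where "C0 = (\<Union>(f, g)\<in>{fg \<in> T. fst fg \<noteq> 0}. {z. poly f z = 0})"
  have C0I: "z \<in> C0" if "(f, g) \<in> T" "f \<noteq> 0" "poly f z = 0" for f g z
    using that by (force simp: C0_def)
  have C0root: "sgn (poly p z) = sgn (poly q (\<phi> z))" if "z \<in> C0" for z
    using that root by (auto simp: C0_def)
  have finC0: "finite C0"
    unfolding C0_def using T poly_roots_finite by (intro finite_UN_I) auto
  have p0: "p \<noteq> 0" "q \<noteq> 0" using deg by auto
  have pd0: "pderiv p \<noteq> 0" "pderiv q \<noteq> 0" using deg by (auto simp: pderiv_eq_0_iff)
  define R where "R = {z. poly p z = 0}"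
  define R' where "R' = {z. poly q z = 0}"
  have finR: "finite R" "finite R'" using p0 poly_roots_finite by (auto simp: R_def R'_def)
  obtain L0 where L0: "\<forall>z\<le>L0. sgn (poly p z) = sgn (lead_coeff p) * (- 1) ^ degree p"
    using poly_sgn_at_bot by blast
  obtain M0 where M0: "\<forall>z\<le>M0. sgn (poly q z) = sgn (lead_coeff q) * (- 1) ^ degree q"
    using poly_sgn_at_bot by blast
  obtain U0 where U0: "\<forall>z\<ge>U0. sgn (poly p z) = sgn (lead_coeff p)" using poly_sgn_at_top by blast
  obtain V0 where V0: "\<forall>z\<ge>V0. sgn (poly q z) = sgn (lead_coeff q)" using poly_sgn_at_top by blast
  \<comment> \<open>\<open>L\<close>, \<open>U\<close> are artificial end points for
    \<open>p\<close>, and \<open>M\<close>, \<open>V\<close> those for \<open>q\<close>. They lie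
    beyond all roots, where the sign is that of the leading term; thus every root outside
    \<open>C\<close> lies in a gap between two points of \<open>C\<close>, also at the ends.\<close>
  define L where "L = Min (insert L0 (C0 \<union> R)) - 1"
  define M where "M = Min (insert M0 (\<phi> ` C0 \<union> R')) - 1"
  define U where "U = Max (insert U0 (insert L (C0 \<union> R))) + 1"
  define V where "V = Max (insert V0 (insert M (\<phi> ` C0 \<union> R'))) + 1"
  have Min1: "Min A - 1 < z" if "finite A" "z \<in> A" for A and z :: real
    using Min_le[OF that] by linarith
  have Max1: "z < Max A + 1" if "finite A" "z \<in> A" for A and z :: real
    using Max_ge[OF that] by linarith
  have L: "L < L0" "\<And>z. z \<in> C0 \<union> R \<Longrightarrow> L < z"
    unfolding L_def by (rule Min1; use finC0 finR in auto)+
  have M: "M < M0" "\<And>z. z \<in> \<phi> ` C0 \<union> R' \<Longrightarrow> M < z"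
    unfolding M_def by (rule Min1; use finC0 finR in auto)+
  have U: "U0 < U" "L < U" "\<And>z. z \<in> C0 \<union> R \<Longrightarrow> z < U"
    unfolding U_def by (rule Max1; use finC0 finR in auto)+
  have V: "V0 < V" "M < V" "\<And>z. z \<in> \<phi> ` C0 \<union> R' \<Longrightarrow> z < V"
    unfolding V_def by (rule Max1; use finC0 finR in auto)+
  define C where "C = insert L (insert U C0)"
  have finC: "finite C" using finC0 by (simp add: C_def)
  define \<sigma>0 where "\<sigma>0 z = (if z = L then M else if z = U then V else \<phi> z)" for z
  have "strict_mono_on C \<sigma>0"
    using L U M V inc_bij_less_iff[OF \<phi>]
    by (fastforce simp: strict_mono_on_def C_def \<sigma>0_def)
  then obtain \<phi>1 where \<phi>1: "inc_bij \<phi>1" "\<And>c. c \<in> C \<Longrightarrow> \<phi>1 c = \<sigma>0 c"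
    using inc_bij_extend[OF finC] by blast
  have \<phi>1C0: "\<phi>1 c = \<phi> c" if "c \<in> C0" for c
    using \<phi>1(2)[of c] that L(2)[of c] U(3)[of c] by (auto simp: C_def \<sigma>0_def)
  have \<phi>1L: "\<phi>1 L = M" "\<phi>1 U = V" using \<phi>1(2)[of L] \<phi>1(2)[of U] U(2) by (auto simp: C_def \<sigma>0_def)
  have m1: "sgn (poly f z) = sgn (poly g (\<phi>1 z))" if "(f, g) \<in> T" for f g z
    by (rule sgn_match_transfer[OF \<phi> \<phi>1(1), where C = C0])
       (use \<phi>1C0 C0I that sign_matchD[OF m] in auto)
  have sC: "sgn (poly p c) = sgn (poly q (\<phi>1 c))" if "c \<in> C" for c
  proof -
    consider "c = L" | "c = U" | "c \<in> C0" using \<open>c \<in> C\<close> by (auto simp: C_def)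
    then show ?thesis
    proof cases
      case 1 then show ?thesis using L0 M0 L(1) M(1) \<phi>1L lc deg by simp
    next
      case 2 then show ?thesis using U0 V0 U(1) V(1) \<phi>1L lc by simp
    next
      case 3 then show ?thesis using C0root \<phi>1C0 by simp
    qed
  qed
  have dpC: "z \<in> C" if "poly (pderiv p) z = 0" for z
    using C0I[OF pd pd0(1) that] by (simp add: C_def)
  have dqC: "z \<in> \<phi>1 ` C" if "poly (pderiv q) z = 0" for z
  proof -
    obtain y where y: "z = \<phi>1 y" using \<phi>1(1) by (auto simp: inc_bij_def surj_def)
    with m1[OF pd, of y] that have "poly (pderiv p) y = 0" by (simp add: sgn_0_0)
    then show ?thesis using dpC y by blast
  qed
  have mono1: "strict_mono_on C \<phi>1" using \<phi>1(1) by (auto simp: inc_bij_def strict_mono_on_def strict_mono_less)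
  have pq: "\<exists>\<eta>. poly q \<eta> = 0 \<and> (\<forall>c\<in>C. (c < \<zeta> \<longrightarrow> \<phi>1 c < \<eta>) \<and> (\<zeta> < c \<longrightarrow> \<eta> < \<phi>1 c))"
    if "poly p \<zeta> = 0" "\<zeta> \<notin> C" for \<zeta>
    by (rule gap_root[OF finC dpC that _ _ mono1 sC]) (use L U that in \<open>auto simp: C_def R_def\<close>)
  \<comment> \<open>The same argument with the roles of \<open>p\<close> and \<open>q\<close>
    exchanged and the bijection inverted.\<close>
  have qp: "\<exists>\<zeta>. poly p \<zeta> = 0 \<and> (\<forall>c\<in>C. (\<phi>1 c < \<eta> \<longrightarrow> c < \<zeta>) \<and> (\<eta> < \<phi>1 c \<longrightarrow> \<zeta> < c))"
    if \<eta>: "poly q \<eta> = 0" "\<eta> \<notin> \<phi>1 ` C" for \<eta>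
  proof -
    have i: "inv \<phi>1 (\<phi>1 c) = c" for c
      using \<phi>1(1) by (simp add: inc_bij_def strict_mono_imp_inj_on)
    have "\<exists>\<zeta>. poly p \<zeta> = 0 \<and> (\<forall>c\<in>\<phi>1 ` C. (c < \<eta> \<longrightarrow> inv \<phi>1 c < \<zeta>) \<and> (\<eta> < c \<longrightarrow> \<zeta> < inv \<phi>1 c))"
    proof (rule gap_root[OF _ dqC \<eta>])
      show "\<exists>c\<in>\<phi>1 ` C. c < \<eta>" "\<exists>c\<in>\<phi>1 ` C. \<eta> < c"
        using \<phi>1L M(2)[of \<eta>] V(3)[of \<eta>] \<eta>(1) by (auto simp: R'_def C_def)
      show "strict_mono_on (\<phi>1 ` C) (inv \<phi>1)"
        using inc_bij_less_iff[OF \<phi>1(1)] by (auto simp: strict_mono_on_def i)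
    qed (use finC sC i in auto)
    then show ?thesis by (auto simp: i)
  qed
  define \<sigma> where "\<sigma> z = (if z \<in> C then \<phi>1 z else
      SOME \<eta>. poly q \<eta> = 0 \<and> (\<forall>c\<in>C. (c < z \<longrightarrow> \<phi>1 c < \<eta>) \<and> (z < c \<longrightarrow> \<eta> < \<phi>1 c)))" for z
  have \<sigma>C: "\<sigma> c = \<phi>1 c" if "c \<in> C" for c using that by (simp add: \<sigma>_def)
  have \<sigma>R: "poly q (\<sigma> z) = 0 \<and> (\<forall>c\<in>C. (c < z \<longrightarrow> \<phi>1 c < \<sigma> z) \<and> (z < c \<longrightarrow> \<sigma> z < \<phi>1 c))"
    if "z \<in> R" "z \<notin> C" for z
    using someI_ex[OF pq[of z]] that by (simp add: \<sigma>_def R_def)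
  have between: "\<exists>c\<in>C. x < c \<and> c < y" if "x \<in> R" "y \<in> R" "x < y" for x y
    using poly_MVT[OF that(3), of p] that dpC by (auto simp: R_def)
  have between': "\<exists>c\<in>C. x < \<phi>1 c \<and> \<phi>1 c < y" if "poly q x = 0" "poly q y = 0" "x < y" for x y
    using poly_MVT[OF that(3), of q] that dqC by auto
  have "strict_mono_on (C \<union> R) \<sigma>"
  proof (unfold strict_mono_on_def, intro allI impI)
    fix r s assume "r \<in> C \<union> R \<and> s \<in> C \<union> R \<and> r < s"
    then have rs: "r \<in> C \<union> R" "s \<in> C \<union> R" "r < s" by auto
    consider "r \<in> C" "s \<in> C" | "r \<in> C" "s \<notin> C" | "r \<notin> C" "s \<in> C" | "r \<notin> C" "s \<notin> C" by blast
    then show "\<sigma> r < \<sigma> s"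
    proof cases
      case 1 then show ?thesis using rs \<sigma>C inc_bij_less_iff[OF \<phi>1(1)] by simp
    next
      case 2 then show ?thesis using rs \<sigma>C \<sigma>R[of s] by auto
    next
      case 3 then show ?thesis using rs \<sigma>C \<sigma>R[of r] by auto
    next
      case 4
      then obtain c where "c \<in> C" "r < c" "c < s" using between rs by blast
      then have "\<sigma> r < \<phi>1 c" "\<phi>1 c < \<sigma> s" using \<sigma>R[of r] \<sigma>R[of s] 4 rs by auto
      then show ?thesis by simp
    qed
  qed
  then obtain \<psi> where \<psi>: "inc_bij \<psi>" "\<And>a. a \<in> C \<union> R \<Longrightarrow> \<psi> a = \<sigma> a"
    using inc_bij_extend[of "C \<union> R" \<sigma>] finC finR by blast
  have psi: "\<psi> x < \<psi> y \<longleftrightarrow> x < y" for x y using inc_bij_less_iff[OF \<psi>(1)] .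
  have \<psi>C: "\<psi> c = \<phi>1 c" if "c \<in> C" for c using \<psi>(2) \<sigma>C that by simp
  have m2: "sgn (poly f z) = sgn (poly g (\<psi> z))" if "(f, g) \<in> T" for f g z
    by (rule sgn_match_transfer[OF \<phi>1(1) \<psi>(1), where C = C0])
       (use \<psi>C C0I that m1 in \<open>auto simp: C_def\<close>)
  \<comment> \<open>No root of \<open>q\<close> is missed: two distinct roots of \<open>q\<close>
    are separated by a root of its derivative, hence by the image of a point of \<open>C\<close>,
    whereas \<open>w\<close> and \<open>\<sigma> \<zeta>\<close> lie in the same gap.\<close>
  have qroot: "\<exists>a\<in>C \<union> R. w = \<psi> a" if w: "poly q w = 0" for w
  proof (cases "w \<in> \<phi>1 ` C")
    case True
    then show ?thesis using \<psi>C by (metis UnI1 imageE)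
  next
    case False
    obtain \<zeta> where \<zeta>: "poly p \<zeta> = 0" "\<And>c. c \<in> C \<Longrightarrow> (\<phi>1 c < w \<longrightarrow> c < \<zeta>) \<and> (w < \<phi>1 c \<longrightarrow> \<zeta> < c)"
      using qp[OF w False] by blast
    have "\<zeta> \<notin> C" using \<zeta>(2)[of \<zeta>] False by (metis image_eqI linorder_neqE_linordered_idom less_irrefl)
    have \<zeta>R: "\<zeta> \<in> R" using \<zeta>(1) by (simp add: R_def)
    note s = \<sigma>R[OF \<zeta>R \<open>\<zeta> \<notin> C\<close>]
    have "\<not> w < \<sigma> \<zeta>"
    proof
      assume "w < \<sigma> \<zeta>"
      then obtain c where "c \<in> C" "w < \<phi>1 c" "\<phi>1 c < \<sigma> \<zeta>" using between' w s by blast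
      with s \<zeta>(2)[of c] show False by force
    qed
    moreover have "\<not> \<sigma> \<zeta> < w"
    proof
      assume "\<sigma> \<zeta> < w"
      then obtain c where "c \<in> C" "\<sigma> \<zeta> < \<phi>1 c" "\<phi>1 c < w" using between' w s by blast
      with s \<zeta>(2)[of c] show False by force
    qed
    ultimately have "w = \<psi> \<zeta>" using \<psi>(2) \<zeta>R by simp
    with \<zeta>R show ?thesis by blast
  qed
  have "sgn (poly p z) = sgn (poly q (\<psi> z))" for z
  proof -
    consider "z \<in> C" | "z \<in> R" "z \<notin> C" | "z < L" | "z \<notin> C \<union> R" "L < z"
      by (cases z L rule: linorder_cases) (auto simp: C_def)
    then show ?thesis
    proof cases
      case 1 then show ?thesis using sC \<psi>C by simp
    next
      case 2 then show ?thesis using \<sigma>R[of z] \<psi>(2)[of z] by (simp add: R_def)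
    next
      case 3
      have "\<psi> z < M" using 3 psi[of z L] \<psi>C[of L] \<phi>1L by (simp add: C_def)
      then show ?thesis using L0 M0 L(1) M(1) 3 lc deg by simp
    next
      case 4
      define a where "a = Max {c \<in> C \<union> R. c < z}"
      have "a \<in> {c \<in> C \<union> R. c < z}" unfolding a_def
        by (rule Max_in) (use finC finR 4 in \<open>auto simp: C_def\<close>)
      then have a: "a \<in> C \<union> R" "a < z" by auto
      have amax: "c \<le> a" if "c \<in> C \<union> R" "c < z" for c
        unfolding a_def by (rule Max_ge) (use finC finR that in auto)
      have gap: "c \<notin> C \<union> R" if "a < c" "c \<le> z" for c
        using amax[of c] that 4 by (cases "c = z") auto
      have psia: "\<psi> a < \<psi> z" using a psi by simp
      have gap': "\<psi> c \<notin> \<psi> ` (C \<union> R)" if "a < c" "c \<le> z" for c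
        using gap[OF that] by (auto simp: inc_bij_eq_iff[OF \<psi>(1)])
      have surj: "\<exists>c. w = \<psi> c" for w using \<psi>(1) by (auto simp: inc_bij_def surj_def)
      have gapw: "w \<notin> \<psi> ` (C \<union> R)" if "\<psi> a < w" "w \<le> \<psi> z" for w
      proof -
        obtain c where c: "w = \<psi> c" using surj by blast
        have "a < c" "c \<le> z" using that c psi[of a c] psi[of z c] by auto
        then show ?thesis unfolding c by (rule gap')
      qed
      have sa: "sgn (poly p a) = sgn (poly q (\<psi> a))"
        using a sC \<psi>C \<sigma>R[of a] \<psi>(2)[of a] by (cases "a \<in> C") (auto simp: R_def)
      show ?thesis
      proof (cases "poly p a = 0")
        case False
        have "sgn (poly p a) = sgn (poly p z)"
        proof (rule poly_sgn_const)
          show "poly p w \<noteq> 0" if "a \<le> w" "w \<le> z" for w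
            using gap[of w] that False by (cases "w = a") (auto simp: R_def)
        qed (use a in simp)
        moreover have "sgn (poly q (\<psi> a)) = sgn (poly q (\<psi> z))"
        proof (rule poly_sgn_const)
          fix w assume w: "\<psi> a \<le> w" "w \<le> \<psi> z"
          show "poly q w \<noteq> 0"
          proof
            assume "poly q w = 0"
            then have "w \<in> \<psi> ` (C \<union> R)" using qroot by blast
            with gapw w have "w = \<psi> a" by force
            with sa \<open>poly q w = 0\<close> False show False by (simp add: sgn_0_0)
          qed
        qed (use psia in simp)
        ultimately show ?thesis using sa by simp
      next
        case True
        then have qa: "poly q (\<psi> a) = 0" using sa by (simp add: sgn_0_0)
        obtain x where x: "a < x" "x < z" "poly p z - poly p a = (z - a) * poly (pderiv p) x"
          using poly_MVT[OF a(2)] by blast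
        obtain y where y: "\<psi> a < y" "y < \<psi> z" "poly q (\<psi> z) - poly q (\<psi> a) = (\<psi> z - \<psi> a) * poly (pderiv q) y"
          using poly_MVT[OF psia] by blast
        \<comment> \<open>To the right of a root and before the next point of
          \<open>C \<union> R\<close>, the sign of \<open>p\<close> is that of its derivative, which
          belongs to \<open>T\<close> and is matched already.\<close>
        have "sgn (poly p z) = sgn (poly (pderiv p) x)" using x(3) True a by (simp add: sgn_mult)
        also have "\<dots> = sgn (poly (pderiv p) z)"
          by (rule poly_sgn_const) (use x gap dpC in force)+
        also have "\<dots> = sgn (poly (pderiv q) (\<psi> z))" using m2[OF pd] .
        also have "\<dots> = sgn (poly (pderiv q) y)"
        proof (rule sym, rule poly_sgn_const)
          fix w assume w: "y \<le> w" "w \<le> \<psi> z"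
          show "poly (pderiv q) w \<noteq> 0"
          proof
            assume "poly (pderiv q) w = 0"
            then have "w \<in> \<psi> ` (C \<union> R)" using dqC \<psi>C by force
            with gapw[of w] w y show False by simp
          qed
        qed (use y in simp)
        also have "\<dots> = sgn (poly q (\<psi> z))" using y(3) qa psia by (simp add: sgn_mult)
        finally show ?thesis .
      qed
    qed
  qed
  with m2 have "sign_match \<psi> (insert (p, q) T)" by (auto simp: sign_match_def)
  with \<psi>(1) show ?thesis by blast
qed

section \<open>Univariate polynomials with coefficients depending on parameters\<close>

definition fun_ring :: "('x \<Rightarrow> real) set \<Rightarrow> bool" where
  "fun_ring R \<longleftrightarrow> (\<forall>c. (\<lambda>_. c) \<in> R) \<and>
     (\<forall>f\<in>R. \<forall>g\<in>R. (\<lambda>x. f x + g x) \<in> R \<and> (\<lambda>x. f x * g x) \<in> R)"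

lemma fun_ringD:
  assumes "fun_ring R"
  shows "(\<lambda>_. c) \<in> R" "f \<in> R \<Longrightarrow> g \<in> R \<Longrightarrow> (\<lambda>x. f x + g x) \<in> R"
    "f \<in> R \<Longrightarrow> g \<in> R \<Longrightarrow> (\<lambda>x. f x * g x) \<in> R"
    "f \<in> R \<Longrightarrow> g \<in> R \<Longrightarrow> (\<lambda>x. f x - g x) \<in> R"
proof -
  show *: "(\<lambda>_. c) \<in> R" "f \<in> R \<Longrightarrow> g \<in> R \<Longrightarrow> (\<lambda>x. f x + g x) \<in> R"
    "f \<in> R \<Longrightarrow> g \<in> R \<Longrightarrow> (\<lambda>x. f x * g x) \<in> R" for c f g
    using assms by (auto simp: fun_ring_def)
  show "(\<lambda>x. f x - g x) \<in> R" if "f \<in> R" "g \<in> R"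
    using *(2)[OF that(1) *(3)[OF *(1)[of "-1"] that(2)]] by simp
qed

text \<open>The bound \<open>n\<close> holds for all parameters, but the formal leading coefficient
  may vanish at some of them; the actual degree is recovered later by cutting off.\<close>

definition Par :: "('x \<Rightarrow> real) set \<Rightarrow> nat \<Rightarrow> ('x \<Rightarrow> real poly) set" where
  "Par R n = {P. (\<forall>x. degree (P x) \<le> n) \<and> (\<forall>i. (\<lambda>x. coeff (P x) i) \<in> R)}"

lemma Par_mono: "P \<in> Par R n \<Longrightarrow> n \<le> m \<Longrightarrow> P \<in> Par R m"
  unfolding Par_def by (blast intro: order_trans)

lemma Par_coeff_0: "P \<in> Par R n \<Longrightarrow> n < i \<Longrightarrow> coeff (P x) i = 0"
  by (rule coeff_eq_0, rule le_less_trans[of _ n]) (simp_all add: Par_def)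

lemma Par_pderiv:
  assumes "fun_ring R" "P \<in> Par R (Suc n)" shows "(\<lambda>x. pderiv (P x)) \<in> Par R n"
proof -
  have "degree (pderiv (P x)) \<le> n" for x
  proof -
    have "degree (P x) \<le> Suc n" using assms(2) by (simp add: Par_def)
    then show ?thesis by (simp add: degree_pderiv)
  qed
  moreover have "(\<lambda>x. coeff (pderiv (P x)) i) \<in> R" for i
  proof -
    have "(\<lambda>x. coeff (P x) (Suc i)) \<in> R" using assms(2) by (simp add: Par_def)
    from fun_ringD(3)[OF assms(1) fun_ringD(1)[OF assms(1)] this, of "of_nat (Suc i)"]
    show ?thesis by (simp add: coeff_pderiv)
  qed
  ultimately show ?thesis by (auto simp: Par_def)
qed

lemma Par_cutoff:
  assumes "fun_ring R" "P \<in> Par R n" shows "(\<lambda>x. poly_cutoff (Suc m) (P x)) \<in> Par R m"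
proof -
  have "degree (poly_cutoff (Suc m) (P x)) \<le> m" for x
    by (rule degree_le) (auto simp: coeff_poly_cutoff)
  moreover have "(\<lambda>x. coeff (poly_cutoff (Suc m) (P x)) i) \<in> R" for i
    using assms fun_ringD(1)[OF assms(1), of 0]
    by (cases "i < Suc m") (auto simp: coeff_poly_cutoff Par_def)
  ultimately show ?thesis by (auto simp: Par_def)
qed

lemma poly_cutoff_eq:
  assumes "\<And>i. m < i \<Longrightarrow> coeff p i = 0" shows "poly_cutoff (Suc m) p = p"
  by (rule poly_eqI) (use assms in \<open>auto simp: coeff_poly_cutoff\<close>)

text \<open>The even exponent keeps the sign of \<open>P\<close> at the roots of \<open>T\<close>.\<close>

lemma pseudo_remainder:
  assumes R: "fun_ring R" and P: "P \<in> Par R n" and T: "T \<in> Par R m" and m: "m \<ge> 1"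
  shows "\<exists>Q e. Q \<in> Par R (m - 1) \<and>
    (\<forall>x z. poly (T x) z = 0 \<longrightarrow> coeff (T x) m ^ (2 * e) * poly (P x) z = poly (Q x) z)"
  using P
proof (induction n arbitrary: P)
  case 0
  then have "P \<in> Par R (m - 1)" by (rule Par_mono) simp
  then show ?case by (intro exI[of _ P] exI[of _ 0]) simp
next
  case (Suc n)
  show ?case
  proof (cases "Suc n < m")
    case True
    then have "P \<in> Par R (m - 1)" using Suc.prems by (intro Par_mono[OF Suc.prems]) simp
    then show ?thesis by (intro exI[of _ P] exI[of _ 0]) simp
  next
    case False
    define k where "k = Suc n - m"
    define P1 where "P1 = (\<lambda>x. smult (coeff (T x) m * coeff (T x) m) (P x)
        - smult (coeff (T x) m * coeff (P x) (Suc n)) (monom 1 k * T x))"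
    have cR: "(\<lambda>x. coeff (P x) i) \<in> R" "(\<lambda>x. coeff (T x) i) \<in> R" for i
      using Suc.prems T by (auto simp: Par_def)
    have "(\<lambda>x. coeff (P1 x) i) \<in> R" for i
    proof -
      have "(\<lambda>x. coeff (monom 1 k * T x) i) \<in> R"
        using cR(2)[of "i - k"] fun_ringD(1)[OF R, of 0]
        by (cases "i < k") (auto simp: coeff_monom_mult)
      then show ?thesis unfolding P1_def coeff_diff coeff_smult
        by (intro fun_ringD[OF R] cR)
    qed
    moreover have "degree (P1 x) \<le> n" for x
    proof (rule degree_le, intro allI impI)
      fix i assume "n < i"
      show "coeff (P1 x) i = 0"
      proof (cases "i = Suc n")
        case True
        then have "k \<le> i" "i - k = m" using False by (auto simp: k_def)
        then show ?thesis using True by (simp add: P1_def coeff_monom_mult)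
      next
        case i: False
        then have "Suc n < i" "m < i - k" using \<open>n < i\<close> False by (auto simp: k_def)
        then show ?thesis using Par_coeff_0[OF Suc.prems] Par_coeff_0[OF T]
          by (simp add: P1_def coeff_monom_mult)
      qed
    qed
    ultimately have "P1 \<in> Par R n" by (simp add: Par_def)
    from Suc.IH[OF this] obtain Q e where Q: "Q \<in> Par R (m - 1)"
      "\<And>x z. poly (T x) z = 0 \<Longrightarrow> coeff (T x) m ^ (2 * e) * poly (P1 x) z = poly (Q x) z" by blast
    have "coeff (T x) m ^ (2 * Suc e) * poly (P x) z = poly (Q x) z" if "poly (T x) z = 0" for x z
      using Q(2)[OF that] that by (simp add: P1_def algebra_simps power2_eq_square)
    with Q(1) show ?thesis by blast
  qed
qed

text \<open>Elimination of one quantifier without formulas: finitely many signs of coefficient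
  expressions decide the whole sign diagram of the family.\<close>

definition sign_determined :: "('x \<Rightarrow> real) set \<Rightarrow> ('x \<Rightarrow> real poly) set \<Rightarrow> bool" where
  "sign_determined R \<F> \<longleftrightarrow> (\<exists>\<G>. finite \<G> \<and> \<G> \<subseteq> R \<and> (\<forall>x y. (\<forall>G\<in>\<G>. sgn (G x) = sgn (G y)) \<longrightarrow>
     (\<exists>\<phi>. inc_bij \<phi> \<and> sign_match \<phi> ((\<lambda>P. (P x, P y)) ` \<F>))))"

text \<open>\<open>P\<close> is traded for members of degree at most \<open>n\<close>, to which the
  hypothesis applies: its derivative, its truncation (for the parameters where the top coefficient
  vanishes), and its pseudo-remainders, which carry the signs of \<open>P\<close> at the roots of
  the other members.\<close>

lemma sign_determined_step:
  assumes R: "fun_ring R" and S: "finite S" "S \<subseteq> Par R (Suc n)" and P: "P \<in> Par R (Suc n)"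
    and IH: "\<And>\<F>0. finite \<F>0 \<Longrightarrow> \<F>0 \<subseteq> Par R n \<Longrightarrow> sign_determined R (\<F>0 \<union> S)"
    and F0: "finite \<F>0" "\<F>0 \<subseteq> Par R n"
  shows "sign_determined R (\<F>0 \<union> insert P S)"
proof -
  define P' where "P' = (\<lambda>x. pderiv (P x))"
  define T0 where "T0 = insert P' (\<F>0 \<union> S)"
  have P': "P' \<in> Par R n" unfolding P'_def by (rule Par_pderiv[OF R P])
  have T0: "finite T0" "T0 \<subseteq> Par R (Suc n)"
    using F0 S P' Par_mono[of _ R n "Suc n"] by (auto simp: T0_def)
  \<comment> \<open>The degree of \<open>F x\<close> varies with \<open>x\<close>, so a
    pseudo-remainder modulo the truncation of \<open>F\<close> is taken for every possible degree
    \<open>m\<close> in advance.\<close>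
  have "\<forall>F\<in>T0. \<forall>m\<in>{1..Suc n}. \<exists>Q e. Q \<in> Par R (m - 1) \<and>
    (\<forall>x z. poly (poly_cutoff (Suc m) (F x)) z = 0 \<longrightarrow>
       coeff (poly_cutoff (Suc m) (F x)) m ^ (2 * e) * poly (P x) z = poly (Q x) z)"
  proof (intro ballI)
    fix F m assume "F \<in> T0" "m \<in> {1..Suc n}"
    then show "\<exists>Q e. Q \<in> Par R (m - 1) \<and>
      (\<forall>x z. poly (poly_cutoff (Suc m) (F x)) z = 0 \<longrightarrow>
         coeff (poly_cutoff (Suc m) (F x)) m ^ (2 * e) * poly (P x) z = poly (Q x) z)"
      using T0(2) by (intro pseudo_remainder[OF R P] Par_cutoff[OF R]) auto
  qed
  then obtain Q e where Q: "\<And>F m. F \<in> T0 \<Longrightarrow> m \<in> {1..Suc n} \<Longrightarrow> Q F m \<in> Par R (m - 1)"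
    "\<And>F m x z. F \<in> T0 \<Longrightarrow> m \<in> {1..Suc n} \<Longrightarrow> poly (poly_cutoff (Suc m) (F x)) z = 0 \<Longrightarrow>
       coeff (poly_cutoff (Suc m) (F x)) m ^ (2 * e F m) * poly (P x) z = poly (Q F m x) z"
    by metis
  define P0 where "P0 = (\<lambda>x. poly_cutoff (Suc n) (P x))"
  define \<F>1 where "\<F>1 = \<F>0 \<union> {P', P0} \<union> (\<lambda>(F, m). Q F m) ` (T0 \<times> {1..Suc n})"
  have "Q F m \<in> Par R n" if "F \<in> T0" "m \<in> {1..Suc n}" for F m
    using that by (intro Par_mono[OF Q(1)]) auto
  moreover have "P0 \<in> Par R n" unfolding P0_def by (rule Par_cutoff[OF R P])
  ultimately have F1: "finite \<F>1" "\<F>1 \<subseteq> Par R n"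
    using F0 T0 P' by (auto simp: \<F>1_def)
  from IH[OF F1] obtain \<G>1 where G1: "finite \<G>1" "\<G>1 \<subseteq> R"
    "\<And>x y. \<forall>G\<in>\<G>1. sgn (G x) = sgn (G y) \<Longrightarrow>
       \<exists>\<phi>. inc_bij \<phi> \<and> sign_match \<phi> ((\<lambda>P. (P x, P y)) ` (\<F>1 \<union> S))"
    unfolding sign_determined_def by blast
  \<comment> \<open>The coefficients are added to force equal degrees, and equal leading signs, at
    \<open>x\<close> and \<open>y\<close>.\<close>
  define \<G> where "\<G> = \<G>1 \<union> (\<lambda>(F, i) x. coeff (F x) i) ` (insert P T0 \<times> {..Suc n})"
  have "finite \<G>" using G1 T0 by (simp add: \<G>_def)
  moreover have "\<G> \<subseteq> R" using G1 T0(2) P by (auto simp: \<G>_def Par_def)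
  moreover have "\<exists>\<psi>. inc_bij \<psi> \<and> sign_match \<psi> ((\<lambda>P. (P x, P y)) ` (\<F>0 \<union> insert P S))"
    if xy: "\<forall>G\<in>\<G>. sgn (G x) = sgn (G y)" for x y
  proof -
    have "\<forall>G\<in>\<G>1. sgn (G x) = sgn (G y)" using xy by (simp add: \<G>_def ball_Un)
    then obtain \<phi> where \<phi>: "inc_bij \<phi>" "sign_match \<phi> ((\<lambda>P. (P x, P y)) ` (\<F>1 \<union> S))"
      using G1(3) by blast
    have mt: "sgn (poly (F x) z) = sgn (poly (F y) (\<phi> z))" if "F \<in> \<F>1 \<union> S" for F z
      using \<phi>(2) that by (auto simp: sign_match_def)
    have co: "sgn (coeff (F x) i) = sgn (coeff (F y) i)" if "F \<in> insert P T0" for F i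
    proof (cases "i \<le> Suc n")
      case True
      then have "(\<lambda>x. coeff (F x) i) \<in> \<G>" using that by (force simp: \<G>_def)
      then show ?thesis using xy by fast
    next
      case False
      then show ?thesis using Par_coeff_0[of F R "Suc n" i] that P T0 by (metis insert_iff not_le subsetD)
    qed
    have T0sub: "T0 \<subseteq> \<F>1 \<union> S" by (auto simp: T0_def \<F>1_def)
    have co0: "coeff (F x) i = 0 \<longleftrightarrow> coeff (F y) i = 0" if "F \<in> insert P T0" for F i
      using co[OF that, of i] by (metis sgn_0_0)
    show ?thesis
    proof (cases "coeff (P x) (Suc n) = 0")
      case True
      have zero: "coeff (P x) i = 0" "coeff (P y) i = 0" if "n < i" for i
        using True co0[of P "Suc n"] Par_coeff_0[OF P, of i] that by (cases "i = Suc n"; simp)+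
      then have "P0 x = P x" "P0 y = P y" by (auto simp: P0_def poly_cutoff_eq)
      then have "sgn (poly (P x) z) = sgn (poly (P y) (\<phi> z))" for z
        using mt[of P0 z] by (simp add: \<F>1_def)
      then have "sign_match \<phi> ((\<lambda>P. (P x, P y)) ` (\<F>0 \<union> insert P S))"
        using mt by (auto simp: sign_match_def \<F>1_def)
      with \<phi>(1) show ?thesis by blast
    next
      case False
      have degP: "degree (P x) = Suc n" "degree (P y) = Suc n"
        using False co0[of P "Suc n"] P by (auto simp: Par_def intro!: antisym le_degree)
      have "\<exists>\<psi>. inc_bij \<psi> \<and> sign_match \<psi> (insert (P x, P y) ((\<lambda>P. (P x, P y)) ` T0))"
      proof (rule sign_match_insert[OF \<phi>(1)])
        show "sign_match \<phi> ((\<lambda>P. (P x, P y)) ` T0)"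
          using mt T0sub by (auto simp: sign_match_def)
        show "(pderiv (P x), pderiv (P y)) \<in> (\<lambda>P. (P x, P y)) ` T0"
          by (force simp: T0_def P'_def)
        show "sgn (lead_coeff (P x)) = sgn (lead_coeff (P y))" using co[of P "Suc n"] degP by simp
      next
        fix f g z assume "(f, g) \<in> (\<lambda>P. (P x, P y)) ` T0" and f: "f \<noteq> 0" "poly f z = 0"
        then obtain F where F: "F \<in> T0" "f = F x" "g = F y" by auto
        define m where "m = degree (F x)"
        have "m \<noteq> 0"
        proof
          assume "m = 0"
          then obtain c where "F x = [:c:]" using degree_eq_zeroE unfolding m_def by blast
          with f F show False by simp
        qed
        moreover have "m \<le> Suc n" using F T0 by (auto simp: m_def Par_def)
        ultimately have m: "m \<in> {1..Suc n}" by simp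
        have "coeff (F x) i = 0" "coeff (F y) i = 0" if "m < i" for i
          using that co0[of F i] F by (auto simp: m_def coeff_eq_0)
        then have cut: "poly_cutoff (Suc m) (F x) = F x" "poly_cutoff (Suc m) (F y) = F y"
          by (auto intro: poly_cutoff_eq)
        have cx: "coeff (F x) m \<noteq> 0" using f F by (simp add: m_def)
        then have cy: "coeff (F y) m \<noteq> 0" using co0[of F m] F by simp
        have "poly (F y) (\<phi> z) = 0" using mt[of F z] F T0sub f by (auto simp: sgn_0_0)
        then have "coeff (F y) m ^ (2 * e F m) * poly (P y) (\<phi> z) = poly (Q F m y) (\<phi> z)"
          using Q(2)[OF F(1) m, of y "\<phi> z"] cut by simp
        moreover have "coeff (F x) m ^ (2 * e F m) * poly (P x) z = poly (Q F m x) z"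
          using Q(2)[OF F(1) m, of x z] cut f F by simp
        moreover have "sgn (poly (Q F m x) z) = sgn (poly (Q F m y) (\<phi> z))"
          by (rule mt) (use F m in \<open>force simp: \<F>1_def\<close>)
        moreover have "coeff (F x) m ^ (2 * e F m) > 0" "coeff (F y) m ^ (2 * e F m) > 0"
          using cx cy by (simp_all add: zero_less_power_eq)
        ultimately show "sgn (poly (P x) z) = sgn (poly (P y) (\<phi> z))"
          by (metis sgn_mult sgn_pos mult_1)
      qed (use T0 degP in auto)
      then obtain \<psi> where "inc_bij \<psi>" "sign_match \<psi> (insert (P x, P y) ((\<lambda>P. (P x, P y)) ` T0))"
        by blast
      then show ?thesis by (intro exI[of _ \<psi>]) (auto simp: sign_match_def T0_def)
    qed
  qed
  ultimately show ?thesis unfolding sign_determined_def by blast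
qed

text \<open>Outer induction on the degree, inner induction on the number of members that may attain
  it.\<close>

lemma sign_determined_finite:
  assumes R: "fun_ring R" and "finite \<F>" "\<F> \<subseteq> Par R n"
  shows "sign_determined R \<F>"
  using assms(2,3)
proof (induction n arbitrary: \<F>)
  case 0
  show ?case unfolding sign_determined_def
  proof (intro exI[of _ "(\<lambda>P x. coeff (P x) 0) ` \<F>"] conjI allI impI)
    fix x y assume xy: "\<forall>G\<in>(\<lambda>P x. coeff (P x) 0) ` \<F>. sgn (G x) = sgn (G y)"
    have "poly (P x) z = coeff (P x) 0" if "P \<in> \<F>" for P x z
    proof -
      have "P \<in> Par R 0" using that 0 by blast
      then have "degree (P x) = 0" by (simp add: Par_def)
      then obtain c where "P x = [:c:]" by (rule degree_eq_zeroE)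
      then show ?thesis by simp
    qed
    then have "sign_match (\<lambda>z. z) ((\<lambda>P. (P x, P y)) ` \<F>)"
      using xy by (auto simp: sign_match_def)
    moreover have "inc_bij (\<lambda>z. z)" by (auto simp: inc_bij_def strict_mono_def)
    ultimately show "\<exists>\<phi>. inc_bij \<phi> \<and> sign_match \<phi> ((\<lambda>P. (P x, P y)) ` \<F>)" by blast
  qed (use 0 in \<open>auto simp: Par_def\<close>)
next
  case (Suc n)
  have "sign_determined R (\<F>0 \<union> S)"
    if "finite S" "S \<subseteq> Par R (Suc n)" "finite \<F>0" "\<F>0 \<subseteq> Par R n" for S \<F>0
    using that
  proof (induction S arbitrary: \<F>0 rule: finite_induct)
    case empty
    then show ?case using Suc.IH by simp
  next
    case (insert P S)
    show ?case
      by (rule sign_determined_step[OF R insert.hyps(1)]) (use insert in auto)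
  qed
  from this[of \<F> "{}"] show ?case using Suc.prems by simp
qed

section \<open>Elimination of variables\<close>

text \<open>The product runs over the support, so that the same monomial can be read in any larger
  set of variables; sets of variables change during elimination.\<close>

definition mon :: "('v \<Rightarrow> nat) \<Rightarrow> ('v \<Rightarrow> real) \<Rightarrow> real" where
  "mon \<alpha> x = (\<Prod>v | \<alpha> v \<noteq> 0. x v ^ \<alpha> v)"

definition expo :: "'v set \<Rightarrow> nat \<Rightarrow> ('v \<Rightarrow> nat) set" where
  "expo V D = {\<alpha>. {v. \<alpha> v \<noteq> 0} \<subseteq> V \<and> sum \<alpha> V \<le> D}"

definition pol :: "'v set \<Rightarrow> nat \<Rightarrow> (('v \<Rightarrow> real) \<Rightarrow> real) \<Rightarrow> bool" where
  "pol V D f \<longleftrightarrow> (\<exists>a. f = (\<lambda>x. \<Sum>\<alpha>\<in>expo V D. a \<alpha> * mon \<alpha> x))"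

lemma mon_eq: "finite V \<Longrightarrow> {v. \<alpha> v \<noteq> 0} \<subseteq> V \<Longrightarrow> mon \<alpha> x = (\<Prod>v\<in>V. x v ^ \<alpha> v)"
  unfolding mon_def by (rule prod.mono_neutral_left) auto

lemma mon_add:
  assumes "finite V" "{v. \<alpha> v \<noteq> 0} \<subseteq> V" "{v. \<beta> v \<noteq> 0} \<subseteq> V"
  shows "mon (\<lambda>v. \<alpha> v + \<beta> v) x = mon \<alpha> x * mon \<beta> x"
proof -
  have "{v. \<alpha> v + \<beta> v \<noteq> 0} \<subseteq> V" using assms by auto
  then show ?thesis using assms by (simp add: mon_eq[of V] power_add prod.distrib)
qed

lemma expo_le: "\<alpha> \<in> expo V D \<Longrightarrow> finite V \<Longrightarrow> \<alpha> v \<le> D"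
  using member_le_sum[of v V \<alpha>] by (cases "v \<in> V") (force simp: expo_def)+

lemma finite_expo: assumes "finite V" shows "finite (expo V D)"
proof (rule finite_subset)
  show "expo V D \<subseteq> {\<alpha>. \<forall>v. (v \<in> V \<longrightarrow> \<alpha> v \<in> {..D}) \<and> (v \<notin> V \<longrightarrow> \<alpha> v = 0)}"
    using expo_le[OF _ assms] by (auto simp: expo_def)
  show "finite {\<alpha>. \<forall>v. (v \<in> V \<longrightarrow> \<alpha> v \<in> {..D}) \<and> (v \<notin> V \<longrightarrow> \<alpha> v = (0::nat))}"
    using assms by (intro finite_set_of_finite_funs) auto
qed

lemma expo_mono:
  assumes "finite V'" "V \<subseteq> V'" "D \<le> D'" shows "expo V D \<subseteq> expo V' D'"
proof
  fix \<alpha> assume a: "\<alpha> \<in> expo V D"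
  have "sum \<alpha> V' = sum \<alpha> V"
    by (rule sum.mono_neutral_right) (use assms a in \<open>auto simp: expo_def\<close>)
  then show "\<alpha> \<in> expo V' D'" using assms a by (auto simp: expo_def)
qed

lemma pol_lincomb:
  assumes "finite V" "finite A" "A \<subseteq> expo V D"
  shows "pol V D (\<lambda>x. \<Sum>\<alpha>\<in>A. a \<alpha> * mon \<alpha> x)"
  unfolding pol_def
  by (intro exI[of _ "\<lambda>\<alpha>. if \<alpha> \<in> A then a \<alpha> else 0"] ext sum.mono_neutral_cong_left)
     (use assms finite_expo in auto)

lemma pol_mono: "pol V D f \<Longrightarrow> finite V' \<Longrightarrow> V \<subseteq> V' \<Longrightarrow> D \<le> D' \<Longrightarrow> pol V' D' f"
proof -
  assume a: "pol V D f" "finite V'" "V \<subseteq> V'" "D \<le> D'"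
  then obtain b where "f = (\<lambda>x. \<Sum>\<alpha>\<in>expo V D. b \<alpha> * mon \<alpha> x)" by (auto simp: pol_def)
  then show ?thesis
    using pol_lincomb[OF a(2), of "expo V D" D' b] expo_mono[OF a(2-4)] finite_expo[of V D] a
    by (simp add: finite_subset)
qed

lemma pol_mon: "finite V \<Longrightarrow> \<alpha> \<in> expo V D \<Longrightarrow> pol V D (\<lambda>x. c * mon \<alpha> x)"
  using pol_lincomb[of V "{\<alpha>}" D "\<lambda>_. c"] by simp

lemma pol_const: "finite V \<Longrightarrow> pol V D (\<lambda>_. c)"
  using pol_mon[of V "\<lambda>_. 0" D c] by (simp add: expo_def mon_def)

lemma pol_var: "finite V \<Longrightarrow> i \<in> V \<Longrightarrow> pol V 1 (\<lambda>x. x i)"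
proof -
  assume "finite V" "i \<in> V"
  then have "(\<lambda>v. if v = i then 1 else 0) \<in> expo V 1" by (auto simp: expo_def)
  from pol_mon[OF \<open>finite V\<close> this, of 1] show ?thesis
    by (simp add: mon_def if_distrib[of "\<lambda>e. _ ^ e"] cong: if_cong)
qed

lemma pol_add: "pol V D f \<Longrightarrow> pol V D g \<Longrightarrow> pol V D (\<lambda>x. f x + g x)"
proof -
  assume "pol V D f" "pol V D g"
  then obtain a b where "f = (\<lambda>x. \<Sum>\<alpha>\<in>expo V D. a \<alpha> * mon \<alpha> x)"
    "g = (\<lambda>x. \<Sum>\<alpha>\<in>expo V D. b \<alpha> * mon \<alpha> x)" by (auto simp: pol_def)
  then show ?thesis unfolding pol_def
    by (intro exI[of _ "\<lambda>\<alpha>. a \<alpha> + b \<alpha>"]) (simp add: sum.distrib distrib_right)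
qed

lemma pol_sum: "finite V \<Longrightarrow> (\<And>i. i \<in> A \<Longrightarrow> pol V D (f i)) \<Longrightarrow> pol V D (\<lambda>x. \<Sum>i\<in>A. f i x)"
  by (induction A rule: infinite_finite_induct) (auto intro: pol_const pol_add)

lemma pol_mult:
  assumes V: "finite V" and "pol V D f" "pol V E g"
  shows "pol V (D + E) (\<lambda>x. f x * g x)"
proof -
  obtain a b where ab: "f = (\<lambda>x. \<Sum>\<alpha>\<in>expo V D. a \<alpha> * mon \<alpha> x)"
    "g = (\<lambda>x. \<Sum>\<beta>\<in>expo V E. b \<beta> * mon \<beta> x)"
    using assms by (auto simp: pol_def)
  have "f x * g x = (\<Sum>\<alpha>\<in>expo V D. \<Sum>\<beta>\<in>expo V E. (a \<alpha> * b \<beta>) * mon (\<lambda>i. \<alpha> i + \<beta> i) x)" for x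
    unfolding ab sum_product
    by (intro sum.cong refl) (simp add: expo_def mon_add[OF V])
  then have eq: "(\<lambda>x. f x * g x) =
      (\<lambda>x. \<Sum>\<alpha>\<in>expo V D. \<Sum>\<beta>\<in>expo V E. (a \<alpha> * b \<beta>) * mon (\<lambda>i. \<alpha> i + \<beta> i) x)" by blast
  show ?thesis unfolding eq
    by (intro pol_sum pol_mon V) (auto simp: expo_def sum.distrib)
qed

lemma pol_cmult: "finite V \<Longrightarrow> pol V D f \<Longrightarrow> pol V D (\<lambda>x. c * f x)"
  using pol_mult[of V 0 "\<lambda>_. c" D f] pol_const[of V 0 c] by simp

lemma pol_diff: "finite V \<Longrightarrow> pol V D f \<Longrightarrow> pol V D g \<Longrightarrow> pol V D (\<lambda>x. f x - g x)"
  using pol_add[of V D f "\<lambda>x. (-1) * g x"] pol_cmult[of V D g "-1"] by simp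

lemma pol_prod:
  "finite V \<Longrightarrow> (\<And>i. i \<in> A \<Longrightarrow> pol V (D i) (f i)) \<Longrightarrow> pol V (sum D A) (\<lambda>x. \<Prod>i\<in>A. f i x)"
  by (induction A rule: infinite_finite_induct) (auto intro: pol_const pol_mult)

lemma pol_power: "finite V \<Longrightarrow> pol V D f \<Longrightarrow> pol V (D * n) (\<lambda>x. f x ^ n)"
  using pol_prod[of V "{..<n}" "\<lambda>_. D" "\<lambda>_. f"] by (simp add: mult.commute)

lemma pol_cong: "pol V D f \<Longrightarrow> (\<And>v. v \<in> V \<Longrightarrow> x v = y v) \<Longrightarrow> f x = f y"
proof -
  assume "pol V D f" and xy: "\<And>v. v \<in> V \<Longrightarrow> x v = y v"
  then obtain a where f: "f = (\<lambda>x. \<Sum>\<alpha>\<in>expo V D. a \<alpha> * mon \<alpha> x)" by (auto simp: pol_def)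
  have "mon \<alpha> x = mon \<alpha> y" if "\<alpha> \<in> expo V D" for \<alpha>
    unfolding mon_def by (rule prod.cong) (use that xy in \<open>auto simp: expo_def\<close>)
  then show ?thesis by (simp add: f)
qed

lemma pol_line:
  assumes "finite V" "pol V D f"
  shows "\<exists>p. \<forall>t. f (\<lambda>v. u v + t * (w v - u v)) = poly p t"
proof -
  obtain a where f: "f = (\<lambda>x. \<Sum>\<alpha>\<in>expo V D. a \<alpha> * mon \<alpha> x)" using assms by (auto simp: pol_def)
  show ?thesis unfolding f
    by (intro exI[of _ "\<Sum>\<alpha>\<in>expo V D. smult (a \<alpha>) (\<Prod>v | \<alpha> v \<noteq> 0. [:u v, w v - u v:] ^ \<alpha> v)"])
       (simp add: poly_sum poly_prod mon_def)
qed

text \<open>Restricted to the line through \<open>u\<close> and \<open>w\<close>, both factors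
  become nonzero univariate polynomials.\<close>

lemma pol_mult_nonzero:
  assumes V: "finite V" and f: "pol V D f" "f u \<noteq> 0" and g: "pol V E g" "g w \<noteq> 0"
  shows "\<exists>x. f x * g x \<noteq> 0"
proof -
  obtain p where p: "\<And>t. f (\<lambda>v. u v + t * (w v - u v)) = poly p t" using pol_line[OF V f(1)] by blast
  obtain q where q: "\<And>t. g (\<lambda>v. u v + t * (w v - u v)) = poly q t" using pol_line[OF V g(1)] by blast
  have "p \<noteq> 0" "q \<noteq> 0" using p[of 0] q[of 1] f g by auto
  then have "finite {t. poly (p * q) t = 0}" by (intro poly_roots_finite) simp
  then obtain t where "poly (p * q) t \<noteq> 0"
    using infinite_UNIV_char_0[where 'a = real] by (metis (mono_tags, lifting) UNIV_eq_I mem_Collect_eq)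
  then show ?thesis using p[of t] q[of t] by (metis poly_mult)
qed

lemma pol_prod_nonzero:
  assumes V: "finite V" and "finite A" "\<forall>i\<in>A. pol V (D i) (f i) \<and> (\<exists>x. f i x \<noteq> 0)"
  shows "\<exists>x. (\<Prod>i\<in>A. f i x) \<noteq> 0"
  using assms(2,3)
proof (induction A rule: finite_induct)
  case (insert i A)
  then obtain u w where uw: "f i u \<noteq> 0" "(\<Prod>i\<in>A. f i w) \<noteq> 0" by auto
  have p: "pol V (sum D A) (\<lambda>x. \<Prod>i\<in>A. f i x)" "pol V (D i) (f i)"
    using insert.prems V by (auto intro: pol_prod)
  obtain x where "f i x * (\<Prod>i\<in>A. f i x) \<noteq> 0"
    using pol_mult_nonzero[OF V p(2) uw(1) p(1) uw(2)] by blast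
  then have "(\<Prod>i\<in>insert i A. f i x) \<noteq> 0" using insert.hyps by simp
  then show ?case by blast
qed simp

section \<open>Quantifier elimination in several variables\<close>

definition poly_ring :: "'v set \<Rightarrow> (('v \<Rightarrow> real) \<Rightarrow> real) set" where
  "poly_ring V = {f. \<exists>D. pol V D f}"

lemma fun_ring_poly_ring: assumes "finite V" shows "fun_ring (poly_ring V)"
proof -
  have "(\<lambda>x. f x + g x) \<in> poly_ring V" if "f \<in> poly_ring V" "g \<in> poly_ring V" for f g
  proof -
    obtain D E where "pol V D f" "pol V E g" using \<open>f \<in> _\<close> \<open>g \<in> _\<close> by (auto simp: poly_ring_def)
    then have "pol V (D + E) f" "pol V (D + E) g" using pol_mono[OF _ assms] by auto
    then show ?thesis using pol_add[of V "D + E" f g] unfolding poly_ring_def by blast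
  qed
  moreover have "(\<lambda>x. f x * g x) \<in> poly_ring V" if "f \<in> poly_ring V" "g \<in> poly_ring V" for f g
    using that pol_mult[OF assms] unfolding poly_ring_def by blast
  moreover have "(\<lambda>_. c) \<in> poly_ring V" for c
    using pol_const[OF assms] unfolding poly_ring_def by blast
  ultimately show ?thesis unfolding fun_ring_def by blast
qed

lemma poly_ring_parametric:
  assumes V: "finite V" and i: "i \<notin> V" and f: "pol (insert i V) D f"
  shows "\<exists>P\<in>Par (poly_ring V) D. \<forall>x z. f (x(i := z)) = poly (P x) z"
proof -
  let ?E = "expo (insert i V) D"
  obtain a where a: "f = (\<lambda>x. \<Sum>\<alpha>\<in>?E. a \<alpha> * mon \<alpha> x)" using f by (auto simp: pol_def)
  define P where "P x = (\<Sum>\<alpha>\<in>?E. Polynomial.monom (a \<alpha> * mon (\<alpha>(i := 0)) x) (\<alpha> i))" for x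
  have V': "finite (insert i V)" using V by simp
  have le: "\<alpha> i \<le> D" if "\<alpha> \<in> ?E" for \<alpha> using expo_le[OF that V'] .
  have sub: "\<alpha>(i := 0) \<in> expo V D" if "\<alpha> \<in> ?E" for \<alpha>
  proof -
    have "sum (\<alpha>(i := 0)) V = sum \<alpha> V" by (rule sum.cong) (use i in auto)
    then show ?thesis using that V i by (auto simp: expo_def)
  qed
  have mon: "mon \<alpha> (x(i := z)) = mon (\<alpha>(i := 0)) x * z ^ \<alpha> i" if "\<alpha> \<in> ?E" for \<alpha> x z
  proof -
    have "mon \<alpha> (x(i := z)) = (\<Prod>v\<in>insert i V. (x(i := z)) v ^ \<alpha> v)"
      by (rule mon_eq) (use that V in \<open>auto simp: expo_def\<close>)
    also have "\<dots> = z ^ \<alpha> i * (\<Prod>v\<in>V. (x(i := z)) v ^ \<alpha> v)" using V i by simp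
    also have "(\<Prod>v\<in>V. (x(i := z)) v ^ \<alpha> v) = (\<Prod>v\<in>V. x v ^ (\<alpha>(i := 0)) v)"
      by (rule prod.cong) (use i in auto)
    also have "\<dots> = mon (\<alpha>(i := 0)) x"
      by (rule mon_eq[symmetric]) (use sub[OF that] V in \<open>auto simp: expo_def\<close>)
    finally show ?thesis by (simp only: mult.commute)
  qed
  have "degree (P x) \<le> D" for x
    unfolding P_def by (intro degree_sum_le finite_expo V' order_trans[OF degree_monom_le] le)
  moreover have "(\<lambda>x. coeff (P x) j) \<in> poly_ring V" for j
  proof -
    have "pol V D (\<lambda>x. coeff (P x) j)"
      unfolding P_def coeff_sum coeff_monom
    proof (intro pol_sum V)
      fix \<alpha> assume "\<alpha> \<in> ?E"
      then show "pol V D (\<lambda>x. if \<alpha> i = j then a \<alpha> * mon (\<alpha>(i := 0)) x else 0)"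
        using pol_mon[OF V sub] pol_const[OF V, of D 0] by (cases "\<alpha> i = j") auto
    qed
    then show ?thesis by (auto simp: poly_ring_def)
  qed
  moreover have "f (x(i := z)) = poly (P x) z" for x z
    unfolding a P_def poly_sum poly_monom by (rule sum.cong) (auto simp: mon)
  ultimately show ?thesis by (auto simp: Par_def)
qed

lemma eliminate_one:
  assumes V: "finite V" and i: "i \<notin> V" and F: "finite \<F>" "\<F> \<subseteq> poly_ring (insert i V)"
  shows "\<exists>\<G>. finite \<G> \<and> \<G> \<subseteq> poly_ring V \<and> (\<forall>x y. (\<forall>G\<in>\<G>. sgn (G x) = sgn (G y)) \<longrightarrow>
     (\<forall>z. \<exists>z'. \<forall>f\<in>\<F>. sgn (f (x(i := z))) = sgn (f (y(i := z')))))"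
proof -
  have "\<forall>f\<in>\<F>. \<exists>D P. P \<in> Par (poly_ring V) D \<and> (\<forall>x z. f (x(i := z)) = poly (P x) z)"
  proof
    fix f assume "f \<in> \<F>"
    then obtain D where "pol (insert i V) D f" using F by (auto simp: poly_ring_def)
    from poly_ring_parametric[OF V i this]
    show "\<exists>D P. P \<in> Par (poly_ring V) D \<and> (\<forall>x z. f (x(i := z)) = poly (P x) z)" by blast
  qed
  then obtain D P where P: "\<And>f. f \<in> \<F> \<Longrightarrow> P f \<in> Par (poly_ring V) (D f)"
    "\<And>f x z. f \<in> \<F> \<Longrightarrow> f (x(i := z)) = poly (P f x) z" by metis
  have "D f \<le> sum D \<F>" if "f \<in> \<F>" for f using F(1) that by (simp add: member_le_sum)
  then have "P ` \<F> \<subseteq> Par (poly_ring V) (sum D \<F>)" using Par_mono[OF P(1)] by blast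
  then have "sign_determined (poly_ring V) (P ` \<F>)"
    by (intro sign_determined_finite[OF fun_ring_poly_ring[OF V]]) (use F in auto)
  then obtain \<G> where G: "finite \<G>" "\<G> \<subseteq> poly_ring V"
    "\<And>x y. \<forall>G\<in>\<G>. sgn (G x) = sgn (G y) \<Longrightarrow>
       \<exists>\<phi>. inc_bij \<phi> \<and> sign_match \<phi> ((\<lambda>P. (P x, P y)) ` P ` \<F>)"
    unfolding sign_determined_def by blast
  show ?thesis
  proof (intro exI[of _ \<G>] conjI allI impI)
    fix x y z assume xy: "\<forall>G\<in>\<G>. sgn (G x) = sgn (G y)"
    obtain \<phi> where "sign_match \<phi> ((\<lambda>P. (P x, P y)) ` P ` \<F>)" using G(3)[OF xy] by blast
    then have "\<forall>f\<in>\<F>. sgn (poly (P f x) z) = sgn (poly (P f y) (\<phi> z))"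
      by (auto simp: sign_match_def)
    then show "\<exists>z'. \<forall>f\<in>\<F>. sgn (f (x(i := z))) = sgn (f (y(i := z')))"
      using P(2) by (intro exI[of _ "\<phi> z"]) simp
  qed (use G in auto)
qed

text \<open>The points \<open>x'\<close> form the fibre over \<open>x\<close> of the projection that
  forgets \<open>U\<close>. The signs of \<open>\<G>\<close> at \<open>x\<close> decide which sign
  vectors of \<open>\<F>\<close> occur on this fibre.\<close>

lemma eliminate:
  assumes "finite U" "finite V" "U \<inter> V = {}" "finite \<F>" "\<F> \<subseteq> poly_ring (U \<union> V)"
  shows "\<exists>\<G>. finite \<G> \<and> \<G> \<subseteq> poly_ring V \<and> (\<forall>x y. (\<forall>G\<in>\<G>. sgn (G x) = sgn (G y)) \<longrightarrow>
     (\<forall>x'. (\<forall>v. v \<notin> U \<longrightarrow> x' v = x v) \<longrightarrow>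
        (\<exists>y'. (\<forall>v. v \<notin> U \<longrightarrow> y' v = y v) \<and> (\<forall>f\<in>\<F>. sgn (f x') = sgn (f y')))))"
  using assms
proof (induction U arbitrary: V rule: finite_induct)
  case empty
  have *: "x' = x" if "\<forall>v. v \<notin> {} \<longrightarrow> x' v = x v" for x' x :: "'a \<Rightarrow> real" using that by auto
  show ?case
    by (intro exI[of _ \<F>]) (use empty * in \<open>auto dest!: * \<close>)
next
  case (insert i U)
  have "U \<union> insert i V = insert i U \<union> V" by auto
  then obtain \<G>1 where G1: "finite \<G>1" "\<G>1 \<subseteq> poly_ring (insert i V)"
    "\<And>x y x'. \<forall>G\<in>\<G>1. sgn (G x) = sgn (G y) \<Longrightarrow> \<forall>v. v \<notin> U \<longrightarrow> x' v = x v \<Longrightarrow>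
        \<exists>y'. (\<forall>v. v \<notin> U \<longrightarrow> y' v = y v) \<and> (\<forall>f\<in>\<F>. sgn (f x') = sgn (f y'))"
    using insert.IH[of "insert i V"] insert.hyps insert.prems by auto
  obtain \<G> where G: "finite \<G>" "\<G> \<subseteq> poly_ring V"
    "\<And>x y z. \<forall>G\<in>\<G>. sgn (G x) = sgn (G y) \<Longrightarrow>
       \<exists>z'. \<forall>f\<in>\<G>1. sgn (f (x(i := z))) = sgn (f (y(i := z')))"
    using eliminate_one[OF _ _ G1(1,2)] insert.prems by auto
  show ?case
  proof (intro exI[of _ \<G>] conjI allI impI)
    fix x y x' assume xy: "\<forall>G\<in>\<G>. sgn (G x) = sgn (G y)"
      and x': "\<forall>v. v \<notin> insert i U \<longrightarrow> x' v = x v"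
    obtain z' where z': "\<forall>f\<in>\<G>1. sgn (f (x(i := x' i))) = sgn (f (y(i := z')))"
      using G(3)[OF xy] by blast
    have "\<forall>v. v \<notin> U \<longrightarrow> x' v = (x(i := x' i)) v" using x' by auto
    from G1(3)[OF z' this] obtain y' where
      "\<forall>v. v \<notin> U \<longrightarrow> y' v = (y(i := z')) v" "\<forall>f\<in>\<F>. sgn (f x') = sgn (f y')" by blast
    then show "\<exists>y'. (\<forall>v. v \<notin> insert i U \<longrightarrow> y' v = y v) \<and> (\<forall>f\<in>\<F>. sgn (f x') = sgn (f y'))"
      by (intro exI[of _ y']) auto
  qed (use G in auto)
qed

lemma pol_sign_locally_constant:
  fixes f :: "('n::finite \<Rightarrow> real) \<Rightarrow> real"
  assumes f: "pol UNIV D f" and nz: "f w \<noteq> 0"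
  shows "\<exists>e>0. \<forall>t. (\<forall>i. \<bar>t i - w i\<bar> < e) \<longrightarrow> sgn (f t) = sgn (f w)"
proof -
  obtain a where a: "f = (\<lambda>x. \<Sum>\<alpha>\<in>expo UNIV D. a \<alpha> * mon \<alpha> x)" using f by (auto simp: pol_def)
  have "continuous_on UNIV (\<lambda>x :: real ^ 'n. f (($) x))"
    unfolding a mon_def by (intro continuous_intros)
  then have "isCont (\<lambda>x :: real ^ 'n. f (($) x)) (vec_lambda w)"
    by (simp add: continuous_on_eq_continuous_at)
  then obtain r where r: "r > 0" "\<And>x :: real ^ 'n. dist x (vec_lambda w) < r \<Longrightarrow> dist (f (($) x)) (f w) < \<bar>f w\<bar>"
    unfolding continuous_at_eps_delta using nz
    by (metis (no_types, lifting) vec_lambda_inverse UNIV_I zero_less_abs_iff dist_norm real_norm_def vec_nth_inverse vec_lambda_beta ext)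
  have "sgn (f t) = sgn (f w)" if t: "\<forall>i. \<bar>t i - w i\<bar> < r / CARD('n)" for t
  proof -
    have "dist (vec_lambda t) (vec_lambda w) \<le> (\<Sum>i\<in>UNIV. \<bar>(vec_lambda t - vec_lambda w) $ i\<bar>)"
      unfolding dist_norm by (rule norm_le_l1_cart)
    also have "\<dots> < (\<Sum>i\<in>(UNIV :: 'n set). r / CARD('n))"
      by (rule sum_strict_mono) (use t in auto)
    also have "\<dots> = r" by simp
    finally have "dist (f (($) (vec_lambda t))) (f w) < \<bar>f w\<bar>" by (rule r(2))
    then have "\<bar>f t - f w\<bar> < \<bar>f w\<bar>" by (simp add: dist_real_def vec_lambda_inverse)
    then show ?thesis by (auto simp: sgn_if abs_if split: if_splits)
  qed
  moreover have "r / CARD('n) > 0" using r(1) by simp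
  ultimately show ?thesis by blast
qed

text \<open>Specialising the coefficient variables does not raise the degree; this is the source of
  bounds that are uniform in \<open>a\<close>.\<close>

lemma pol_case_sum:
  assumes E: "finite E" and I: "finite I" and G: "pol (Inl ` E \<union> Inr ` I) D G"
  shows "pol I D (\<lambda>w. G (case_sum a w))"
proof -
  let ?V = "Inl ` E \<union> Inr ` I"
  obtain b where b: "G = (\<lambda>x. \<Sum>\<beta>\<in>expo ?V D. b \<beta> * mon \<beta> x)" using G by (auto simp: pol_def)
  have "pol I D (\<lambda>w. b \<beta> * mon \<beta> (case_sum a w))" if \<beta>: "\<beta> \<in> expo ?V D" for \<beta>
  proof (rule pol_cmult[OF I])
    have "mon \<beta> (case_sum a w) = (\<Prod>v\<in>?V. case_sum a w v ^ \<beta> v)" for w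
      by (rule mon_eq) (use \<beta> E I in \<open>auto simp: expo_def\<close>)
    moreover have "pol I (sum \<beta> ?V) (\<lambda>w. \<Prod>v\<in>?V. case_sum a w v ^ \<beta> v)"
    proof (rule pol_prod[OF I])
      fix v assume "v \<in> ?V"
      then show "pol I (\<beta> v) (\<lambda>w. case_sum a w v ^ \<beta> v)"
        using pol_const[OF I] pol_power[OF I pol_var[OF I], of _ "\<beta> v"] by auto
    qed
    moreover have "sum \<beta> ?V \<le> D" using \<beta> by (simp add: expo_def)
    ultimately show "pol I D (\<lambda>w. mon \<beta> (case_sum a w))" using pol_mono[OF _ I] by simp
  qed
  then show ?thesis unfolding b by (intro pol_sum I)
qed

text \<open>The projection of \<open>Z\<close> to the coordinates in \<open>I\<close> has an
  interior point.\<close>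

definition fat :: "'n set \<Rightarrow> ('n \<Rightarrow> real) set \<Rightarrow> bool" where
  "fat I Z \<longleftrightarrow> (\<exists>w e. e > 0 \<and> (\<forall>t. (\<forall>i\<in>I. \<bar>t i - w i\<bar> < e) \<longrightarrow> (\<exists>z\<in>Z. \<forall>i\<in>I. z i = t i)))"

text \<open>Eliminating the coordinates outside \<open>I\<close> from the universal polynomial of degree \<open>D\<close>, whose
  coefficients are variables too, bounds the degree of \<open>g\<close> uniformly in the coefficients \<open>a\<close>.\<close>

lemma fat_or_dependent:
  fixes I :: "'n::finite set"
  shows "\<exists>c. \<forall>a. fat I {w. (\<Sum>\<alpha>\<in>expo UNIV D. a \<alpha> * mon \<alpha> w) = 0} \<or>
    (\<exists>g. pol I c g \<and> (\<exists>x. g x \<noteq> 0) \<and> (\<forall>w. (\<Sum>\<alpha>\<in>expo UNIV D. a \<alpha> * mon \<alpha> w) = 0 \<longrightarrow> g w = 0))"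
proof -
  define E where "E = (expo UNIV D :: ('n \<Rightarrow> nat) set)"
  define U where "U = (Inr ` (- I) :: (('n \<Rightarrow> nat) + 'n) set)"
  define V where "V = Inl ` E \<union> (Inr ` I :: (('n \<Rightarrow> nat) + 'n) set)"
  define F where "F x = (\<Sum>\<alpha>\<in>E. x (Inl \<alpha>) * mon \<alpha> (\<lambda>i. x (Inr i)))" for x :: "('n \<Rightarrow> nat) + 'n \<Rightarrow> real"
  have fin: "finite E" "finite U" "finite V" by (auto simp: E_def U_def V_def finite_expo)
  have "pol (U \<union> V) (1 + D) F"
    unfolding F_def
  proof (intro pol_sum pol_mult)
    fix \<alpha> assume \<alpha>: "\<alpha> \<in> E"
    show "pol (U \<union> V) 1 (\<lambda>x. x (Inl \<alpha>))" by (rule pol_var) (use fin \<alpha> in \<open>auto simp: V_def\<close>)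
    have "pol (U \<union> V) (\<Sum>i\<in>UNIV. 1 * \<alpha> i) (\<lambda>x. \<Prod>i\<in>UNIV. x (Inr i) ^ \<alpha> i)"
      by (intro pol_prod pol_power pol_var) (use fin in \<open>auto simp: U_def V_def\<close>)
    then have "pol (U \<union> V) (sum \<alpha> UNIV) (\<lambda>x. mon \<alpha> (\<lambda>i. x (Inr i)))"
      by (simp add: mon_eq[of UNIV])
    then show "pol (U \<union> V) D (\<lambda>x. mon \<alpha> (\<lambda>i. x (Inr i)))"
      by (rule pol_mono) (use \<alpha> fin in \<open>auto simp: E_def expo_def\<close>)
  qed (use fin in auto)
  then have "{F} \<subseteq> poly_ring (U \<union> V)" by (auto simp: poly_ring_def)
  moreover have "U \<inter> V = {}" by (auto simp: U_def V_def)
  ultimately obtain \<G> where G: "finite \<G>" "\<G> \<subseteq> poly_ring V"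
    "\<And>x y x'. \<forall>G\<in>\<G>. sgn (G x) = sgn (G y) \<Longrightarrow> \<forall>v. v \<notin> U \<longrightarrow> x' v = x v \<Longrightarrow>
        \<exists>y'. (\<forall>v. v \<notin> U \<longrightarrow> y' v = y v) \<and> sgn (F x') = sgn (F y')"
    using eliminate[OF fin(2,3), of "{F}"] by auto
  have "\<forall>G\<in>\<G>. \<exists>D. pol V D G" using G(2) by (auto simp: poly_ring_def)
  then obtain d where d: "\<And>G. G \<in> \<G> \<Longrightarrow> pol V (d G) G" by metis
  have sp: "pol I (d G) (\<lambda>w. G (case_sum a w))" if "G \<in> \<G>" for G a
    by (rule pol_case_sum[OF fin(1)]) (use d[OF that] in \<open>simp_all add: V_def\<close>)
  have Fa: "F (case_sum a w) = (\<Sum>\<alpha>\<in>expo UNIV D. a \<alpha> * mon \<alpha> w)" for a w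
    by (simp add: F_def E_def)
  show ?thesis
  proof (intro exI[of _ "sum d \<G>"] allI)
    fix a :: "('n \<Rightarrow> nat) \<Rightarrow> real"
    let ?Z = "{w. (\<Sum>\<alpha>\<in>expo UNIV D. a \<alpha> * mon \<alpha> w) = 0}"
    \<comment> \<open>Members that vanish identically after the specialisation have constant sign
      and are left out, so that the product of the others is a nonzero polynomial.\<close>
    define \<G>' where "\<G>' = {G \<in> \<G>. \<exists>w. G (case_sum a w) \<noteq> 0}"
    have finG': "finite \<G>'" using G(1) by (simp add: \<G>'_def)
    show "fat I ?Z \<or> (\<exists>g. pol I (sum d \<G>) g \<and> (\<exists>x. g x \<noteq> 0) \<and>
        (\<forall>w. (\<Sum>\<alpha>\<in>expo UNIV D. a \<alpha> * mon \<alpha> w) = 0 \<longrightarrow> g w = 0))"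
    \<comment> \<open>If all these polynomials are nonzero at some \<open>w\<close> of the zero set,
      their signs persist near \<open>w\<close> and elimination lifts a whole cube to zeros.
      Otherwise their product vanishes on the zero set and serves as the relation.\<close>
    proof (cases "\<exists>w\<in>?Z. \<forall>G\<in>\<G>'. G (case_sum a w) \<noteq> 0")
      case True
      then obtain w where w: "w \<in> ?Z" "\<And>G. G \<in> \<G>' \<Longrightarrow> G (case_sum a w) \<noteq> 0" by blast
      have "\<forall>G\<in>\<G>'. \<exists>e>0. \<forall>t. (\<forall>i. \<bar>t i - w i\<bar> < e) \<longrightarrow> sgn (G (case_sum a t)) = sgn (G (case_sum a w))"
      proof
        fix G assume g: "G \<in> \<G>'"
        then have "pol UNIV (d G) (\<lambda>w. G (case_sum a w))"
          by (intro pol_mono[OF sp]) (auto simp: \<G>'_def)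
        from pol_sign_locally_constant[OF this w(2)[OF g]]
        show "\<exists>e>0. \<forall>t. (\<forall>i. \<bar>t i - w i\<bar> < e) \<longrightarrow> sgn (G (case_sum a t)) = sgn (G (case_sum a w))" .
      qed
      then obtain e where e: "\<And>G. G \<in> \<G>' \<Longrightarrow> e G > 0"
        "\<And>G t. G \<in> \<G>' \<Longrightarrow> \<forall>i. \<bar>t i - w i\<bar> < e G \<Longrightarrow> sgn (G (case_sum a t)) = sgn (G (case_sum a w))"
        by metis
      define \<eta> where "\<eta> = Min (insert 1 (e ` \<G>'))"
      have \<eta>: "\<eta> > 0" "\<And>G. G \<in> \<G>' \<Longrightarrow> \<eta> \<le> e G"
        using finG' e(1) by (auto simp: \<eta>_def)
      have "\<exists>z\<in>?Z. \<forall>i\<in>I. z i = t i" if t: "\<forall>i\<in>I. \<bar>t i - w i\<bar> < \<eta>" for t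
      proof -
        define t' where "t' i = (if i \<in> I then t i else w i)" for i
        have "\<forall>i. \<bar>t' i - w i\<bar> < \<eta>" using t \<eta>(1) by (simp add: t'_def)
        then have "sgn (G (case_sum a t')) = sgn (G (case_sum a w))" if "G \<in> \<G>'" for G
          using e(2)[OF that, of t'] \<eta>(2)[OF that] by (meson less_le_trans)
        moreover have "G (case_sum a u) = 0" if "G \<in> \<G>" "G \<notin> \<G>'" for G u
          using that by (auto simp: \<G>'_def)
        ultimately have "\<forall>G\<in>\<G>. sgn (G (case_sum a w)) = sgn (G (case_sum a t'))" by metis
        from G(3)[OF this, of "case_sum a w"] obtain y where
          y: "\<forall>v. v \<notin> U \<longrightarrow> y v = case_sum a t' v" "sgn (F (case_sum a w)) = sgn (F y)" by blast
        have "y = case_sum a (\<lambda>i. y (Inr i))"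
        proof
          fix v show "y v = case_sum a (\<lambda>i. y (Inr i)) v"
            using y(1) by (cases v) (auto simp: U_def)
        qed
        moreover have "F y = 0" using y(2) w(1) by (simp add: Fa sgn_0_0)
        ultimately have "(\<lambda>i. y (Inr i)) \<in> ?Z" using Fa[of a "\<lambda>i. y (Inr i)"] by simp
        moreover have "y (Inr i) = t i" if "i \<in> I" for i
          using y(1) that by (auto simp: U_def t'_def)
        ultimately show ?thesis by (intro bexI[of _ "\<lambda>i. y (Inr i)"]) auto
      qed
      then have "fat I ?Z" unfolding fat_def using \<eta>(1) by blast
      then show ?thesis by blast
    next
      case False
      let ?g = "\<lambda>w. \<Prod>G\<in>\<G>'. G (case_sum a w)"
      have p: "pol I (sum d \<G>') ?g"
        by (rule pol_prod) (use sp in \<open>auto simp: \<G>'_def\<close>)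
      have le: "sum d \<G>' \<le> sum d \<G>" using G(1) by (intro sum_mono2) (auto simp: \<G>'_def)
      have "pol I (sum d \<G>) ?g" by (rule pol_mono[OF p _ subset_refl le]) simp
      moreover have "\<exists>x. ?g x \<noteq> 0"
        by (rule pol_prod_nonzero[of I _ d]) (use finG' sp in \<open>auto simp: \<G>'_def\<close>)
      moreover have "?g w = 0" if "w \<in> ?Z" for w using False that finG' by auto
      ultimately show ?thesis by (intro disjI2 exI[of _ ?g]) auto
    qed
  qed
qed

section \<open>Zero sets and monomial orders\<close>

definition prime_of :: "'n::finite \<Rightarrow> nat" where
  "prime_of = (SOME f. inj f \<and> (\<forall>i. prime (f i)))"

lemma prime_of: "inj (prime_of :: 'n::finite \<Rightarrow> nat)" "prime (prime_of (i :: 'n))"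
proof -
  obtain S :: "nat set" where S: "S \<subseteq> {p. prime p}" "finite S" "card S = CARD('n)"
    using infinite_arbitrarily_large[OF primes_infinite] by blast
  then obtain f where f: "bij_betw f (UNIV :: 'n set) S"
    using finite_same_card_bij[of "UNIV :: 'n set" S] by auto
  then have "inj f \<and> (\<forall>i. prime (f i))" using S by (auto simp: bij_betw_def)
  then have "inj (prime_of :: 'n \<Rightarrow> nat) \<and> (\<forall>i :: 'n. prime (prime_of i))"
    unfolding prime_of_def by (rule someI[where P = "\<lambda>f. inj f \<and> (\<forall>i. prime (f i))"])
  then show "inj (prime_of :: 'n \<Rightarrow> nat)" "prime (prime_of (i :: 'n))" by auto
qed

text \<open>Comparing keys is a monomial order with finite initial segments, by unique factorisation.\<close>

definition key :: "('n::finite \<Rightarrow> nat) \<Rightarrow> nat" where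
  "key \<alpha> = (\<Prod>i\<in>UNIV. prime_of i ^ \<alpha> i)"

lemma key_add: "key (\<lambda>i. \<alpha> i + \<beta> i) = key \<alpha> * key \<beta>"
  by (simp add: key_def power_add prod.distrib)

lemma key_pos: "key \<alpha> > 0"
  unfolding key_def by (rule prod_pos) (use prime_of(2) prime_gt_0_nat in auto)

lemma multiplicity_key:
  fixes \<alpha> :: "'n::finite \<Rightarrow> nat"
  shows "multiplicity (prime_of i) (key \<alpha>) = \<alpha> i"
proof -
  note inj = prime_of(1)[where 'n = 'n]
  have "key \<alpha> = (\<Prod>p\<in>range (prime_of :: 'n \<Rightarrow> nat). p ^ \<alpha> (inv prime_of p))"
    by (subst prod.reindex) (use inj in \<open>auto simp: key_def inv_f_f\<close>)
  then show ?thesis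
    using multiplicity_prod_prime_powers[of "range (prime_of :: 'n \<Rightarrow> nat)" "prime_of i" "\<lambda>p. \<alpha> (inv prime_of p)"]
      prime_of(2) inj by (auto simp: inv_f_f)
qed

lemma key_inj: "key \<alpha> = key \<beta> \<Longrightarrow> \<alpha> = \<beta>"
  using multiplicity_key by (metis ext)

text \<open>It makes initial segments of the key order finite, and it later bounds exponents
  linearly in the degree.\<close>

lemma two_power_le_key: "2 ^ \<alpha> i \<le> key \<alpha>"
proof -
  have "2 ^ \<alpha> i \<le> prime_of i ^ \<alpha> i" using prime_of(2) prime_ge_2_nat power_mono by blast
  also have "\<dots> \<le> key \<alpha>"
    unfolding key_def by (rule dvd_imp_le) (use key_pos[of \<alpha>] in \<open>auto simp: key_def intro: dvd_prodI\<close>)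
  finally show ?thesis .
qed

lemma finite_key_le: "finite {\<alpha> :: 'n::finite \<Rightarrow> nat. key \<alpha> \<le> Q}"
proof (rule finite_subset)
  have "\<alpha> i \<le> Q" if "key \<alpha> \<le> Q" for \<alpha> :: "'n \<Rightarrow> nat" and i
    using two_power_le_key[of \<alpha> i] that less_exp[of "\<alpha> i"] by linarith
  then show "{\<alpha> :: 'n \<Rightarrow> nat. key \<alpha> \<le> Q} \<subseteq> {\<alpha>. \<forall>i. (i \<in> UNIV \<longrightarrow> \<alpha> i \<in> {..Q}) \<and> (i \<notin> UNIV \<longrightarrow> \<alpha> i = 0)}"
    by auto
  show "finite {\<alpha> :: 'n \<Rightarrow> nat. \<forall>i. (i \<in> UNIV \<longrightarrow> \<alpha> i \<in> {..Q}) \<and> (i \<notin> UNIV \<longrightarrow> \<alpha> i = 0)}"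
    by (rule finite_set_of_finite_funs) auto
qed

text \<open>A monotone subsequence that does not increase is decreasing, hence constant from its
  minimum on.\<close>

lemma nat_seq_mono_subseq:
  fixes f :: "nat \<Rightarrow> nat"
  shows "\<exists>r :: nat \<Rightarrow> nat. strict_mono r \<and> mono (\<lambda>n. f (r n))"
proof -
  obtain r :: "nat \<Rightarrow> nat" where r: "strict_mono r" "monoseq (\<lambda>n. f (r n))" using seq_monosub by blast
  show ?thesis
  proof (cases "mono (\<lambda>n. f (r n))")
    case True then show ?thesis using r by blast
  next
    case False
    then have dec: "f (r n) \<le> f (r m)" if "m \<le> n" for m n
      using r(2) that by (auto simp: monoseq_def mono_def)
    obtain N where N: "\<And>n. f (r N) \<le> f (r n)"
      using ex_has_least_nat[of "\<lambda>_. True" 0 "\<lambda>n. f (r n)"] by blast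
    have "f (r (N + n)) = f (r N)" for n using dec[of N "N + n"] N[of "N + n"] by simp
    then have "mono (\<lambda>n. f (r (N + n)))" by (simp add: mono_def)
    moreover have "strict_mono (\<lambda>n. r (N + n))" using r(1) by (simp add: strict_mono_def)
    ultimately show ?thesis by blast
  qed
qed

text \<open>Subsequences are taken coordinate by coordinate until all coordinates increase; then the
  first two terms compare.\<close>

lemma dickson:
  fixes f :: "nat \<Rightarrow> 'n::finite \<Rightarrow> nat"
  shows "\<exists>i j. i < j \<and> (\<forall>v. f i v \<le> f j v)"
proof -
  have "\<exists>r :: nat \<Rightarrow> nat. strict_mono r \<and> (\<forall>v\<in>V. mono (\<lambda>n. f (r n) v))" if "finite V" for V
    using that
  proof (induction V rule: finite_induct)
    case empty
    show ?case by (rule exI[of _ id]) (simp add: strict_mono_def)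
  next
    case (insert v V)
    then obtain r :: "nat \<Rightarrow> nat" where r: "strict_mono r" "\<forall>v\<in>V. mono (\<lambda>n. f (r n) v)" by blast
    obtain s :: "nat \<Rightarrow> nat" where s: "strict_mono s" "mono (\<lambda>n. f (r (s n)) v)"
      using nat_seq_mono_subseq[of "\<lambda>n. f (r n) v"] by blast
    have "mono (\<lambda>n. f (r (s n)) w)" if "w \<in> V" for w
      using r(2) that s(1) by (simp add: mono_def strict_mono_less_eq)
    then show ?case using r(1) s
      by (intro exI[of _ "\<lambda>n. r (s n)"]) (auto simp: strict_mono_def)
  qed
  from this[of UNIV] obtain r :: "nat \<Rightarrow> nat" where "strict_mono r" "\<forall>v. mono (\<lambda>n. f (r n) v)" by auto
  then show ?thesis
    by (intro exI[of _ "r 0"] exI[of _ "r 1"]) (auto simp: mono_def strict_mono_def)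
qed

definition key_less :: "nat \<Rightarrow> (('n::finite \<Rightarrow> real) \<Rightarrow> real) \<Rightarrow> bool" where
  "key_less Q f \<longleftrightarrow> (\<exists>b. f = (\<lambda>x. \<Sum>\<beta>\<in>{\<beta>. key \<beta> < Q}. b \<beta> * mon \<beta> x))"

lemma finite_key_less: "finite {\<alpha>. key \<alpha> < Q}"
  by (rule finite_subset[OF _ finite_key_le[of Q]]) auto

lemma key_less_sum:
  assumes "finite A" "\<And>\<beta>. \<beta> \<in> A \<Longrightarrow> key \<beta> < Q"
  shows "key_less Q (\<lambda>x. \<Sum>\<beta>\<in>A. b \<beta> * mon \<beta> x)"
  unfolding key_less_def
  by (intro exI[of _ "\<lambda>\<beta>. if \<beta> \<in> A then b \<beta> else 0"] ext sum.mono_neutral_cong_left)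
     (use assms finite_key_less in auto)

lemma pol_key_less:
  fixes f :: "('n::finite \<Rightarrow> real) \<Rightarrow> real"
  assumes "pol V D f" shows "\<exists>Q. key_less Q f"
proof -
  obtain a where a: "f = (\<lambda>x. \<Sum>\<alpha>\<in>expo V D. a \<alpha> * mon \<alpha> x)" using assms by (auto simp: pol_def)
  have fin: "finite (expo V D)" by (rule finite_expo) simp
  have "key_less (Suc (sum key (expo V D))) f"
    unfolding a by (rule key_less_sum[OF fin]) (use fin in \<open>simp add: member_le_sum less_Suc_eq_le\<close>)
  then show ?thesis by blast
qed

lemma key_less_diff: "key_less Q f \<Longrightarrow> key_less Q g \<Longrightarrow> key_less Q (\<lambda>x. f x - c * g x)"
proof -
  assume "key_less Q f" "key_less Q g"
  then obtain a b where ab: "f = (\<lambda>x. \<Sum>\<beta>\<in>{\<beta>. key \<beta> < Q}. a \<beta> * mon \<beta> x)"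
    "g = (\<lambda>x. \<Sum>\<beta>\<in>{\<beta>. key \<beta> < Q}. b \<beta> * mon \<beta> x)" by (auto simp: key_less_def)
  show ?thesis unfolding key_less_def ab
    by (intro exI[of _ "\<lambda>\<beta>. a \<beta> - c * b \<beta>"])
       (simp add: sum_distrib_left sum_subtractf[symmetric] algebra_simps)
qed

lemma key_less_mon_mult:
  assumes "key_less Q g" shows "key_less (key \<gamma> * Q) (\<lambda>x. mon \<gamma> x * g x)"
proof -
  obtain b where b: "g = (\<lambda>x. \<Sum>\<beta>\<in>{\<beta>. key \<beta> < Q}. b \<beta> * mon \<beta> x)"
    using assms by (auto simp: key_less_def)
  let ?h = "\<lambda>\<beta> i. \<gamma> i + \<beta> i"
  have inj: "inj_on ?h {\<beta>. key \<beta> < Q}" by (auto simp: inj_on_def fun_eq_iff)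
  have "mon \<gamma> x * g x = (\<Sum>\<beta>\<in>?h ` {\<beta>. key \<beta> < Q}. b (\<lambda>i. \<beta> i - \<gamma> i) * mon \<beta> x)" for x
    unfolding b sum.reindex[OF inj] sum_distrib_left o_def
    by (rule sum.cong) (auto simp: mon_add[of UNIV])
  moreover have "key_less (key \<gamma> * Q) (\<lambda>x. \<Sum>\<beta>\<in>?h ` {\<beta>. key \<beta> < Q}. b (\<lambda>i. \<beta> i - \<gamma> i) * mon \<beta> x)"
    by (rule key_less_sum) (use finite_key_less key_pos in \<open>auto simp: key_add\<close>)
  ultimately show ?thesis by simp
qed

lemma key_less_Suc:
  assumes "key_less (Suc Q) f" "\<not> key_less Q f"
  shows "\<exists>\<alpha> c r. key \<alpha> = Q \<and> c \<noteq> 0 \<and> key_less Q r \<and> f = (\<lambda>x. c * mon \<alpha> x + r x)"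
proof -
  obtain b where b: "f = (\<lambda>x. \<Sum>\<beta>\<in>{\<beta>. key \<beta> < Suc Q}. b \<beta> * mon \<beta> x)"
    using assms by (auto simp: key_less_def)
  have ex: "\<exists>\<alpha>. key \<alpha> = Q \<and> b \<alpha> \<noteq> 0"
  proof (rule ccontr)
    assume "\<not> ?thesis"
    then have "f = (\<lambda>x. \<Sum>\<beta>\<in>{\<beta>. key \<beta> < Q}. b \<beta> * mon \<beta> x)"
      unfolding b using finite_key_less[of "Suc Q"]
      by (intro ext sum.mono_neutral_right) (auto simp: less_Suc_eq)
    then show False using assms(2) by (auto simp: key_less_def)
  qed
  then obtain \<alpha> where \<alpha>: "key \<alpha> = Q" "b \<alpha> \<noteq> 0" by blast
  have "{\<beta>. key \<beta> < Suc Q} = insert \<alpha> {\<beta>. key \<beta> < Q}"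
    using \<alpha>(1) key_inj by (auto simp: less_Suc_eq)
  then have "f = (\<lambda>x. b \<alpha> * mon \<alpha> x + (\<Sum>\<beta>\<in>{\<beta>. key \<beta> < Q}. b \<beta> * mon \<beta> x))"
    unfolding b by (simp add: finite_key_less \<alpha>(1))
  moreover have "key_less Q (\<lambda>x. \<Sum>\<beta>\<in>{\<beta>. key \<beta> < Q}. b \<beta> * mon \<beta> x)"
    by (auto simp: key_less_def)
  ultimately show ?thesis using \<alpha> by (intro exI conjI)
qed

text \<open>Hilbert's basis theorem in the form needed here: separating polynomials of least leading
  exponent along a strictly descending chain of zero sets contradict Dickson's lemma.\<close>

lemma no_descending_zero_sets:
  fixes Z :: "nat \<Rightarrow> ('n::finite \<Rightarrow> real) set"
  assumes dec: "\<And>i. Z (Suc i) \<subseteq> Z i"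
    and sep: "\<And>i. \<exists>D f. pol UNIV D f \<and> (\<forall>x\<in>Z (Suc i). f x = 0) \<and> (\<exists>x\<in>Z i. f x \<noteq> 0)"
  shows False
proof -
  define sp where "sp i f \<longleftrightarrow> (\<forall>x\<in>Z (Suc i). f x = 0) \<and> (\<exists>x\<in>Z i. f x \<noteq> 0)" for i and f :: "('n \<Rightarrow> real) \<Rightarrow> real"
  have "\<exists>Q f. key_less Q f \<and> sp i f" for i
    using sep[of i] pol_key_less unfolding sp_def by blast
  then have "\<exists>Q. (\<exists>f. key_less Q f \<and> sp i f) \<and> (\<forall>Q'<Q. \<not> (\<exists>f. key_less Q' f \<and> sp i f))" for i
    by (rule exists_least_iff[THEN iffD1])
  then obtain Q f where Q: "\<And>i. key_less (Q i) (f i)" "\<And>i. sp i (f i)"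
    "\<And>i Q' g. Q' < Q i \<Longrightarrow> key_less Q' g \<Longrightarrow> \<not> sp i g" by metis
  have "\<exists>\<alpha> c r. Q i = Suc (key \<alpha>) \<and> c \<noteq> 0 \<and> key_less (key \<alpha>) r \<and> f i = (\<lambda>x. c * mon \<alpha> x + r x)" for i
  proof -
    have "Q i \<noteq> 0"
    proof
      assume "Q i = 0"
      then have "f i = (\<lambda>_. 0)" using Q(1)[of i] by (auto simp: key_less_def)
      then show False using Q(2)[of i] by (auto simp: sp_def)
    qed
    then obtain q where q: "Q i = Suc q" by (cases "Q i") auto
    then have "\<not> key_less q (f i)" using Q(2)[of i] Q(3)[of q i "f i"] q by auto
    with key_less_Suc[of q "f i"] Q(1)[of i] q show ?thesis by metis
  qed
  then obtain \<alpha> c r where r: "\<And>i. Q i = Suc (key (\<alpha> i))" "\<And>i. c i \<noteq> 0" "\<And>i. key_less (key (\<alpha> i)) (r i)"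
    "\<And>i. f i = (\<lambda>x. c i * mon (\<alpha> i) x + r i x)" by metis
  obtain i j where ij: "i < j" "\<And>v. \<alpha> i v \<le> \<alpha> j v" using dickson[of \<alpha>] by blast
  define \<gamma> where "\<gamma> v = \<alpha> j v - \<alpha> i v" for v
  have \<alpha>j: "\<alpha> j = (\<lambda>v. \<gamma> v + \<alpha> i v)" using ij(2) by (auto simp: \<gamma>_def)
  have mon: "mon (\<alpha> j) x = mon \<gamma> x * mon (\<alpha> i) x" for x
    unfolding \<alpha>j by (rule mon_add[of UNIV]) auto
  \<comment> \<open>\<open>f i\<close> vanishes on \<open>Z j\<close> because \<open>i < j\<close>.
    Subtracting a multiple of it cancels the leading monomial of \<open>f j\<close> and changes no
    value on \<open>Z j\<close>, so \<open>h\<close> still separates there, against the minimality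
    of \<open>Q j\<close>.\<close>
  define h where "h x = r j x - (c j / c i) * (mon \<gamma> x * r i x)" for x
  have h: "h x = f j x - (c j / c i) * mon \<gamma> x * f i x" for x
    using r(2)[of i] by (simp add: h_def r(4) mon field_simps)
  have k: "key_less (key (\<alpha> j)) (\<lambda>x. mon \<gamma> x * r i x)"
    using key_less_mon_mult[OF r(3)[of i], of \<gamma>] by (simp add: \<alpha>j key_add)
  have "key_less (key (\<alpha> j)) h"
    unfolding h_def by (rule key_less_diff[OF r(3)[of j] k])
  moreover have "sp j h"
  proof -
    have "Z n \<subseteq> Z m" if "m \<le> n" for m n
      using that by (induction rule: dec_induct) (use dec in blast)+
    then have "Z j \<subseteq> Z (Suc i)" "Z (Suc j) \<subseteq> Z (Suc i)" using ij(1) by simp_all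
    then have "f i x = 0" if "x \<in> Z j \<or> x \<in> Z (Suc j)" for x using Q(2)[of i] that by (auto simp: sp_def)
    then show ?thesis using Q(2)[of j] by (auto simp: sp_def h)
  qed
  ultimately show False using Q(3)[of "key (\<alpha> j)" j h] r(1) by simp
qed

section \<open>Linear algebra and standard monomials\<close>

lemma nontrivial_solution:
  fixes c :: "'m \<Rightarrow> 'b \<Rightarrow> real"
  assumes "finite B" "finite M" "card B < card M"
  shows "\<exists>a. (\<exists>\<mu>\<in>M. a \<mu> \<noteq> 0) \<and> (\<forall>\<beta>\<in>B. (\<Sum>\<mu>\<in>M. a \<mu> * c \<mu> \<beta>) = 0)"
  using assms
proof (induction B arbitrary: M c rule: finite_induct)
  case empty
  then have "M \<noteq> {}" by auto
  then show ?case by (intro exI[of _ "\<lambda>_. 1"]) auto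
next
  case (insert \<beta> B)
  show ?case
  proof (cases "\<forall>\<mu>\<in>M. c \<mu> \<beta> = 0")
    case True
    have "card B < card M" using insert by simp
    from insert.IH[OF insert.prems(1) this, of c] obtain a where
      "\<exists>\<mu>\<in>M. a \<mu> \<noteq> 0" "\<forall>\<beta>\<in>B. (\<Sum>\<mu>\<in>M. a \<mu> * c \<mu> \<beta>) = 0" by blast
    then show ?thesis using True by (intro exI[of _ a]) simp
  next
    case False
    then obtain \<nu> where \<nu>: "\<nu> \<in> M" "c \<nu> \<beta> \<noteq> 0" by blast
    define M' where "M' = M - {\<nu>}"
    have M': "finite M'" "\<nu> \<notin> M'" "M = insert \<nu> M'" using insert.prems \<nu> by (auto simp: M'_def)
    have "card B < card M'" using insert.prems insert.hyps M' by simp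
    from insert.IH[OF M'(1) this, of "\<lambda>\<mu> b. c \<mu> b - c \<mu> \<beta> / c \<nu> \<beta> * c \<nu> b"] obtain a where
      a: "\<exists>\<mu>\<in>M'. a \<mu> \<noteq> 0"
        "\<And>b. b \<in> B \<Longrightarrow> (\<Sum>\<mu>\<in>M'. a \<mu> * (c \<mu> b - c \<mu> \<beta> / c \<nu> \<beta> * c \<nu> b)) = 0" by blast
    define s where "s = (\<Sum>\<mu>\<in>M'. a \<mu> * c \<mu> \<beta>)"
    define a' where "a' \<mu> = (if \<mu> = \<nu> then - s / c \<nu> \<beta> else a \<mu>)" for \<mu>
    have sum: "(\<Sum>\<mu>\<in>M. a' \<mu> * c \<mu> b) = (\<Sum>\<mu>\<in>M'. a \<mu> * c \<mu> b) - s / c \<nu> \<beta> * c \<nu> b" for b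
    proof -
      have "(\<Sum>\<mu>\<in>M'. a' \<mu> * c \<mu> b) = (\<Sum>\<mu>\<in>M'. a \<mu> * c \<mu> b)"
        by (rule sum.cong) (use M' in \<open>auto simp: a'_def\<close>)
      then show ?thesis using M' by (simp add: a'_def)
    qed
    have "(\<Sum>\<mu>\<in>M. a' \<mu> * c \<mu> b) = 0" if "b \<in> insert \<beta> B" for b
    proof (cases "b = \<beta>")
      case True
      then show ?thesis using sum[of \<beta>] \<nu> by (simp add: s_def)
    next
      case False
      then have "(\<Sum>\<mu>\<in>M'. a \<mu> * (c \<mu> b - c \<mu> \<beta> / c \<nu> \<beta> * c \<nu> b)) = 0" using a(2) that by simp
      moreover have "(\<Sum>\<mu>\<in>M'. a \<mu> * (c \<mu> b - c \<mu> \<beta> / c \<nu> \<beta> * c \<nu> b))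
          = (\<Sum>\<mu>\<in>M'. a \<mu> * c \<mu> b) - s / c \<nu> \<beta> * c \<nu> b"
        by (simp add: s_def right_diff_distrib sum_subtractf sum_distrib_right sum_divide_distrib mult.assoc)
      ultimately show ?thesis using sum by simp
    qed
    moreover have "\<exists>\<mu>\<in>M. a' \<mu> \<noteq> 0" using a(1) M' by (auto simp: a'_def)
    ultimately show ?thesis by blast
  qed
qed

definition dependent_on :: "nat \<Rightarrow> 'n set \<Rightarrow> ('n \<Rightarrow> real) set \<Rightarrow> bool" where
  "dependent_on c I Z \<longleftrightarrow> (\<exists>g. pol I c g \<and> (\<exists>x. g x \<noteq> 0) \<and> (\<forall>x\<in>Z. g x = 0))"

text \<open>Solved for its monomial of largest key, the relation becomes a rewriting rule that
  lowers keys.\<close>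

lemma dependent_on_leading:
  fixes I :: "'n::finite set"
  assumes "dependent_on c I Z"
  shows "\<exists>l\<in>expo I c. \<exists>b. \<forall>x\<in>Z. mon l x = (\<Sum>\<beta>\<in>{\<beta>\<in>expo I c. key \<beta> < key l}. b \<beta> * mon \<beta> x)"
proof -
  obtain a where a: "\<exists>x. (\<Sum>\<alpha>\<in>expo I c. a \<alpha> * mon \<alpha> x) \<noteq> 0" "\<forall>x\<in>Z. (\<Sum>\<alpha>\<in>expo I c. a \<alpha> * mon \<alpha> x) = 0"
    using assms by (auto simp: dependent_on_def pol_def)
  define A where "A = {\<alpha> \<in> expo I c. a \<alpha> \<noteq> 0}"
  have fin: "finite (expo I c)" by (rule finite_expo) simp
  then have finA: "finite A" by (simp add: A_def)
  have "A \<noteq> {}" using a(1) by (force simp: A_def)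
  then obtain l where l: "l \<in> A" "\<And>\<alpha>. \<alpha> \<in> A \<Longrightarrow> key \<alpha> \<le> key l"
    using finA by (metis (no_types) obtains_MAX Max_ge finite_imageI image_eqI)
  have sub: "A - {l} \<subseteq> {\<beta>\<in>expo I c. key \<beta> < key l}"
    using l key_inj by (fastforce simp: A_def le_less)
  define b where "b \<beta> = (if \<beta> \<in> A then - a \<beta> / a l else 0)" for \<beta>
  have "mon l x = (\<Sum>\<beta>\<in>{\<beta>\<in>expo I c. key \<beta> < key l}. b \<beta> * mon \<beta> x)" if "x \<in> Z" for x
  proof -
    have "(\<Sum>\<alpha>\<in>expo I c. a \<alpha> * mon \<alpha> x) = (\<Sum>\<alpha>\<in>A. a \<alpha> * mon \<alpha> x)"
      by (rule sum.mono_neutral_right) (use fin in \<open>auto simp: A_def\<close>)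
    also have "\<dots> = a l * mon l x + (\<Sum>\<alpha>\<in>A - {l}. a \<alpha> * mon \<alpha> x)" by (rule sum.remove[OF finA l(1)])
    finally have "a l * mon l x = - (\<Sum>\<alpha>\<in>A - {l}. a \<alpha> * mon \<alpha> x)" using a(2) that by simp
    moreover have "a l \<noteq> 0" using l by (simp add: A_def)
    ultimately have "mon l x = - (\<Sum>\<alpha>\<in>A - {l}. a \<alpha> * mon \<alpha> x) / a l" by (simp add: field_simps)
    also have "\<dots> = (\<Sum>\<alpha>\<in>A - {l}. b \<alpha> * mon \<alpha> x)"
      by (simp add: b_def sum_divide_distrib sum_negf)
    also have "\<dots> = (\<Sum>\<beta>\<in>{\<beta>\<in>expo I c. key \<beta> < key l}. b \<beta> * mon \<beta> x)"
      by (rule sum.mono_neutral_left) (use sub fin in \<open>auto simp: b_def\<close>)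
    finally show ?thesis .
  qed
  then show ?thesis using l by (intro bexI[of _ l] exI[of _ b]) (auto simp: A_def)
qed

text \<open>The growth is of order \<open>M ^ r\<close> for fixed \<open>c\<close>; this is how a
  dimension \<open>r\<close> becomes the growth exponent of a Hilbert function.\<close>

lemma card_bounded_off_few:
  "card {\<alpha> :: 'n::finite \<Rightarrow> nat. \<exists>T. card T \<le> r \<and> (\<forall>i. \<alpha> i \<le> (if i \<in> T then M else c))}
     \<le> 2 ^ CARD('n) * ((M + 1) ^ r * (c + 1) ^ CARD('n))" (is "card ?S \<le> _")
proof -
  define \<T> where "\<T> = {T :: 'n set. card T \<le> r}"
  define P where "P T = PiE (UNIV :: 'n set) (\<lambda>i. {..if i \<in> T then M else c})" for T
  have "?S \<subseteq> (\<Union>T\<in>\<T>. P T)" by (auto simp: \<T>_def P_def)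
  moreover have "finite (P T)" for T unfolding P_def by (rule finite_PiE) auto
  moreover have fin: "finite \<T>" by simp
  ultimately have "card ?S \<le> card (\<Union>T\<in>\<T>. P T)" by (intro card_mono finite_UN_I) auto
  also have "\<dots> \<le> (\<Sum>T\<in>\<T>. card (P T))" by (rule card_UN_le[OF fin])
  also have "\<dots> \<le> of_nat (card \<T>) * ((M + 1) ^ r * (c + 1) ^ CARD('n))"
  proof (rule sum_bounded_above)
    fix T assume T: "T \<in> \<T>"
    have "card (P T) = (\<Prod>i\<in>UNIV. if i \<in> T then M + 1 else c + 1)"
      unfolding P_def by (subst card_PiE) (auto intro!: prod.cong)
    also have "\<dots> = (M + 1) ^ card T * (c + 1) ^ card (- T)"
      by (simp add: prod.If_cases Compl_eq)
    also have "\<dots> \<le> (M + 1) ^ r * (c + 1) ^ CARD('n)"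
      using T by (intro mult_mono power_increasing) (auto simp: \<T>_def card_mono)
    finally show "card (P T) \<le> (M + 1) ^ r * (c + 1) ^ CARD('n)" .
  qed
  also have "\<dots> \<le> 2 ^ CARD('n) * ((M + 1) ^ r * (c + 1) ^ CARD('n))"
  proof (rule mult_right_mono)
    have "card \<T> \<le> card (Pow (UNIV :: 'n set))" by (rule card_mono) auto
    then show "of_nat (card \<T>) \<le> (2 :: nat) ^ CARD('n)" by (simp add: card_Pow)
  qed simp
  finally show ?thesis .
qed

text \<open>An upper bound \<open>N\<close> for the Hilbert function of \<open>Z\<close> in degree
  \<open>D\<close>. The spanning monomials may themselves have degree above \<open>D\<close>, since
  the key order does not refine the degree.\<close>

definition spanned :: "'n set \<Rightarrow> nat \<Rightarrow> nat \<Rightarrow> ('n \<Rightarrow> real) set \<Rightarrow> bool" where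
  "spanned K D N Z \<longleftrightarrow> (\<exists>B. finite B \<and> card B \<le> N \<and>
     (\<forall>\<alpha>\<in>expo K D. \<exists>b. \<forall>x\<in>Z. mon \<alpha> x = (\<Sum>\<beta>\<in>B. b \<beta> * mon \<beta> x)))"

text \<open>By induction on the key, the monomials divisible by no leading monomial
  \<open>l I\<close> span. Such a monomial has at most \<open>r\<close> exponents that reach
  \<open>c\<close>: with \<open>r + 1\<close> of them, the set \<open>I\<close> of their coordinates
  would have a leading monomial, of exponents at most \<open>c\<close>, dividing it. The constant
  \<open>A\<close> comes before \<open>Z\<close> and so is uniform.\<close>

lemma standard_monomials:
  fixes r c :: nat
  shows "\<exists>A. \<forall>(Z :: ('n::finite \<Rightarrow> real) set) K D.
    (\<forall>I\<subseteq>K. card I = Suc r \<longrightarrow> dependent_on c I Z) \<longrightarrow>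
    spanned K D (A * (D + 1) ^ r) Z"
proof -
  \<comment> \<open>\<open>P\<close> converts between degrees and keys: degree \<open>D\<close>
    gives key at most \<open>P ^ D\<close>, and such a key gives exponents at most
    \<open>P * D\<close>, because \<open>P \<le> 2 ^ P\<close>.\<close>
  define P where "P = Max (range (prime_of :: 'n \<Rightarrow> nat))"
  have P: "prime_of i \<le> P" for i :: 'n by (simp add: P_def)
  have P1: "1 \<le> P" using P[of undefined] prime_of(2)[of undefined] prime_ge_1_nat order_trans by blast
  define A where "A = 2 ^ CARD('n) * (P ^ r * (c + 1) ^ CARD('n))"
  show ?thesis
  proof (intro exI[of _ A] allI impI)
    fix Z :: "('n \<Rightarrow> real) set" and K D
    assume dep: "\<forall>I\<subseteq>K. card I = Suc r \<longrightarrow> dependent_on c I Z"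
    define \<I> where "\<I> = {I. I \<subseteq> K \<and> card I = Suc r}"
    define Ld where "Ld I l b \<longleftrightarrow> l \<in> expo I c \<and>
        (\<forall>x\<in>Z. mon l x = (\<Sum>\<beta>\<in>{\<beta>\<in>expo I c. key \<beta> < key l}. b \<beta> * mon \<beta> x))" for I l b
    have "\<forall>I\<in>\<I>. \<exists>l b. Ld I l b"
      using dep dependent_on_leading[of c _ Z] unfolding \<I>_def Ld_def by blast
    then obtain l b where "\<forall>I\<in>\<I>. Ld I (l I) (b I)" by metis
    then have l: "\<And>I. I \<in> \<I> \<Longrightarrow> l I \<in> expo I c"
      and b: "\<And>I x. I \<in> \<I> \<Longrightarrow> x \<in> Z \<Longrightarrow>
        mon (l I) x = (\<Sum>\<beta>\<in>{\<beta>\<in>expo I c. key \<beta> < key (l I)}. b I \<beta> * mon \<beta> x)"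
      unfolding Ld_def by blast+
    define Std where "Std = {\<alpha>. {i. \<alpha> i \<noteq> 0} \<subseteq> K \<and> (\<forall>I\<in>\<I>. \<exists>i. \<alpha> i < l I i)}"
    define B where "B Q = {\<alpha> \<in> Std. key \<alpha> \<le> Q}" for Q
    have finB: "finite (B Q)" for Q
      by (rule finite_subset[OF _ finite_key_le[of Q]]) (auto simp: B_def)
    define rep where "rep Q f u \<longleftrightarrow> (\<forall>x\<in>Z. f x = (\<Sum>\<beta>\<in>B Q. u \<beta> * mon \<beta> x))"
      for Q u and f :: "('n \<Rightarrow> real) \<Rightarrow> real"
    define red where "red Q f \<longleftrightarrow> (\<exists>u. rep Q f u)" for Q f
    have red_mono: "red Q' f" if "red Q f" "Q \<le> Q'" for Q Q' f
    proof -
      obtain u where u: "\<forall>x\<in>Z. f x = (\<Sum>\<beta>\<in>B Q. u \<beta> * mon \<beta> x)" using \<open>red Q f\<close> by (auto simp: red_def rep_def)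
      have "(\<Sum>\<beta>\<in>B Q. u \<beta> * mon \<beta> x) = (\<Sum>\<beta>\<in>B Q'. (if \<beta> \<in> B Q then u \<beta> else 0) * mon \<beta> x)" for x
        by (rule sum.mono_neutral_cong_left) (use finB that in \<open>auto simp: B_def\<close>)
      then show ?thesis unfolding red_def rep_def using u by (intro exI[of _ "\<lambda>\<beta>. if \<beta> \<in> B Q then u \<beta> else 0"]) simp
    qed
    have red_sum: "red Q (\<lambda>x. \<Sum>\<gamma>\<in>G. w \<gamma> * h \<gamma> x)" if "\<And>\<gamma>. \<gamma> \<in> G \<Longrightarrow> red Q (h \<gamma>)"
      for Q w and G :: "('n \<Rightarrow> nat) set" and h
    proof -
      have "\<forall>\<gamma>\<in>G. \<exists>u. rep Q (h \<gamma>) u" using that by (simp add: red_def)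
      then obtain u where "\<forall>\<gamma>\<in>G. rep Q (h \<gamma>) (u \<gamma>)" by metis
      then have u: "\<And>\<gamma> x. \<gamma> \<in> G \<Longrightarrow> x \<in> Z \<Longrightarrow> h \<gamma> x = (\<Sum>\<beta>\<in>B Q. u \<gamma> \<beta> * mon \<beta> x)"
        unfolding rep_def by blast
      have "(\<Sum>\<gamma>\<in>G. w \<gamma> * h \<gamma> x) = (\<Sum>\<beta>\<in>B Q. (\<Sum>\<gamma>\<in>G. w \<gamma> * u \<gamma> \<beta>) * mon \<beta> x)" if "x \<in> Z" for x
      proof -
        have "(\<Sum>\<gamma>\<in>G. w \<gamma> * h \<gamma> x) = (\<Sum>\<gamma>\<in>G. \<Sum>\<beta>\<in>B Q. w \<gamma> * u \<gamma> \<beta> * mon \<beta> x)"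
          using u that by (intro sum.cong) (auto simp: sum_distrib_left mult.assoc)
        also have "\<dots> = (\<Sum>\<beta>\<in>B Q. \<Sum>\<gamma>\<in>G. w \<gamma> * u \<gamma> \<beta> * mon \<beta> x)" by (rule sum.swap)
        finally show ?thesis by (simp add: sum_distrib_right)
      qed
      then show ?thesis unfolding red_def rep_def by (intro exI[of _ "\<lambda>\<beta>. \<Sum>\<gamma>\<in>G. w \<gamma> * u \<gamma> \<beta>"]) simp
    qed
    have red: "red (key \<alpha>) (mon \<alpha>)" if "{i. \<alpha> i \<noteq> 0} \<subseteq> K" for \<alpha>
      using that
    proof (induction "key \<alpha>" arbitrary: \<alpha> rule: less_induct)
      case less
      show ?case
      proof (cases "\<alpha> \<in> Std")
        case True
        then have "\<alpha> \<in> B (key \<alpha>)" by (simp add: B_def)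
        then have "mon \<alpha> x = (\<Sum>\<beta>\<in>B (key \<alpha>). (if \<beta> = \<alpha> then 1 else 0) * mon \<beta> x)" for x
          using finB by (simp add: if_distrib[of "\<lambda>z. z * _"] cong: if_cong)
        then show ?thesis unfolding red_def rep_def
          by (intro exI[of _ "\<lambda>\<beta>. if \<beta> = \<alpha> then 1 else 0"]) blast
      next
        case False
        then obtain I where I: "I \<in> \<I>" "\<And>i. l I i \<le> \<alpha> i"
          using less.prems by (auto simp: Std_def not_less)
        define \<gamma> where "\<gamma> i = \<alpha> i - l I i" for i
        have \<alpha>: "\<alpha> = (\<lambda>i. \<gamma> i + l I i)" using I(2) by (auto simp: \<gamma>_def)
        let ?G = "{\<beta>\<in>expo I c. key \<beta> < key (l I)}"
        have "mon \<alpha> x = (\<Sum>\<beta>\<in>?G. b I \<beta> * mon (\<lambda>i. \<gamma> i + \<beta> i) x)" if "x \<in> Z" for x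
        proof -
          have "mon \<alpha> x = mon \<gamma> x * mon (l I) x" unfolding \<alpha> by (rule mon_add[of UNIV]) auto
          also have "\<dots> = (\<Sum>\<beta>\<in>?G. b I \<beta> * (mon \<gamma> x * mon \<beta> x))"
            unfolding b[OF I(1) that] by (simp add: sum_distrib_left mult.left_commute)
          finally show ?thesis by (simp add: mon_add[of UNIV])
        qed
        moreover have "red (key \<alpha>) (\<lambda>x. \<Sum>\<beta>\<in>?G. b I \<beta> * mon (\<lambda>i. \<gamma> i + \<beta> i) x)"
        proof (rule red_sum)
          fix \<beta> assume \<beta>: "\<beta> \<in> ?G"
          have k: "key (\<lambda>i. \<gamma> i + \<beta> i) < key \<alpha>"
            using \<beta> key_pos[of \<gamma>] by (simp add: \<alpha> key_add)
          have "{i. \<gamma> i + \<beta> i \<noteq> 0} \<subseteq> K"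
            using \<beta> I(1) less.prems by (auto simp: \<gamma>_def expo_def \<I>_def)
          from less.hyps[OF k this] k show "red (key \<alpha>) (mon (\<lambda>i. \<gamma> i + \<beta> i))"
            using red_mono less_imp_le by blast
        qed
        ultimately show ?thesis by (simp add: red_def rep_def)
      qed
    qed
    have keyP: "key \<alpha> \<le> P ^ D" if "\<alpha> \<in> expo K D" for \<alpha>
    proof -
      have "key \<alpha> \<le> (\<Prod>i\<in>UNIV. P ^ \<alpha> i)"
        unfolding key_def by (intro prod_mono) (auto intro: power_mono P)
      also have "\<dots> = P ^ (\<Sum>i\<in>UNIV. \<alpha> i)" by (simp add: power_sum)
      also have "(\<Sum>i\<in>UNIV. \<alpha> i) = sum \<alpha> K"
        by (rule sum.mono_neutral_right) (use that in \<open>auto simp: expo_def\<close>)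
      also have "P ^ sum \<alpha> K \<le> P ^ D" using that P1 by (intro power_increasing) (auto simp: expo_def)
      finally show ?thesis .
    qed
    have sub: "B (P ^ D) \<subseteq> {\<alpha>. \<exists>T. card T \<le> r \<and> (\<forall>i. \<alpha> i \<le> (if i \<in> T then P * D else c))}"
    proof
      fix \<alpha> assume \<alpha>: "\<alpha> \<in> B (P ^ D)"
      define T where "T = {i\<in>K. c \<le> \<alpha> i}"
      have "card T \<le> r"
      proof (rule ccontr)
        assume "\<not> card T \<le> r"
        then obtain I where I: "I \<subseteq> T" "card I = Suc r"
          using obtain_subset_with_card_n[of "Suc r" T] by auto
        then have "I \<in> \<I>" by (auto simp: \<I>_def T_def)
        then obtain i where i: "\<alpha> i < l I i" using \<alpha> by (auto simp: B_def Std_def)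
        have "i \<in> I" using i l[OF \<open>I \<in> \<I>\<close>] by (auto simp: expo_def)
        then have "c \<le> \<alpha> i" using I by (auto simp: T_def)
        moreover have "l I i \<le> c" using expo_le[OF l[OF \<open>I \<in> \<I>\<close>]] by simp
        ultimately show False using i by simp
      qed
      moreover have "\<alpha> i \<le> (if i \<in> T then P * D else c)" for i
      proof (cases "i \<in> T")
        case True
        have "2 ^ \<alpha> i \<le> P ^ D" using two_power_le_key[of \<alpha> i] \<alpha> by (auto simp: B_def)
        also have "\<dots> \<le> (2 ^ P) ^ D" by (rule power_mono) (use less_exp[of P] in auto)
        finally have "(2::nat) ^ \<alpha> i \<le> 2 ^ (P * D)" by (simp add: power_mult)
        then show ?thesis using True by simp
      next
        case False
        moreover have "{i. \<alpha> i \<noteq> 0} \<subseteq> K" using \<alpha> by (simp add: B_def Std_def)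
        ultimately show ?thesis by (cases "\<alpha> i = 0") (auto simp: T_def)
      qed
      ultimately show "\<alpha> \<in> {\<alpha>. \<exists>T. card T \<le> r \<and> (\<forall>i. \<alpha> i \<le> (if i \<in> T then P * D else c))}" by blast
    qed
    have fin: "finite {\<alpha> :: 'n \<Rightarrow> nat. \<exists>T. card T \<le> r \<and> (\<forall>i. \<alpha> i \<le> (if i \<in> T then P * D else c))}"
    proof (rule finite_subset)
      show "{\<alpha> :: 'n \<Rightarrow> nat. \<exists>T. card T \<le> r \<and> (\<forall>i. \<alpha> i \<le> (if i \<in> T then P * D else c))} \<subseteq>
        PiE UNIV (\<lambda>_. {..P * D + c})"
      proof
        fix \<alpha> :: "'n \<Rightarrow> nat"
        assume "\<alpha> \<in> {\<alpha>. \<exists>T. card T \<le> r \<and> (\<forall>i. \<alpha> i \<le> (if i \<in> T then P * D else c))}"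
        then obtain T where T: "\<And>i. \<alpha> i \<le> (if i \<in> T then P * D else c)" by blast
        have "\<alpha> i \<le> P * D + c" for i using T[of i] by (cases "i \<in> T") auto
        then show "\<alpha> \<in> PiE UNIV (\<lambda>_. {..P * D + c})" by auto
      qed
      show "finite (PiE (UNIV :: 'n set) (\<lambda>_. {..P * D + c}))" by (rule finite_PiE) auto
    qed
    have "card (B (P ^ D)) \<le> 2 ^ CARD('n) * ((P * D + 1) ^ r * (c + 1) ^ CARD('n))"
      by (rule order_trans[OF card_mono[OF fin sub] card_bounded_off_few])
    also have "\<dots> \<le> 2 ^ CARD('n) * ((P * (D + 1)) ^ r * (c + 1) ^ CARD('n))"
      using P1 by (intro mult_left_mono mult_right_mono power_mono) auto
    also have "\<dots> = A * (D + 1) ^ r" unfolding A_def power_mult_distrib by (simp only: mult_ac)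
    finally have "card (B (P ^ D)) \<le> A * (D + 1) ^ r" .
    moreover have "\<exists>u. \<forall>x\<in>Z. mon \<alpha> x = (\<Sum>\<beta>\<in>B (P ^ D). u \<beta> * mon \<beta> x)" if "\<alpha> \<in> expo K D" for \<alpha>
      using red_mono[OF red keyP[OF that]] that by (auto simp: red_def rep_def expo_def)
    ultimately show "spanned K D (A * (D + 1) ^ r) Z"
      unfolding spanned_def using finB[of "P ^ D"] by (intro exI[of _ "B (P ^ D)"]) blast
  qed
qed

section \<open>Dimension of real varieties\<close>

lemma expo_UNIV: "expo UNIV D = exponents_upto D"
  by (auto simp: expo_def exponents_upto_def)

lemma monom_fun_mon: "monom_fun \<alpha> x = mon \<alpha> (($) x)"
  by (simp add: monom_fun_def mon_eq[of UNIV])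

lemma poly_fun_deg_le_iff: "poly_fun_deg_le D f \<longleftrightarrow> (\<exists>g. pol UNIV D g \<and> f = (\<lambda>x. g (($) x)))"
  unfolding poly_fun_deg_le_def pol_def expo_UNIV monom_fun_mon by auto

text \<open>Over the reals a sum of squares merges all equations into one of twice the
  degree.\<close>

lemma defined_in_degree_single:
  fixes W :: "(real ^ 'n::finite) set"
  assumes "defined_in_degree D W"
  shows "\<exists>g. pol UNIV (2 * D) g \<and> W = {x. g (($) x) = 0}"
proof -
  obtain A where A: "finite A" "\<forall>f\<in>A. poly_fun_deg_le D f" "W = {x. \<forall>f\<in>A. f x = 0}"
    using assms by (auto simp: defined_in_degree_def)
  have "\<forall>f\<in>A. \<exists>g. pol UNIV D g \<and> (\<forall>x. f x = g (($) x))"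
  proof
    fix f assume "f \<in> A"
    then obtain g where "pol UNIV D g" "f = (\<lambda>x. g (($) x))"
      using A(2) unfolding poly_fun_deg_le_iff by blast
    then show "\<exists>g. pol UNIV D g \<and> (\<forall>x. f x = g (($) x))" by (intro exI[of _ g]) auto
  qed
  then obtain G where G: "\<And>f. f \<in> A \<Longrightarrow> pol UNIV D (G f)" "\<And>f x. f \<in> A \<Longrightarrow> f x = G f (($) x)"
    by metis
  let ?g = "\<lambda>x. \<Sum>f\<in>A. (G f x)\<^sup>2"
  have "pol UNIV (2 * D) ?g"
  proof (rule pol_sum)
    show "pol UNIV (2 * D) (\<lambda>x. (G f x)\<^sup>2)" if "f \<in> A" for f
      using pol_power[OF _ G(1)[OF that], of 2] by (simp add: mult.commute)
  qed simp
  moreover have "(\<forall>f\<in>A. f x = 0) \<longleftrightarrow> ?g (($) x) = 0" for x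
  proof -
    have "?g (($) x) = 0 \<longleftrightarrow> (\<forall>f\<in>A. (G f (($) x))\<^sup>2 = 0)"
      using A(1) by (intro sum_nonneg_eq_0_iff) auto
    also have "\<dots> \<longleftrightarrow> (\<forall>f\<in>A. f x = 0)" using G(2) by simp
    finally show ?thesis by simp
  qed
  ultimately show ?thesis using A(3) by (intro exI[of _ ?g]) auto
qed

lemma variety_pol: "pol UNIV D g \<Longrightarrow> variety {x. g (($) x) = 0}"
  unfolding variety_iff_defined_in_degree defined_in_degree_def
  by (intro exI[of _ D] exI[of _ "{\<lambda>x. g (($) x)}"]) (auto simp: poly_fun_deg_le_iff)

lemma variety_obtain:
  assumes "variety W" obtains D g where "pol UNIV D g" "W = {x. g (($) x) = 0}"
  using assms defined_in_degree_single unfolding variety_iff_defined_in_degree by blast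

lemma variety_Int:
  assumes "variety W" "variety W'" shows "variety (W \<inter> W')"
proof -
  obtain A where "finite A" "\<forall>f\<in>A. real_polynomial_function f" "W = {x. \<forall>f\<in>A. f x = 0}"
    using assms(1) unfolding variety_def by blast
  moreover obtain A' where "finite A'" "\<forall>f\<in>A'. real_polynomial_function f" "W' = {x. \<forall>f\<in>A'. f x = 0}"
    using assms(2) unfolding variety_def by blast
  ultimately show ?thesis unfolding variety_def by (intro exI[of _ "A \<union> A'"]) auto
qed

lemma variety_point: "variety {p :: real ^ 'n::finite}"
proof -
  have "pol UNIV (1 * 2) (\<lambda>x. \<Sum>i\<in>UNIV. (x i - p $ i)\<^sup>2)"
    by (intro pol_sum pol_power pol_diff pol_var pol_const) auto
  from variety_pol[OF this] have "variety {x. (\<Sum>i\<in>UNIV. (x $ i - p $ i)\<^sup>2) = 0}" .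
  moreover have "(\<Sum>i\<in>UNIV. (x $ i - p $ i)\<^sup>2) = 0 \<longleftrightarrow> x = p" for x
    by (subst sum_nonneg_eq_0_iff) (auto simp: vec_eq_iff)
  ultimately show ?thesis by simp
qed

lemma irreducible_point: "irreducible_variety {p :: real ^ 'n::finite}"
  unfolding irreducible_variety_def
proof (intro conjI allI impI)
  fix W1 W2 assume "variety W1 \<and> variety W2 \<and> {p} = W1 \<union> W2"
  then have "W1 \<subseteq> {p}" "W2 \<subseteq> {p}" "p \<in> W1 \<or> p \<in> W2" by auto
  then show "{p} = W1 \<or> {p} = W2" by blast
qed (use variety_point in auto)

lemma irreducible_mult:
  assumes Z: "irreducible_variety Z" and f: "pol UNIV D f" and g: "pol UNIV E g"
    and fg: "\<forall>x\<in>Z. f (($) x) * g (($) x) = 0"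
  shows "(\<forall>x\<in>Z. f (($) x) = 0) \<or> (\<forall>x\<in>Z. g (($) x) = 0)"
proof -
  let ?A = "Z \<inter> {x. f (($) x) = 0}" and ?B = "Z \<inter> {x. g (($) x) = 0}"
  have "variety Z" using Z by (simp add: irreducible_variety_def)
  then have "variety ?A" "variety ?B" using variety_Int variety_pol f g by blast+
  moreover have "Z = ?A \<union> ?B" using fg by auto
  ultimately have "Z = ?A \<or> Z = ?B" using Z unfolding irreducible_variety_def by meson
  then show ?thesis by blast
qed

lemma variety_separate:
  assumes "variety W" "x \<notin> W"
  shows "\<exists>D f. pol UNIV D f \<and> (\<forall>y\<in>W. f (($) y) = 0) \<and> f (($) x) \<noteq> 0"
proof -
  obtain D g where "pol UNIV D g" "W = {x. g (($) x) = 0}" using variety_obtain[OF assms(1)] .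
  then show ?thesis using assms(2) by (intro exI[of _ D] exI[of _ g]) auto
qed

text \<open>Strict inclusion of varieties is well-founded, because an infinite descent would
  contradict \<open>no_descending_zero_sets\<close>.\<close>

lemma variety_minimal:
  fixes W :: "(real ^ 'n::finite) set"
  assumes "variety W" "\<Phi> W"
  shows "\<exists>Z\<subseteq>W. variety Z \<and> \<Phi> Z \<and> (\<forall>Z'. variety Z' \<longrightarrow> Z' \<subset> Z \<longrightarrow> \<not> \<Phi> Z')"
proof -
  let ?r = "{(Z', Z :: (real ^ 'n) set). variety Z' \<and> variety Z \<and> Z' \<subset> Z}"
  have "wf ?r"
    unfolding wf_iff_no_infinite_down_chain
  proof
    assume "\<exists>f. \<forall>i. (f (Suc i), f i) \<in> ?r"
    then obtain f where "\<forall>i. (f (Suc i), f i) \<in> ?r" by blast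
    then have f: "variety (f i)" "f (Suc i) \<subset> f i" for i by simp_all
    show False
    proof (rule no_descending_zero_sets[of "\<lambda>i. ($) ` f i"])
      show "($) ` f (Suc i) \<subseteq> ($) ` f i" for i using f(2)[of i] by blast
      fix i
      obtain x where x: "x \<in> f i" "x \<notin> f (Suc i)" using f(2)[of i] by blast
      from variety_separate[OF f(1) x(2)] x(1)
      show "\<exists>D g. pol UNIV D g \<and> (\<forall>x\<in>($) ` f (Suc i). g x = 0) \<and> (\<exists>x\<in>($) ` f i. g x \<noteq> 0)" by blast
    qed
  qed
  moreover have "W \<in> {Z. Z \<subseteq> W \<and> variety Z \<and> \<Phi> Z}" using assms by auto
  ultimately obtain Z where Z: "Z \<in> {Z. Z \<subseteq> W \<and> variety Z \<and> \<Phi> Z}"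
    "\<And>Z'. (Z', Z) \<in> ?r \<Longrightarrow> Z' \<notin> {Z. Z \<subseteq> W \<and> variety Z \<and> \<Phi> Z}"
    by (rule wfE_min) blast
  then show ?thesis by (intro exI[of _ Z]) auto
qed

section \<open>Algebraically independent coordinates and chains of irreducible varieties\<close>

definition independent_on :: "'n set \<Rightarrow> (real ^ 'n::finite) set \<Rightarrow> bool" where
  "independent_on I W \<longleftrightarrow> (\<forall>D g. pol I D g \<longrightarrow> (\<forall>x\<in>W. g (($) x) = 0) \<longrightarrow> (\<forall>x. g x = 0))"

lemma independent_on_Un:
  assumes "independent_on I (W1 \<union> W2)"
  shows "independent_on I W1 \<or> independent_on I W2"
proof (rule ccontr)
  assume "\<not> ?thesis"
  then obtain D g u E h w where g: "pol I D g" "\<forall>x\<in>W1. g (($) x) = 0" "g u \<noteq> 0"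
    and h: "pol I E h" "\<forall>x\<in>W2. h (($) x) = 0" "h w \<noteq> 0" by (auto simp: independent_on_def)
  have fin: "finite I" by simp
  have "pol I (D + E) (\<lambda>x. g x * h x)" by (rule pol_mult[OF fin g(1) h(1)])
  moreover have "\<forall>x\<in>W1 \<union> W2. g (($) x) * h (($) x) = 0" using g h by auto
  ultimately have "\<forall>x. g x * h x = 0" using assms unfolding independent_on_def by blast
  then show False using pol_mult_nonzero[OF fin g(1,3) h(1,3)] by blast
qed

lemma fat_imp_independent:
  fixes W :: "(real ^ 'n::finite) set"
  assumes "fat I (($) ` W)" shows "independent_on I W"
  unfolding independent_on_def
proof (intro allI impI)
  fix D g x assume g: "pol I D g" "\<forall>x\<in>W. g (($) x) = 0"
  obtain w e where e: "e > 0" "\<And>t. \<forall>i\<in>I. \<bar>t i - w i\<bar> < e \<Longrightarrow> \<exists>z\<in>($) ` W. \<forall>i\<in>I. z i = t i"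
    using assms unfolding fat_def by metis
  have box: "g t = 0" if t: "\<forall>i\<in>I. \<bar>t i - w i\<bar> < e" for t
  proof -
    obtain z where "z \<in> W" "\<forall>i\<in>I. z $ i = t i" using e(2)[OF t] by auto
    then show ?thesis using g(2) pol_cong[OF g(1), of "($) z" t] by auto
  qed
  obtain p where p: "\<And>t. g (\<lambda>v. w v + t * (x v - w v)) = poly p t"
    using pol_line[OF _ g(1), of w x] by auto
  \<comment> \<open>\<open>M\<close> exceeds every coordinate of the direction \<open>x - w\<close>,
    so the segment with \<open>0 \<le> t \<le> e / M\<close> stays in the open cube and provides
    infinitely many roots of \<open>p\<close>.\<close>
  define M where "M = 1 + (\<Sum>i\<in>UNIV. \<bar>x i - w i\<bar>)"
  have M: "M > 0" "\<bar>x i - w i\<bar> < M" for i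
    using member_le_sum[of i UNIV "\<lambda>i. \<bar>x i - w i\<bar>"] by (auto simp: M_def add_pos_nonneg sum_nonneg)
  have "poly p t = 0" if "t \<in> {0..e / M}" for t
  proof -
    have "\<bar>t * (x i - w i)\<bar> < e" for i
    proof (cases "t = 0")
      case False
      have "\<bar>t * (x i - w i)\<bar> = t * \<bar>x i - w i\<bar>" using that by (simp add: abs_mult)
      also have "\<dots> < t * M" using M that False by (intro mult_strict_left_mono) auto
      also have "\<dots> \<le> e / M * M" using M that by (intro mult_right_mono) auto
      finally show ?thesis using M by simp
    qed (use e in simp)
    then have "g (\<lambda>v. w v + t * (x v - w v)) = 0" by (intro box) simp
    then show ?thesis using p by simp
  qed
  then have "{0..e / M} \<subseteq> {t. poly p t = 0}" by blast
  moreover have "infinite {0..e / M}" using e(1) M(1) by (simp add: infinite_Icc)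
  ultimately have "p = 0" using poly_roots_finite[of p] finite_subset by blast
  then show "g x = 0" using p[of 1] by simp
qed

text \<open>The converse of \<open>fat_imp_independent\<close>: by \<open>fat_or_dependent\<close>,
  a variety whose projection has no interior point satisfies a relation in the coordinates of
  \<open>I\<close>.\<close>

lemma independent_imp_fat:
  fixes W :: "(real ^ 'n::finite) set"
  assumes "variety W" "independent_on I W" shows "fat I (($) ` W)"
proof -
  obtain D f where f: "pol UNIV D f" "W = {x. f (($) x) = 0}" using variety_obtain[OF assms(1)] .
  obtain a where a: "f = (\<lambda>x. \<Sum>\<alpha>\<in>expo UNIV D. a \<alpha> * mon \<alpha> x)" using f(1) by (auto simp: pol_def)
  have W: "($) ` W = {w. (\<Sum>\<alpha>\<in>expo UNIV D. a \<alpha> * mon \<alpha> w) = 0}"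
  proof
    show "($) ` W \<subseteq> {w. (\<Sum>\<alpha>\<in>expo UNIV D. a \<alpha> * mon \<alpha> w) = 0}" by (auto simp: f(2) a)
    show "{w. (\<Sum>\<alpha>\<in>expo UNIV D. a \<alpha> * mon \<alpha> w) = 0} \<subseteq> ($) ` W"
    proof
      fix w assume "w \<in> {w. (\<Sum>\<alpha>\<in>expo UNIV D. a \<alpha> * mon \<alpha> w) = 0}"
      moreover have "w = ($) (vec_lambda w)" by auto
      ultimately show "w \<in> ($) ` W" by (intro image_eqI[of _ _ "vec_lambda w"]) (auto simp: f(2) a)
    qed
  qed
  obtain c where c: "fat I (($) ` W) \<or> (\<exists>g. pol I c g \<and> (\<exists>x. g x \<noteq> 0) \<and> (\<forall>w\<in>($) ` W. g w = 0))"
    using fat_or_dependent[of I D] unfolding W by blast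
  then show ?thesis using assms(2) unfolding independent_on_def by blast
qed

text \<open>A minimal subvariety \<open>Z\<close> on which the coordinates are independent is
  irreducible, since independence passes to one part of a union. It is fat again, so fixing the
  coordinate \<open>i\<close> at \<open>w i\<close> leaves a variety that is fat in the remaining
  ones. The slice is proper because \<open>Z\<close> also has a point with this coordinate
  \<open>w i + e / 2\<close>.\<close>

lemma fat_chain:
  fixes W :: "(real ^ 'n::finite) set"
  assumes "variety W" "fat I (($) ` W)"
  shows "has_irreducible_chain W (card I)"
proof -
  have "finite I" by simp
  then show ?thesis using assms
  proof (induction I arbitrary: W rule: finite_induct)
    case empty
    then obtain p where "p \<in> W" by (auto simp: fat_def)
    then show ?case unfolding has_irreducible_chain_def
      by (intro exI[of _ "\<lambda>_. {p}"]) (simp add: irreducible_point)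
  next
    case (insert i I)
    obtain Z where Z: "Z \<subseteq> W" "variety Z" "independent_on (insert i I) Z"
      "\<And>Z'. variety Z' \<Longrightarrow> Z' \<subset> Z \<Longrightarrow> \<not> independent_on (insert i I) Z'"
      using variety_minimal[of W "independent_on (insert i I)"] insert.prems fat_imp_independent by blast
    have "Z \<noteq> {}"
    proof
      assume "Z = {}"
      then have "\<forall>x :: 'n \<Rightarrow> real. (1::real) = 0"
        using Z(3) pol_const[of "insert i I" 0 1] unfolding independent_on_def by fastforce
      then show False by simp
    qed
    moreover have "Z = W1 \<or> Z = W2" if "variety W1" "variety W2" "Z = W1 \<union> W2" for W1 W2
      using independent_on_Un[of "insert i I" W1 W2] Z(3,4) that by blast
    ultimately have irr: "irreducible_variety Z" using Z(2) by (auto simp: irreducible_variety_def)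
    obtain w e where e: "e > 0" "\<And>t. \<forall>j\<in>insert i I. \<bar>t j - w j\<bar> < e \<Longrightarrow>
        \<exists>z\<in>($) ` Z. \<forall>j\<in>insert i I. z j = t j"
      using independent_imp_fat[OF Z(2,3)] unfolding fat_def by metis
    define Z' where "Z' = Z \<inter> {x. x $ i - w i = 0}"
    have "pol UNIV 1 (\<lambda>x :: 'n \<Rightarrow> real. x i - w i)" by (intro pol_diff pol_var pol_const) auto
    from variety_pol[OF this] have "variety Z'" unfolding Z'_def by (intro variety_Int Z(2))
    moreover have "fat I (($) ` Z')"
      unfolding fat_def
    proof (intro exI[of _ w] exI[of _ e] conjI allI impI e(1))
      fix t assume t: "\<forall>j\<in>I. \<bar>t j - w j\<bar> < e"
      have "\<forall>j\<in>insert i I. \<bar>(t(i := w i)) j - w j\<bar> < e" using t e(1) by simp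
      from e(2)[OF this] obtain z where z: "z \<in> Z" "\<forall>j\<in>insert i I. z $ j = (t(i := w i)) j" by auto
      then have "z \<in> Z'" by (simp add: Z'_def)
      moreover have "\<forall>j\<in>I. z $ j = t j" using z(2) insert.hyps by auto
      ultimately show "\<exists>z\<in>($) ` Z'. \<forall>j\<in>I. z j = t j" by blast
    qed
    ultimately have "has_irreducible_chain Z' (card I)" by (rule insert.IH)
    then obtain Y where Y: "\<forall>j\<le>card I. irreducible_variety (Y j)" "\<forall>j<card I. Y j \<subset> Y (Suc j)"
      "Y (card I) \<subseteq> Z'" by (auto simp: has_irreducible_chain_def)
    have "Z' \<subset> Z"
    proof -
      have "\<forall>j\<in>insert i I. \<bar>(w(i := w i + e / 2)) j - w j\<bar> < e" using e(1) by simp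
      from e(2)[OF this] obtain z where "z \<in> Z" "z $ i = w i + e / 2" by auto
      then have "z \<in> Z - Z'" using e(1) by (simp add: Z'_def)
      then show ?thesis by (auto simp: Z'_def)
    qed
    then have "Y (card I) \<subset> Z" using Y(3) by blast
    then show ?case unfolding has_irreducible_chain_def
      using Y irr Z(1) insert.hyps
      by (intro exI[of _ "\<lambda>j. if j \<le> card I then Y j else Z"]) (auto simp: less_Suc_eq le_Suc_eq)
  qed
qed

text \<open>Fatness in \<open>\<delta> + 1\<close> coordinates would give a chain longer than the
  dimension, so the other case of \<open>fat_or_dependent\<close> holds. Its bound depends only on
  \<open>c\<close> and \<open>I\<close>, and the sum over all \<open>I\<close> serves every set of
  coordinates.\<close>

lemma bounded_degree_dependence:
  fixes c :: nat
  shows "\<exists>c'. \<forall>(W :: (real ^ 'n::finite) set) (I :: 'n set) \<delta>. defined_in_degree c W \<longrightarrow> variety_dim W = ereal (real \<delta>) \<longrightarrow>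
    card I = Suc \<delta> \<longrightarrow> dependent_on c' I (($) ` W)"
proof -
  define Q where "Q I c' \<longleftrightarrow> (\<forall>a. fat I {w. (\<Sum>\<alpha>\<in>expo UNIV (2 * c). a \<alpha> * mon \<alpha> w) = 0} \<or>
    (\<exists>g. pol I c' g \<and> (\<exists>x. g x \<noteq> 0) \<and> (\<forall>w. (\<Sum>\<alpha>\<in>expo UNIV (2 * c). a \<alpha> * mon \<alpha> w) = 0 \<longrightarrow> g w = 0)))"
    for I :: "'n set" and c'
  have "\<forall>I. \<exists>c'. Q I c'" using fat_or_dependent[of _ "2 * c"] unfolding Q_def by blast
  then obtain C where C: "\<And>I. Q I (C I)" by metis
  have le: "C I \<le> sum C UNIV" for I by (rule member_le_sum) auto
  show ?thesis
  proof (intro exI[of _ "sum C UNIV"] allI impI)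
    fix W :: "(real ^ 'n) set" and I :: "'n set" and \<delta>
    assume W: "defined_in_degree c W" and dim: "variety_dim W = ereal (real \<delta>)" and I: "card I = Suc \<delta>"
    obtain f where f: "pol UNIV (2 * c) f" "W = {x. f (($) x) = 0}" using defined_in_degree_single[OF W] by blast
    obtain a where a: "f = (\<lambda>x. \<Sum>\<alpha>\<in>expo UNIV (2 * c). a \<alpha> * mon \<alpha> x)" using f(1) by (auto simp: pol_def)
    have img: "($) ` W = {w. (\<Sum>\<alpha>\<in>expo UNIV (2 * c). a \<alpha> * mon \<alpha> w) = 0}"
    proof (intro equalityI subsetI)
      fix w assume "w \<in> {w. (\<Sum>\<alpha>\<in>expo UNIV (2 * c). a \<alpha> * mon \<alpha> w) = 0}"
      moreover have "w = ($) (vec_lambda w)" by auto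
      ultimately show "w \<in> ($) ` W" by (intro image_eqI[of _ _ "vec_lambda w"]) (auto simp: f(2) a)
    qed (auto simp: f(2) a)
    have "\<not> fat I (($) ` W)"
    proof
      assume "fat I (($) ` W)"
      moreover have "variety W" using W variety_iff_defined_in_degree by blast
      ultimately have "has_irreducible_chain W (Suc \<delta>)" using fat_chain I by metis
      then have "ereal (real (Suc \<delta>)) \<le> variety_dim W"
        unfolding variety_dim_def by (intro SUP_upper) simp
      then show False using dim by simp
    qed
    then obtain g where g: "pol I (C I) g" "\<exists>x. g x \<noteq> 0" "\<forall>w\<in>($) ` W. g w = 0"
      using C[of I] unfolding Q_def img by blast
    moreover have "pol I (sum C UNIV) g" by (rule pol_mono[OF g(1) _ subset_refl le]) simp
    ultimately show "dependent_on (sum C UNIV) I (($) ` W)"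
      unfolding dependent_on_def by blast
  qed
qed

section \<open>Lower bounds for Hilbert functions from chains\<close>

definition indep_family :: "(real ^ 'n::finite) set \<Rightarrow> nat \<Rightarrow> nat \<Rightarrow> bool" where
  "indep_family Z D N \<longleftrightarrow> (\<exists>f. (\<forall>i<N. pol UNIV D (f i)) \<and>
     (\<forall>a. (\<forall>x\<in>Z. (\<Sum>i<N. a i * f i (($) x)) = 0) \<longrightarrow> (\<forall>i<N. a i = (0::real))))"

lemma indep_family_mono: "indep_family Z D N \<Longrightarrow> D \<le> D' \<Longrightarrow> indep_family Z D' N"
  unfolding indep_family_def using pol_mono[of UNIV D _ UNIV D'] by (metis finite subset_UNIV)

lemma sum_lessThan_add:
  fixes g :: "nat \<Rightarrow> real" and M N :: nat
  shows "(\<Sum>i<N + M. g i) = (\<Sum>i<N. g i) + (\<Sum>j<M. g (N + j))"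
  by (induction M) auto

text \<open>Multiplication by a polynomial that vanishes on \<open>Z0\<close> but not on \<open>Z1\<close> embeds the functions
  on \<open>Z1\<close> into those that vanish on \<open>Z0\<close>.\<close>

lemma indep_family_add:
  fixes Z0 Z1 :: "(real ^ 'n::finite) set"
  assumes Z0: "variety Z0" "Z0 \<subset> Z1" and Z1: "irreducible_variety Z1"
  shows "\<exists>m. \<forall>D N0 N1. indep_family Z0 (D + m) N0 \<longrightarrow> indep_family Z1 D N1 \<longrightarrow> indep_family Z1 (D + m) (N0 + N1)"
proof -
  obtain p where p: "p \<in> Z1" "p \<notin> Z0" using Z0(2) by blast
  obtain m f where f: "pol UNIV m f" "\<forall>y\<in>Z0. f (($) y) = 0" "f (($) p) \<noteq> 0"
    using variety_separate[OF Z0(1) p(2)] by blast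
  show ?thesis
  proof (intro exI[of _ m] allI impI)
    fix D N0 N1 assume "indep_family Z0 (D + m) N0" "indep_family Z1 D N1"
    then obtain g h where g: "\<forall>i<N0. pol UNIV (D + m) (g i)"
      "\<And>a. \<forall>x\<in>Z0. (\<Sum>i<N0. a i * g i (($) x)) = 0 \<Longrightarrow> \<forall>i<N0. a i = (0::real)"
      and h: "\<forall>i<N1. pol UNIV D (h i)"
      "\<And>a. \<forall>x\<in>Z1. (\<Sum>i<N1. a i * h i (($) x)) = 0 \<Longrightarrow> \<forall>i<N1. a i = (0::real)"
      unfolding indep_family_def by blast
    define e where "e i = (if i < N0 then g i else (\<lambda>x. h (i - N0) x * f x))" for i
    have "pol UNIV (D + m) (e i)" if "i < N0 + N1" for i
      using g(1) h(1) that pol_mult[OF _ _ f(1), of D "h (i - N0)"] by (simp add: e_def)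
    moreover have "\<forall>i<N0 + N1. a i = 0" if a: "\<forall>x\<in>Z1. (\<Sum>i<N0 + N1. a i * e i (($) x)) = 0" for a :: "nat \<Rightarrow> real"
    proof -
      have s: "(\<Sum>i<N0 + N1. a i * e i x) = (\<Sum>i<N0. a i * g i x) + (\<Sum>j<N1. a (N0 + j) * h j x) * f x" for x
        by (simp add: sum_lessThan_add e_def sum_distrib_right mult.assoc)
      have "\<forall>x\<in>Z0. (\<Sum>i<N0. a i * g i (($) x)) = 0"
      proof
        fix x assume "x \<in> Z0"
        then have "x \<in> Z1" "f (($) x) = 0" using Z0(2) f(2) by auto
        then show "(\<Sum>i<N0. a i * g i (($) x)) = 0" using a s[of "($) x"] by simp
      qed
      then have a0: "\<forall>i<N0. a i = 0" by (rule g(2))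
      then have "\<forall>x\<in>Z1. (\<Sum>j<N1. a (N0 + j) * h j (($) x)) * f (($) x) = 0" using a unfolding s by simp
      moreover have "pol UNIV D (\<lambda>x. \<Sum>j<N1. a (N0 + j) * h j x)"
        using h(1) by (intro pol_sum pol_cmult) auto
      ultimately have "(\<forall>x\<in>Z1. (\<Sum>j<N1. a (N0 + j) * h j (($) x)) = 0) \<or> (\<forall>x\<in>Z1. f (($) x) = 0)"
        using irreducible_mult[OF Z1 _ f(1)] by blast
      then have "\<forall>x\<in>Z1. (\<Sum>j<N1. a (N0 + j) * h j (($) x)) = 0" using f(3) p by blast
      then have "\<forall>j<N1. a (N0 + j) = 0" by (rule h(2))
      then have "a i = 0" if "i < N0 + N1" for i
      proof (cases "i < N0")
        case False
        then have "i = N0 + (i - N0)" "i - N0 < N1" using that by auto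
        then show ?thesis using \<open>\<forall>j<N1. a (N0 + j) = 0\<close> by metis
      qed (use a0 in simp)
      then show ?thesis by blast
    qed
    ultimately show "indep_family Z1 (D + m) (N0 + N1)"
      unfolding indep_family_def by (intro exI[of _ e]) blast
  qed
qed

text \<open>One more variety in the chain raises the growth exponent by one: \<open>s\<close> rounds
  of \<open>indep_family_add\<close>, each adding the fixed amount \<open>m\<close> to the degree,
  gain \<open>s ^ r\<close> independent functions each.\<close>

lemma chain_growth:
  fixes Z :: "nat \<Rightarrow> (real ^ 'n::finite) set"
  assumes "\<forall>i\<le>r. irreducible_variety (Z i)" "\<forall>i<r. Z i \<subset> Z (Suc i)"
  shows "\<exists>a. \<forall>s. indep_family (Z r) (a * s) (s ^ r)"
  using assms
proof (induction r)
  case 0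
  then obtain p where "p \<in> Z 0" by (auto simp: irreducible_variety_def)
  then have "indep_family (Z 0) D 1" for D
    unfolding indep_family_def by (intro exI[of _ "\<lambda>_ _. 1"]) (auto intro: pol_const)
  then show ?case by simp
next
  case (Suc r)
  then obtain a where a: "\<And>s. indep_family (Z r) (a * s) (s ^ r)" by auto
  have "variety (Z r)" "irreducible_variety (Z (Suc r))" using Suc.prems by (auto simp: irreducible_variety_def)
  moreover have "Z r \<subset> Z (Suc r)" using Suc.prems by simp
  ultimately obtain m where "\<forall>D N0 N1. indep_family (Z r) (D + m) N0 \<longrightarrow> indep_family (Z (Suc r)) D N1 \<longrightarrow>
      indep_family (Z (Suc r)) (D + m) (N0 + N1)"
    using indep_family_add[of "Z r" "Z (Suc r)"] by blast
  note m = this[rule_format]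
  have "indep_family (Z (Suc r)) (a * s + m * j) (j * s ^ r)" for s j
  proof (induction j)
    case 0
    show ?case by (simp add: indep_family_def)
  next
    case (Suc j)
    have "indep_family (Z r) (a * s + m * j + m) (s ^ r)"
      by (rule indep_family_mono[OF a[of s]]) simp
    from m[OF this Suc] show ?case by (simp add: add_ac)
  qed
  from this[of s s for s] have "indep_family (Z (Suc r)) ((a + m) * s) (s ^ Suc r)" for s
    by (simp add: distrib_right)
  then show ?case by blast
qed

lemma indep_family_le_span:
  assumes ind: "indep_family Z D N" and B: "finite B"
    and span: "\<And>f. pol UNIV D f \<Longrightarrow> \<exists>b. \<forall>x\<in>Z. f (($) x) = (\<Sum>\<beta>\<in>B. b \<beta> * h \<beta> x)"
  shows "N \<le> card B"
proof (rule ccontr)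
  assume "\<not> N \<le> card B"
  obtain f where f: "\<And>i. i < N \<Longrightarrow> pol UNIV D (f i)"
    "\<And>a. \<forall>x\<in>Z. (\<Sum>i<N. a i * f i (($) x)) = 0 \<Longrightarrow> \<forall>i<N. a i = (0::real)"
    using ind unfolding indep_family_def by blast
  define rep where "rep i b \<longleftrightarrow> (\<forall>x\<in>Z. f i (($) x) = (\<Sum>\<beta>\<in>B. b \<beta> * h \<beta> x))" for i b
  have "\<forall>i\<in>{..<N}. \<exists>b. rep i b" using span f(1) unfolding rep_def by blast
  then obtain b where b: "\<And>i. i < N \<Longrightarrow> rep i (b i)" by (metis lessThan_iff)
  obtain a where a: "\<exists>i\<in>{..<N}. a i \<noteq> 0" "\<forall>\<beta>\<in>B. (\<Sum>i<N. a i * b i \<beta>) = 0"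
    using nontrivial_solution[OF B, of "{..<N}" b] \<open>\<not> N \<le> card B\<close> by auto
  have "(\<Sum>i<N. a i * f i (($) x)) = 0" if "x \<in> Z" for x
  proof -
    have "(\<Sum>i<N. a i * f i (($) x)) = (\<Sum>i<N. \<Sum>\<beta>\<in>B. a i * b i \<beta> * h \<beta> x)"
      using b that by (intro sum.cong) (auto simp: rep_def sum_distrib_left mult.assoc)
    also have "\<dots> = (\<Sum>\<beta>\<in>B. \<Sum>i<N. a i * b i \<beta> * h \<beta> x)" by (rule sum.swap)
    also have "\<dots> = (\<Sum>\<beta>\<in>B. (\<Sum>i<N. a i * b i \<beta>) * h \<beta> x)" by (simp add: sum_distrib_right)
    also have "\<dots> = 0" using a(2) by simp
    finally show ?thesis .
  qed
  then have "\<forall>i<N. a i = 0" using f(2) by blast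
  with a(1) show False by auto
qed

lemma pol_compose:
  fixes K :: "'v set" and L :: "'n::finite \<Rightarrow> ('v \<Rightarrow> real) \<Rightarrow> real"
  assumes K: "finite K" and f: "pol UNIV D f" and L: "\<And>i. pol K d (L i)"
  shows "pol K (d * D) (\<lambda>x. f (\<lambda>i. L i x))"
proof -
  obtain a where a: "f = (\<lambda>x. \<Sum>\<alpha>\<in>expo UNIV D. a \<alpha> * mon \<alpha> x)" using f by (auto simp: pol_def)
  have "pol K (d * D) (\<lambda>x. mon \<alpha> (\<lambda>i. L i x))" if "\<alpha> \<in> expo UNIV D" for \<alpha>
  proof -
    have p: "pol K (\<Sum>i\<in>UNIV. d * \<alpha> i) (\<lambda>x. \<Prod>i\<in>UNIV. L i x ^ \<alpha> i)"
      by (intro pol_prod pol_power K L)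
    have "(\<Sum>i\<in>UNIV. d * \<alpha> i) \<le> d * D" using that by (simp add: expo_def flip: sum_distrib_left)
    from pol_mono[OF p K subset_refl this] show ?thesis by (simp add: mon_eq[of UNIV])
  qed
  then show ?thesis unfolding a by (intro pol_sum pol_cmult K)
qed

lemma dependent_on_mono: "dependent_on c I Z \<Longrightarrow> finite I \<Longrightarrow> c \<le> c' \<Longrightarrow> dependent_on c' I Z"
  unfolding dependent_on_def using pol_mono[of I c _ I c'] by blast

text \<open>Two estimates of a Hilbert function collide: if any \<open>r + 1\<close> coordinates in
  \<open>K\<close> were dependent on \<open>Z\<close>, the functions of degree \<open>D\<close> on
  \<open>Z\<close> would be spanned by \<open>O(D ^ r)\<close> monomials, while a chain of length
  \<open>r + 1\<close> yields growth of order \<open>r + 1\<close>. The maps \<open>L\<close>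
  rewrite all coordinates through those in \<open>K\<close>, so relations inside \<open>K\<close>
  suffice.\<close>

lemma chain_imp_independent:
  fixes Z :: "(real ^ 'n::finite) set"
  assumes chain: "has_irreducible_chain Z (Suc r)"
    and L: "\<And>i. pol K 1 (L i)" "\<And>x i. x \<in> Z \<Longrightarrow> x $ i = L i (($) x)"
  shows "\<exists>J\<subseteq>K. card J = Suc r \<and> (\<forall>c. \<not> dependent_on c J (($) ` Z))"
proof (rule ccontr)
  assume neg: "\<not> ?thesis"
  have fin: "finite I" for I :: "'n set" by simp
  have "\<forall>J. \<exists>c. J \<subseteq> K \<longrightarrow> card J = Suc r \<longrightarrow> dependent_on c J (($) ` Z)" using neg by blast
  then obtain C where "\<forall>J. J \<subseteq> K \<longrightarrow> card J = Suc r \<longrightarrow> dependent_on (C J) J (($) ` Z)"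
    by (rule choice[THEN exE])
  then have C: "\<And>J. J \<subseteq> K \<Longrightarrow> card J = Suc r \<Longrightarrow> dependent_on (C J) J (($) ` Z)" by blast
  have "C J \<le> sum C UNIV" for J by (rule member_le_sum) auto
  then have dep: "\<forall>J\<subseteq>K. card J = Suc r \<longrightarrow> dependent_on (sum C UNIV) J (($) ` Z)"
    using dependent_on_mono[OF C fin] by blast
  obtain A where "\<forall>(Z :: ('n \<Rightarrow> real) set) K D.
      (\<forall>I\<subseteq>K. card I = Suc r \<longrightarrow> dependent_on (sum C UNIV) I Z) \<longrightarrow> spanned K D (A * (D + 1) ^ r) Z"
    using standard_monomials[where 'n = 'n] by blast
  with dep have A: "spanned K D (A * (D + 1) ^ r) (($) ` Z)" for D by blast
  obtain Y where Y: "\<forall>i\<le>Suc r. irreducible_variety (Y i)" "\<forall>i<Suc r. Y i \<subset> Y (Suc i)" "Y (Suc r) \<subseteq> Z"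
    using chain by (auto simp: has_irreducible_chain_def)
  obtain a where a: "\<And>s. indep_family (Y (Suc r)) (a * s) (s ^ Suc r)"
    using chain_growth[OF Y(1,2)] by blast
  \<comment> \<open>Chosen so that \<open>A * (a * s + 1) ^ r \<le> A * (a + 1) ^ r * s ^ r < s ^
    Suc r\<close>.\<close>
  define s where "s = A * (a + 1) ^ r + 1"
  obtain B where B: "finite B" "card B \<le> A * (a * s + 1) ^ r"
    "\<And>\<alpha>. \<alpha> \<in> expo K (a * s) \<Longrightarrow> \<exists>b. \<forall>x\<in>($) ` Z. mon \<alpha> x = (\<Sum>\<beta>\<in>B. b \<beta> * mon \<beta> x)"
    using A[of "a * s"] unfolding spanned_def by blast
  have "s ^ Suc r \<le> card B"
  proof (rule indep_family_le_span[OF a B(1), where h = "\<lambda>\<beta> x. mon \<beta> (($) x)"])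
    fix f :: "('n \<Rightarrow> real) \<Rightarrow> real" assume f: "pol UNIV (a * s) f"
    have "pol K (1 * (a * s)) (\<lambda>x. f (\<lambda>i. L i x))" by (rule pol_compose[OF fin f L(1)])
    then obtain u where u: "(\<lambda>x. f (\<lambda>i. L i x)) = (\<lambda>x. \<Sum>\<alpha>\<in>expo K (a * s). u \<alpha> * mon \<alpha> x)"
      by (auto simp: pol_def)
    define rep where "rep \<alpha> b \<longleftrightarrow> (\<forall>x\<in>($) ` Z. mon \<alpha> x = (\<Sum>\<beta>\<in>B. b \<beta> * mon \<beta> x))" for \<alpha> b
    have "\<forall>\<alpha>\<in>expo K (a * s). \<exists>b. rep \<alpha> b" using B(3) unfolding rep_def by blast
    then obtain b where b: "\<forall>\<alpha>\<in>expo K (a * s). rep \<alpha> (b \<alpha>)" by metis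
    have "f (($) x) = (\<Sum>\<beta>\<in>B. (\<Sum>\<alpha>\<in>expo K (a * s). u \<alpha> * b \<alpha> \<beta>) * mon \<beta> (($) x))" if "x \<in> Y (Suc r)" for x
    proof -
      have x: "x \<in> Z" using that Y(3) by blast
      have "(\<lambda>i. L i (($) x)) = ($) x" using L(2)[OF x] by auto
      then have "f (($) x) = (\<Sum>\<alpha>\<in>expo K (a * s). u \<alpha> * mon \<alpha> (($) x))" using fun_cong[OF u, of "($) x"] by simp
      also have "\<dots> = (\<Sum>\<alpha>\<in>expo K (a * s). \<Sum>\<beta>\<in>B. u \<alpha> * b \<alpha> \<beta> * mon \<beta> (($) x))"
      proof (rule sum.cong[OF refl])
        fix \<alpha> assume "\<alpha> \<in> expo K (a * s)"
        then have "mon \<alpha> (($) x) = (\<Sum>\<beta>\<in>B. b \<alpha> \<beta> * mon \<beta> (($) x))" using b x unfolding rep_def by blast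
        then show "u \<alpha> * mon \<alpha> (($) x) = (\<Sum>\<beta>\<in>B. u \<alpha> * b \<alpha> \<beta> * mon \<beta> (($) x))"
          by (simp add: sum_distrib_left mult.assoc)
      qed
      also have "\<dots> = (\<Sum>\<beta>\<in>B. \<Sum>\<alpha>\<in>expo K (a * s). u \<alpha> * b \<alpha> \<beta> * mon \<beta> (($) x))" by (rule sum.swap)
      finally show ?thesis by (simp add: sum_distrib_right)
    qed
    then show "\<exists>b. \<forall>x\<in>Y (Suc r). f (($) x) = (\<Sum>\<beta>\<in>B. b \<beta> * mon \<beta> (($) x))"
      by (intro exI[of _ "\<lambda>\<beta>. \<Sum>\<alpha>\<in>expo K (a * s). u \<alpha> * b \<alpha> \<beta>"]) blast
  qed
  also have "\<dots> \<le> A * (a * s + 1) ^ r" by (rule B(2))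
  also have "\<dots> \<le> A * ((a + 1) * s) ^ r" by (intro mult_left_mono power_mono) (auto simp: s_def)
  also have "\<dots> = (A * (a + 1) ^ r) * s ^ r" by (simp only: power_mult_distrib mult.assoc)
  also have "\<dots> < s * s ^ r" by (rule mult_strict_right_mono) (auto simp: s_def)
  finally show False by simp
qed

lemma variety_dim_chain:
  assumes "variety_dim X = ereal (real k)" shows "has_irreducible_chain X k"
proof -
  \<comment> \<open>Lengths are integers, so a chain longer than \<open>k - 1 / 2\<close> has length
    at least \<open>k\<close> and can be truncated.\<close>
  have "ereal (real k - 1 / 2) < variety_dim X" using assms by simp
  then obtain r where r: "has_irreducible_chain X r" "real k - 1 / 2 < real r"
    unfolding variety_dim_def less_SUP_iff by auto
  then have "k \<le> r" by linarith
  obtain Z where Z: "\<forall>i\<le>r. irreducible_variety (Z i)" "\<forall>i<r. Z i \<subset> Z (Suc i)" "Z r \<subseteq> X"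
    using r(1) by (auto simp: has_irreducible_chain_def)
  have "Z k \<subseteq> Z r"
    using \<open>k \<le> r\<close> Z(2)
  proof (induction r rule: dec_induct)
    case (step n)
    then show ?case by (metis less_Suc_eq order_trans psubset_imp_subset)
  qed simp
  then show ?thesis unfolding has_irreducible_chain_def
    using Z \<open>k \<le> r\<close> by (intro exI[of _ Z]) auto
qed

section \<open>Kronecker substitution\<close>

lemma digits_inject:
  fixes \<alpha> \<beta> :: "nat \<Rightarrow> nat"
  assumes "(\<Sum>i<N. \<alpha> i * E ^ i) = (\<Sum>i<N. \<beta> i * E ^ i)" "\<And>i. \<alpha> i < E" "\<And>i. \<beta> i < E"
  shows "\<forall>i<N. \<alpha> i = \<beta> i"
  using assms
proof (induction N arbitrary: \<alpha> \<beta>)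
  case (Suc N)
  have s: "(\<Sum>i<Suc N. \<gamma> i * E ^ i) = \<gamma> 0 + E * (\<Sum>i<N. \<gamma> (Suc i) * E ^ i)" for \<gamma> :: "nat \<Rightarrow> nat"
    by (simp only: sum.lessThan_Suc_shift sum_distrib_left) (simp add: mult_ac)
  have eq: "\<alpha> 0 + E * (\<Sum>i<N. \<alpha> (Suc i) * E ^ i) = \<beta> 0 + E * (\<Sum>i<N. \<beta> (Suc i) * E ^ i)"
    using Suc.prems(1) unfolding s .
  have 0: "\<alpha> 0 = \<beta> 0" using arg_cong[OF eq, of "\<lambda>n. n mod E"] Suc.prems(2,3) by simp
  moreover have "E > 0" using Suc.prems(2)[of 0] by simp
  ultimately have "(\<Sum>i<N. \<alpha> (Suc i) * E ^ i) = (\<Sum>i<N. \<beta> (Suc i) * E ^ i)" using eq by simp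
  then have "\<forall>i<N. \<alpha> (Suc i) = \<beta> (Suc i)" using Suc.IH[of "\<lambda>i. \<alpha> (Suc i)" "\<lambda>i. \<beta> (Suc i)"] Suc.prems by simp
  then show ?case using 0 by (auto simp: less_Suc_eq_0_disj)
qed simp

text \<open>With all exponents below \<open>E\<close>, the exponent of \<open>t\<close> that a
  monomial receives has the entries of \<open>\<alpha>\<close> as its base \<open>E\<close> digits.
  Distinct monomials therefore stay distinct, the polynomial in \<open>t\<close> is nonzero, and its
  degree bound does not depend on the coefficients.\<close>

lemma kronecker_roots:
  fixes idx :: "'v \<Rightarrow> nat"
  assumes V: "finite V" and idx: "inj_on idx V"
    and A: "finite A" "\<And>\<alpha>. \<alpha> \<in> A \<Longrightarrow> {v. \<alpha> v \<noteq> 0} \<subseteq> V" "\<And>\<alpha> v. \<alpha> \<in> A \<Longrightarrow> \<alpha> v < E"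
    and nz: "\<alpha> \<in> A" "a \<alpha> \<noteq> 0"
  shows "finite {t. (\<Sum>\<alpha>\<in>A. a \<alpha> * mon \<alpha> (\<lambda>v. t ^ E ^ idx v)) = 0}"
    "card {t. (\<Sum>\<alpha>\<in>A. a \<alpha> * mon \<alpha> (\<lambda>v. t ^ E ^ idx v)) = 0} \<le> (\<Sum>v\<in>V. E * E ^ idx v)"
proof -
  define e where "e \<alpha> = (\<Sum>v\<in>V. \<alpha> v * E ^ idx v)" for \<alpha>
  define N where "N = Suc (Max (insert 0 (idx ` V)))"
  have N: "idx v < N" if "v \<in> V" for v using V that by (simp add: N_def less_Suc_eq_le)
  have e_digits: "e \<alpha> = (\<Sum>i<N. (if i \<in> idx ` V then \<alpha> (inv_into V idx i) else 0) * E ^ i)" for \<alpha>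
  proof -
    have "(\<Sum>i<N. (if i \<in> idx ` V then \<alpha> (inv_into V idx i) else 0) * E ^ i)
        = (\<Sum>i\<in>idx ` V. \<alpha> (inv_into V idx i) * E ^ i)"
      by (rule sum.mono_neutral_cong_right) (use N in auto)
    also have "\<dots> = e \<alpha>" unfolding e_def by (subst sum.reindex[OF idx]) (simp add: idx)
    finally show ?thesis by simp
  qed
  have inj: "inj_on e A"
  proof (rule inj_onI)
    fix \<alpha> \<beta> assume ab: "\<alpha> \<in> A" "\<beta> \<in> A" "e \<alpha> = e \<beta>"
    have E: "0 < E" using A(3)[OF ab(1)] by (metis gr_zeroI less_nat_zero_code)
    have "\<forall>i<N. (if i \<in> idx ` V then \<alpha> (inv_into V idx i) else 0) = (if i \<in> idx ` V then \<beta> (inv_into V idx i) else 0)"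
      using digits_inject[of "\<lambda>i. if i \<in> idx ` V then \<alpha> (inv_into V idx i) else 0" E N
          "\<lambda>i. if i \<in> idx ` V then \<beta> (inv_into V idx i) else 0"] ab A(3) E
      by (simp flip: e_digits)
    then have "\<alpha> v = \<beta> v" if "v \<in> V" for v
      using N[OF that] that idx by (auto dest!: spec[of _ "idx v"])
    moreover have "\<alpha> v = \<beta> v" if "v \<notin> V" for v using A(2) ab that by (metis (mono_tags, lifting) mem_Collect_eq subsetD)
    ultimately show "\<alpha> = \<beta>" by blast
  qed
  define p where "p = (\<Sum>\<alpha>\<in>A. Polynomial.monom (a \<alpha>) (e \<alpha>))"
  have "coeff p (e \<alpha>) = (\<Sum>\<beta>\<in>A. if \<beta> = \<alpha> then a \<beta> else 0)"
    unfolding p_def coeff_sum coeff_monom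
    by (rule sum.cong) (use inj nz in \<open>auto simp: inj_on_def\<close>)
  then have p0: "p \<noteq> 0" using nz A(1) by auto
  have "mon \<alpha> (\<lambda>v. t ^ E ^ idx v) = t ^ e \<alpha>" if "\<alpha> \<in> A" for \<alpha> and t :: real
    using mon_eq[OF V A(2)[OF that]] by (simp add: e_def power_sum mult.commute flip: power_mult)
  then have eq: "(\<Sum>\<alpha>\<in>A. a \<alpha> * mon \<alpha> (\<lambda>v. t ^ E ^ idx v)) = poly p t" for t
    unfolding p_def poly_sum poly_monom by (intro sum.cong) auto
  show "finite {t. (\<Sum>\<alpha>\<in>A. a \<alpha> * mon \<alpha> (\<lambda>v. t ^ E ^ idx v)) = 0}"
    unfolding eq by (rule poly_roots_finite[OF p0])
  have "e \<alpha> \<le> (\<Sum>v\<in>V. E * E ^ idx v)" if "\<alpha> \<in> A" for \<alpha>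
    unfolding e_def by (intro sum_mono mult_right_mono) (use A(3)[OF that] in \<open>auto intro: less_imp_le\<close>)
  then have "degree p \<le> (\<Sum>v\<in>V. E * E ^ idx v)"
    unfolding p_def by (intro degree_sum_le A order_trans[OF degree_monom_le])
  then show "card {t. (\<Sum>\<alpha>\<in>A. a \<alpha> * mon \<alpha> (\<lambda>v. t ^ E ^ idx v)) = 0} \<le> (\<Sum>v\<in>V. E * E ^ idx v)"
    unfolding eq using card_poly_roots_bound[OF p0] by simp
qed

section \<open>Flats in bad position\<close>

text \<open>Bounding each exponent instead of the total degree makes the count an exact power, which
  keeps the later comparison of dimensions simple.\<close>

definition box_exps :: "'v set \<Rightarrow> nat \<Rightarrow> ('v \<Rightarrow> nat) set" where
  "box_exps V \<Delta> = {\<alpha>. \<forall>v. (v \<in> V \<longrightarrow> \<alpha> v \<le> \<Delta>) \<and> (v \<notin> V \<longrightarrow> \<alpha> v = 0)}"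

lemma box_exps_finite_card:
  assumes V: "finite V"
  shows "finite (box_exps V \<Delta>)" "card (box_exps V \<Delta>) = (\<Delta> + 1) ^ card V"
proof -
  have b: "bij_betw (\<lambda>f v. if v \<in> V then f v else 0) (PiE V (\<lambda>_. {..\<Delta>})) (box_exps V \<Delta>)"
  proof (rule bij_betwI[where g = "\<lambda>f. restrict f V"])
    show "(\<lambda>f v. if v \<in> V then f v else 0) \<in> PiE V (\<lambda>_. {..\<Delta>}) \<rightarrow> box_exps V \<Delta>"
      by (auto simp: box_exps_def PiE_iff)
    show "(\<lambda>f. restrict f V) \<in> box_exps V \<Delta> \<rightarrow> PiE V (\<lambda>_. {..\<Delta>})" by (auto simp: box_exps_def)
    show "restrict (\<lambda>v. if v \<in> V then f v else 0) V = f" if "f \<in> PiE V (\<lambda>_. {..\<Delta>})" for f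
      using that by (auto simp: PiE_iff extensional_def restrict_def)
    show "(\<lambda>v. if v \<in> V then restrict f V v else 0) = f" if "f \<in> box_exps V \<Delta>" for f
      using that by (auto simp: box_exps_def)
  qed
  have fin: "finite (PiE V (\<lambda>_. {..\<Delta>}))" using V by (intro finite_PiE) auto
  show "finite (box_exps V \<Delta>)" using bij_betw_finite[OF b] fin by simp
  show "card (box_exps V \<Delta>) = (\<Delta> + 1) ^ card V"
    using bij_betw_same_card[OF b] V by (simp add: card_PiE)
qed

lemma box_exps_supp: "\<alpha> \<in> box_exps V \<Delta> \<Longrightarrow> {v. \<alpha> v \<noteq> 0} \<subseteq> V"
  by (rule subsetI, rule ccontr) (simp add: box_exps_def)

lemma box_exps_le: "\<alpha> \<in> box_exps V \<Delta> \<Longrightarrow> \<alpha> v \<le> \<Delta>"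
  by (cases "v \<in> V") (simp_all add: box_exps_def)

lemma box_exps_expo: "\<alpha> \<in> box_exps V \<Delta> \<Longrightarrow> \<alpha> \<in> expo V (card V * \<Delta>)"
  using sum_bounded_above[of V \<alpha> \<Delta>] box_exps_supp[of \<alpha> V \<Delta>] box_exps_le[of \<alpha> V \<Delta>]
  by (simp add: expo_def)

text \<open>Otherwise Kronecker substitution would give a nonzero polynomial with every real number
  as a root.\<close>

lemma mon_coeffs_zero:
  assumes V: "finite V" and A: "finite A" "\<And>\<alpha>. \<alpha> \<in> A \<Longrightarrow> {v. \<alpha> v \<noteq> 0} \<subseteq> V"
    and zero: "\<And>x. (\<Sum>\<alpha>\<in>A. c \<alpha> * mon \<alpha> x) = 0" and "\<alpha> \<in> A"
  shows "c \<alpha> = 0"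
proof (rule ccontr)
  assume nz: "c \<alpha> \<noteq> 0"
  obtain idx :: "'a \<Rightarrow> nat" where idx: "inj_on idx V" using finite_imp_inj_to_nat_seg[OF V] by blast
  define E where "E = Suc (\<Sum>\<alpha>\<in>A. \<Sum>v\<in>V. \<alpha> v)"
  have "\<beta> v < E" if "\<beta> \<in> A" for \<beta> v
  proof (cases "v \<in> V")
    case True
    have "\<beta> v \<le> (\<Sum>v\<in>V. \<beta> v)" using V True by (simp add: member_le_sum)
    also have "\<dots> \<le> (\<Sum>\<alpha>\<in>A. \<Sum>v\<in>V. \<alpha> v)" using member_le_sum[of \<beta> A "\<lambda>\<alpha>. sum \<alpha> V"] A(1) that by simp
    finally show ?thesis by (simp add: E_def)
  next
    case False
    then have "\<beta> v = 0" using A(2)[OF that] by blast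
    then show ?thesis by (simp add: E_def)
  qed
  then have "finite {t :: real. (\<Sum>\<alpha>\<in>A. c \<alpha> * mon \<alpha> (\<lambda>v. t ^ E ^ idx v)) = 0}"
    by (intro kronecker_roots(1)[where a = c and \<alpha> = \<alpha>, OF V idx A(1,2) _ assms(5) nz])
  then have "finite (UNIV :: real set)" using zero by simp
  then show False using infinite_UNIV_char_0 by blast
qed

text \<open>The graph of an affine map over the coordinates \<open>X \<union> Y\<close>. The slopes
  \<open>a\<close> along \<open>X\<close> stay fixed and occur only in the row \<open>z1\<close>;
  the parameters are the columns over \<open>Y\<close> and one offset. With \<open>z1\<close>
  outside \<open>Y\<close>, the index \<open>(z1, z1)\<close> is no column entry and is free to hold
  the offset.\<close>

definition tflat :: "'n set \<Rightarrow> 'n set \<Rightarrow> 'n \<Rightarrow> ('n \<Rightarrow> real) \<Rightarrow> ('n \<times> 'n \<Rightarrow> real) \<Rightarrow> (real ^ 'n::finite) set" where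
  "tflat X Y z1 a \<theta> = {x. \<forall>z. z \<notin> X \<union> Y \<longrightarrow>
     x $ z = (if z = z1 then \<theta> (z1, z1) + (\<Sum>i\<in>X. a i * x $ i) else 0) + (\<Sum>y\<in>Y. \<theta> (z, y) * x $ y)}"

definition tvars :: "'n set \<Rightarrow> 'n set \<Rightarrow> 'n \<Rightarrow> ('n \<times> 'n) set" where
  "tvars X Y z1 = insert (z1, z1) ((- (X \<union> Y)) \<times> Y)"

lemma mon_case_sum:
  assumes "finite T" "finite U" "{v. \<gamma> v \<noteq> 0} \<subseteq> Inl ` T \<union> Inr ` U"
  shows "mon \<gamma> (case_sum \<theta> x) = mon (\<gamma> \<circ> Inl) \<theta> * mon (\<gamma> \<circ> Inr) x"
proof -
  have "mon \<gamma> (case_sum \<theta> x) = (\<Prod>v\<in>Inl ` T \<union> Inr ` U. case_sum \<theta> x v ^ \<gamma> v)"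
    by (rule mon_eq) (use assms in auto)
  also have "\<dots> = (\<Prod>v\<in>Inl ` T. case_sum \<theta> x v ^ \<gamma> v) * (\<Prod>v\<in>Inr ` U. case_sum \<theta> x v ^ \<gamma> v)"
    by (rule prod.union_disjoint) (use assms in auto)
  also have "(\<Prod>v\<in>Inl ` T. case_sum \<theta> x v ^ \<gamma> v) = (\<Prod>t\<in>T. \<theta> t ^ (\<gamma> \<circ> Inl) t)"
    by (subst prod.reindex) auto
  also have "(\<Prod>v\<in>Inr ` U. case_sum \<theta> x v ^ \<gamma> v) = (\<Prod>i\<in>U. x i ^ (\<gamma> \<circ> Inr) i)"
    by (subst prod.reindex) auto
  also have "(\<Prod>t\<in>T. \<theta> t ^ (\<gamma> \<circ> Inl) t) = mon (\<gamma> \<circ> Inl) \<theta>"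
    by (rule mon_eq[symmetric]) (use assms in auto)
  also have "(\<Prod>i\<in>U. x i ^ (\<gamma> \<circ> Inr) i) = mon (\<gamma> \<circ> Inr) x"
    by (rule mon_eq[symmetric]) (use assms in auto)
  finally show ?thesis .
qed

text \<open>On the flat, the column \<open>j\<close> of the parameters is determined by the point and the other
  parameters; multiplying by a power of the coordinate \<open>j\<close> clears the denominators.\<close>

lemma column_elimination:
  fixes X Y J :: "'n::finite set"
  assumes XY: "X \<inter> Y = {}" "z1 \<notin> X \<union> Y" and j: "j \<in> J" "j \<in> Y"
    and \<nu>: "\<nu> \<in> box_exps (tvars X Y z1) \<Delta>" and \<tau>: "\<tau> \<in> box_exps J \<Delta>"
  shows "\<exists>G. pol (Inl ` (tvars X Y z1 - (- (X \<union> Y)) \<times> {j}) \<union> Inr ` UNIV)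
      (\<Delta> * (card (tvars X Y z1 - (- (X \<union> Y)) \<times> {j}) + 2 * card (- (X \<union> Y)) + card J)) G \<and>
    (\<forall>\<theta> x. x \<in> tflat X Y z1 a \<theta> \<longrightarrow>
       (x $ j) ^ (\<Delta> * card (- (X \<union> Y))) * (mon \<nu> \<theta> * mon \<tau> (($) x)) = G (case_sum \<theta> (($) x)))"
proof -
  define Zc where "Zc = - (X \<union> Y)"
  define T where "T = tvars X Y z1"
  define T' where "T' = T - Zc \<times> {j}"
  define V where "V = Inl ` T' \<union> Inr ` (UNIV :: 'n set)"
  \<comment> \<open>On the flat, \<open>L z\<close> equals the coordinate \<open>j\<close> times
    \<open>\<theta> (z, j)\<close>, though no parameter of column \<open>j\<close> occurs in
    it.\<close>
  define L where "L z \<xi> = \<xi> (Inr z) - (if z = z1 then \<xi> (Inl (z1, z1)) + (\<Sum>i\<in>X. a i * \<xi> (Inr i)) else 0)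
      - (\<Sum>y\<in>Y - {j}. \<xi> (Inl (z, y)) * \<xi> (Inr y))" for z and \<xi> :: "('n \<times> 'n) + 'n \<Rightarrow> real"
  define G where "G \<xi> = (\<Prod>t\<in>T'. \<xi> (Inl t) ^ \<nu> t) *
      (\<Prod>z\<in>Zc. \<xi> (Inr j) ^ (\<Delta> - \<nu> (z, j)) * L z \<xi> ^ \<nu> (z, j)) * (\<Prod>i\<in>J. \<xi> (Inr i) ^ \<tau> i)"
    for \<xi> :: "('n \<times> 'n) + 'n \<Rightarrow> real"
  have fin: "finite V" by (simp add: V_def)
  have z1: "(z1, z1) \<in> T'" using XY j by (auto simp: T'_def T_def tvars_def)
  have Tin: "(z, y) \<in> T'" if "z \<in> Zc" "y \<in> Y - {j}" for z y
    using that by (auto simp: T'_def T_def tvars_def Zc_def)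
  have var: "pol V 1 (\<lambda>\<xi>. \<xi> v)" if "v \<in> V" for v using pol_var[OF fin that] .
  have var2: "pol V 2 (\<lambda>\<xi>. \<xi> v)" if "v \<in> V" for v
    by (rule pol_mono[OF var[OF that] fin]) auto
  have L: "pol V 2 (L z)" if "z \<in> Zc" for z
  proof -
    have "pol V (1 + 1) (\<lambda>\<xi>. \<xi> (Inl (z, y)) * \<xi> (Inr y))" if "y \<in> Y - {j}" for y
      by (intro pol_mult fin var) (use Tin[OF \<open>z \<in> Zc\<close> that] in \<open>auto simp: V_def\<close>)
    then have "pol V 2 (\<lambda>\<xi>. \<Sum>y\<in>Y - {j}. \<xi> (Inl (z, y)) * \<xi> (Inr y))"
      by (intro pol_sum fin) (simp add: numeral_2_eq_2)
    moreover have "pol V 2 (\<lambda>\<xi>. if z = z1 then \<xi> (Inl (z1, z1)) + (\<Sum>i\<in>X. a i * \<xi> (Inr i)) else 0)"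
    proof (cases "z = z1")
      case True
      have "pol V 2 (\<lambda>\<xi>. \<xi> (Inl (z1, z1)) + (\<Sum>i\<in>X. a i * \<xi> (Inr i)))"
        by (intro pol_add pol_sum pol_cmult fin var2) (use z1 in \<open>auto simp: V_def\<close>)
      then show ?thesis using True by simp
    qed (simp add: pol_const fin)
    ultimately show ?thesis unfolding L_def by (intro pol_diff fin var2) (auto simp: V_def)
  qed
  note \<nu>le = box_exps_le[OF \<nu>] and \<tau>le = box_exps_le[OF \<tau>]
  have pG: "pol V (sum \<nu> T' + (\<Sum>z\<in>Zc. (\<Delta> - \<nu> (z, j)) + 2 * \<nu> (z, j)) + sum \<tau> J) G"
    unfolding G_def
  proof (intro pol_mult pol_prod fin)
    show "pol V (\<nu> t) (\<lambda>\<xi>. \<xi> (Inl t) ^ \<nu> t)" if "t \<in> T'" for t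
      using pol_power[OF fin var[of "Inl t"], of "\<nu> t"] that by (auto simp: V_def)
    show "pol V (\<Delta> - \<nu> (z, j)) (\<lambda>\<xi>. \<xi> (Inr j) ^ (\<Delta> - \<nu> (z, j)))" for z
      using pol_power[OF fin var[of "Inr j"], of "\<Delta> - \<nu> (z, j)"] by (auto simp: V_def)
    show "pol V (2 * \<nu> (z, j)) (\<lambda>\<xi>. L z \<xi> ^ \<nu> (z, j))" if "z \<in> Zc" for z
      by (rule pol_power[OF fin L[OF that]])
    show "pol V (\<tau> i) (\<lambda>\<xi>. \<xi> (Inr i) ^ \<tau> i)" for i
      using pol_power[OF fin var[of "Inr i"], of "\<tau> i"] by (auto simp: V_def)
  qed
  have leG: "sum \<nu> T' + (\<Sum>z\<in>Zc. (\<Delta> - \<nu> (z, j)) + 2 * \<nu> (z, j)) + sum \<tau> J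
      \<le> \<Delta> * (card T' + 2 * card Zc + card J)"
  proof -
    have "sum \<nu> T' \<le> of_nat (card T') * \<Delta>" by (rule sum_bounded_above) (rule \<nu>le)
    moreover have "(\<Sum>z\<in>Zc. (\<Delta> - \<nu> (z, j)) + 2 * \<nu> (z, j)) \<le> of_nat (card Zc) * (2 * \<Delta>)"
    proof (rule sum_bounded_above)
      show "\<Delta> - \<nu> (z, j) + 2 * \<nu> (z, j) \<le> 2 * \<Delta>" for z using \<nu>le[of "(z, j)"] by linarith
    qed
    moreover have "sum \<tau> J \<le> of_nat (card J) * \<Delta>" by (rule sum_bounded_above) (rule \<tau>le)
    ultimately show ?thesis by (simp add: algebra_simps)
  qed
  have "pol V (\<Delta> * (card T' + 2 * card Zc + card J)) G" by (rule pol_mono[OF pG fin subset_refl leG])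
  moreover have "(x $ j) ^ (\<Delta> * card Zc) * (mon \<nu> \<theta> * mon \<tau> (($) x)) = G (case_sum \<theta> (($) x))"
    if x: "x \<in> tflat X Y z1 a \<theta>" for \<theta> x
  proof -
    let ?\<xi> = "case_sum \<theta> (($) x)"
    have L: "L z ?\<xi> = x $ j * \<theta> (z, j)" if "z \<in> Zc" for z
    proof -
      have "x $ z = (if z = z1 then \<theta> (z1, z1) + (\<Sum>i\<in>X. a i * x $ i) else 0) + (\<Sum>y\<in>Y. \<theta> (z, y) * x $ y)"
        using x that by (simp add: tflat_def Zc_def)
      moreover have "(\<Sum>y\<in>Y. \<theta> (z, y) * x $ y) = \<theta> (z, j) * x $ j + (\<Sum>y\<in>Y - {j}. \<theta> (z, y) * x $ y)"
        by (rule sum.remove) (use j in auto)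
      ultimately show ?thesis by (simp add: L_def)
    qed
    have "mon \<nu> \<theta> = (\<Prod>t\<in>T. \<theta> t ^ \<nu> t)"
      by (rule mon_eq) (use box_exps_supp[OF \<nu>] in \<open>auto simp: T_def\<close>)
    also have "\<dots> = (\<Prod>t\<in>T'. \<theta> t ^ \<nu> t) * (\<Prod>t\<in>Zc \<times> {j}. \<theta> t ^ \<nu> t)"
    proof -
      have "T = T' \<union> Zc \<times> {j}" "T' \<inter> Zc \<times> {j} = {}"
        using j by (auto simp: T'_def T_def tvars_def Zc_def)
      then show ?thesis by (metis finite prod.union_disjoint)
    qed
    also have "(\<Prod>t\<in>Zc \<times> {j}. \<theta> t ^ \<nu> t) = (\<Prod>z\<in>Zc. \<theta> (z, j) ^ \<nu> (z, j))"
    proof -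
      have "Zc \<times> {j} = (\<lambda>z. (z, j)) ` Zc" by auto
      then show ?thesis by (simp add: prod.reindex inj_on_def)
    qed
    finally have m: "mon \<nu> \<theta> = (\<Prod>t\<in>T'. \<theta> t ^ \<nu> t) * (\<Prod>z\<in>Zc. \<theta> (z, j) ^ \<nu> (z, j))" .
    have "(x $ j) ^ (\<Delta> * card Zc) = (\<Prod>z\<in>Zc. (x $ j) ^ \<Delta>)" by (simp add: power_mult)
    also have "\<dots> * (\<Prod>z\<in>Zc. \<theta> (z, j) ^ \<nu> (z, j)) = (\<Prod>z\<in>Zc. (x $ j) ^ (\<Delta> - \<nu> (z, j)) * L z ?\<xi> ^ \<nu> (z, j))"
      unfolding prod.distrib[symmetric]
    proof (rule prod.cong[OF refl])
      fix z assume "z \<in> Zc"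
      have "(x $ j) ^ \<Delta> = (x $ j) ^ (\<Delta> - \<nu> (z, j)) * (x $ j) ^ \<nu> (z, j)"
        using \<nu>le[of "(z, j)"] by (simp flip: power_add)
      then show "(x $ j) ^ \<Delta> * \<theta> (z, j) ^ \<nu> (z, j) = (x $ j) ^ (\<Delta> - \<nu> (z, j)) * L z ?\<xi> ^ \<nu> (z, j)"
        by (simp add: L[OF \<open>z \<in> Zc\<close>] power_mult_distrib)
    qed
    finally have p: "(x $ j) ^ (\<Delta> * card Zc) * (\<Prod>z\<in>Zc. \<theta> (z, j) ^ \<nu> (z, j)) =
        (\<Prod>z\<in>Zc. (x $ j) ^ (\<Delta> - \<nu> (z, j)) * L z ?\<xi> ^ \<nu> (z, j))" .
    have t: "mon \<tau> (($) x) = (\<Prod>i\<in>J. (x $ i) ^ \<tau> i)"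
      by (rule mon_eq) (use box_exps_supp[OF \<tau>] in auto)
    have "G ?\<xi> = (\<Prod>t\<in>T'. \<theta> t ^ \<nu> t) * (\<Prod>z\<in>Zc. (x $ j) ^ (\<Delta> - \<nu> (z, j)) * L z ?\<xi> ^ \<nu> (z, j)) * (\<Prod>i\<in>J. (x $ i) ^ \<tau> i)"
      by (simp add: G_def)
    then show ?thesis unfolding m t p[symmetric] by (simp only: mult_ac)
  qed
  ultimately show ?thesis unfolding V_def T'_def T_def Zc_def by blast
qed

text \<open>A dimension count on the pairs of a parameter and a point of \<open>W\<close> on its
  flat: they have only \<open>q = card T' + \<delta>\<close> degrees of freedom, where
  \<open>T'\<close> omits column \<open>j\<close>, but the parameters and the coordinates in
  \<open>J\<close> are \<open>card T + card J > q\<close> variables. So a nontrivial relation holds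
  on these pairs. Read as a polynomial in the coordinates of \<open>J\<close>, it has coefficients
  that are polynomials in \<open>\<theta>\<close>; they all vanish at \<open>\<theta>\<close> if the
  coordinates in \<open>J\<close> are independent on the intersection.\<close>

lemma bad_parameters_hypersurface:
  fixes X Y J :: "'n::finite set" and W :: "(real ^ 'n) set"
  assumes XY: "X \<inter> Y = {}" "z1 \<notin> X \<union> Y" and J: "j \<in> J" "j \<in> Y"
    and W: "\<And>D. spanned UNIV D (A * (D + 1) ^ \<delta>) (($) ` W)"
    and dim: "\<delta> < card J + card (- (X \<union> Y))"
    and q: "q = card (tvars X Y z1 - (- (X \<union> Y)) \<times> {j}) + \<delta>"
    and \<Lambda>: "\<Lambda> = card (tvars X Y z1 - (- (X \<union> Y)) \<times> {j}) + 2 * card (- (X \<union> Y)) + card J"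
    and \<Delta>: "A * (\<Lambda> + 1) ^ q \<le> \<Delta>"
  shows "\<exists>C. (\<exists>\<nu>\<in>box_exps (tvars X Y z1) \<Delta>. C \<nu> \<noteq> 0) \<and>
    (\<forall>\<theta>. (\<forall>c. \<not> dependent_on c J (($) ` (W \<inter> tflat X Y z1 a \<theta>))) \<longrightarrow>
      (\<Sum>\<nu>\<in>box_exps (tvars X Y z1) \<Delta>. C \<nu> * mon \<nu> \<theta>) = 0)"
proof -
  define Zc where "Zc = - (X \<union> Y)"
  define T where "T = tvars X Y z1"
  define T' where "T' = T - Zc \<times> {j}"
  define p where "p = \<Delta> * card Zc"
  define D where "D = \<Delta> * \<Lambda>"
  define M where "M = box_exps T \<Delta> \<times> box_exps J \<Delta>"
  have fin: "finite T" "finite T'" "finite J" by (auto simp: T_def T'_def)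
  have finM: "finite M" "card M = (\<Delta> + 1) ^ (card T + card J)"
    by (simp_all add: M_def box_exps_finite_card fin card_cartesian_product power_add)
  obtain B where B: "finite B" "card B \<le> A * (D + 1) ^ \<delta>"
    "\<And>\<alpha>. \<alpha> \<in> expo UNIV D \<Longrightarrow> \<exists>b. \<forall>x\<in>($) ` W. mon \<alpha> x = (\<Sum>\<beta>\<in>B. b \<beta> * mon \<beta> x)"
    using W[of D] unfolding spanned_def by blast
  define B' where "B' = box_exps T' D \<times> B"
  define h where "h \<kappa> \<theta> x = mon (fst \<kappa>) \<theta> * mon (snd \<kappa>) x"
    for \<kappa> :: "('n \<times> 'n \<Rightarrow> nat) \<times> ('n \<Rightarrow> nat)" and \<theta> x
  have finB': "finite B'" using B by (simp add: B'_def box_exps_finite_card fin)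
  define rep where "rep f u \<longleftrightarrow> (\<forall>\<theta>. \<forall>x\<in>W. x \<in> tflat X Y z1 a \<theta> \<longrightarrow> f \<theta> (($) x) = (\<Sum>\<kappa>\<in>B'. u \<kappa> * h \<kappa> \<theta> (($) x)))"
    for f :: "('n \<times> 'n \<Rightarrow> real) \<Rightarrow> ('n \<Rightarrow> real) \<Rightarrow> real" and u
  define F where "F \<mu> \<theta> x = x j ^ p * (mon (fst \<mu>) \<theta> * mon (snd \<mu>) x)"
    for \<mu> and \<theta> :: "'n \<times> 'n \<Rightarrow> real" and x :: "'n \<Rightarrow> real"
  have "\<exists>u. rep (F \<mu>) u" if \<mu>: "\<mu> \<in> M" for \<mu>
  proof -
    have "\<exists>G. pol (Inl ` T' \<union> Inr ` UNIV) D G \<and> (\<forall>\<theta> x. x \<in> tflat X Y z1 a \<theta> \<longrightarrow>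
        F \<mu> \<theta> (($) x) = G (case_sum \<theta> (($) x)))"
      using column_elimination[OF XY J, of "fst \<mu>" \<Delta> "snd \<mu>" a] \<mu>
      unfolding M_def F_def D_def p_def \<Lambda> T'_def T_def Zc_def by auto
    then obtain G where G: "pol (Inl ` T' \<union> Inr ` UNIV) D G"
      "\<And>\<theta> x. x \<in> tflat X Y z1 a \<theta> \<Longrightarrow> F \<mu> \<theta> (($) x) = G (case_sum \<theta> (($) x))" by blast
    let ?V = "Inl ` T' \<union> Inr ` (UNIV :: 'n set)"
    obtain g where g: "G = (\<lambda>x. \<Sum>\<gamma>\<in>expo ?V D. g \<gamma> * mon \<gamma> x)" using G(1) by (auto simp: pol_def)
    have finV: "finite ?V" by simp
    have le: "\<gamma> v \<le> D" if "\<gamma> \<in> expo ?V D" for \<gamma> v using expo_le[OF that finV] .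
    have lr: "\<gamma> \<circ> Inl \<in> box_exps T' D" "\<gamma> \<circ> Inr \<in> expo UNIV D" if "\<gamma> \<in> expo ?V D" for \<gamma>
    proof -
      have z: "\<gamma> v = 0" if "v \<notin> ?V" for v using \<open>\<gamma> \<in> expo ?V D\<close> that by (auto simp: expo_def)
      have "\<gamma> (Inl v) = 0" if "v \<notin> T'" for v using z[of "Inl v"] that by auto
      then show "\<gamma> \<circ> Inl \<in> box_exps T' D" unfolding box_exps_def using le[OF that] by simp
      have "sum (\<gamma> \<circ> Inr) UNIV = sum \<gamma> (range Inr)" by (simp add: sum.reindex)
      also have "\<dots> \<le> sum \<gamma> ?V" by (rule sum_mono2) auto
      finally show "\<gamma> \<circ> Inr \<in> expo UNIV D" using that by (simp add: expo_def)
    qed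
    define rb where "rb \<alpha> b \<longleftrightarrow> (\<forall>x\<in>($) ` W. mon \<alpha> x = (\<Sum>\<beta>\<in>B. b \<beta> * mon \<beta> x))" for \<alpha> b
    have "\<forall>\<gamma>\<in>expo ?V D. \<exists>b. rb (\<gamma> \<circ> Inr) b" using B(3) lr(2) unfolding rb_def by blast
    then obtain b where b: "\<And>\<gamma>. \<gamma> \<in> expo ?V D \<Longrightarrow> rb (\<gamma> \<circ> Inr) (b \<gamma>)" by metis
    define u where "u \<kappa> = (\<Sum>\<gamma>\<in>expo ?V D. if \<gamma> \<circ> Inl = fst \<kappa> then g \<gamma> * b \<gamma> (snd \<kappa>) else 0)" for \<kappa>
    have "rep (F \<mu>) u"
      unfolding rep_def
    proof (intro allI ballI impI)
      fix \<theta> x assume x: "x \<in> W" "x \<in> tflat X Y z1 a \<theta>"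
      have "F \<mu> \<theta> (($) x) = (\<Sum>\<gamma>\<in>expo ?V D. g \<gamma> * mon \<gamma> (case_sum \<theta> (($) x)))"
        using G(2)[OF x(2)] by (simp add: g)
      also have "\<dots> = (\<Sum>\<gamma>\<in>expo ?V D. \<Sum>\<kappa>\<in>B'. (if \<gamma> \<circ> Inl = fst \<kappa> then g \<gamma> * b \<gamma> (snd \<kappa>) else 0) * h \<kappa> \<theta> (($) x))"
      proof (rule sum.cong[OF refl])
        fix \<gamma> assume \<gamma>: "\<gamma> \<in> expo ?V D"
        have "mon \<gamma> (case_sum \<theta> (($) x)) = mon (\<gamma> \<circ> Inl) \<theta> * mon (\<gamma> \<circ> Inr) (($) x)"
          by (rule mon_case_sum[of T' UNIV]) (use \<gamma> in \<open>auto simp: expo_def\<close>)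
        also have "mon (\<gamma> \<circ> Inr) (($) x) = (\<Sum>\<beta>\<in>B. b \<gamma> \<beta> * mon \<beta> (($) x))"
          using b[OF \<gamma>] x(1) unfolding rb_def by blast
        finally have "g \<gamma> * mon \<gamma> (case_sum \<theta> (($) x)) = (\<Sum>\<beta>\<in>B. g \<gamma> * b \<gamma> \<beta> * h (\<gamma> \<circ> Inl, \<beta>) \<theta> (($) x))"
          by (simp only: h_def fst_conv snd_conv sum_distrib_left mult_ac)
        also have "\<dots> = (\<Sum>\<kappa>\<in>{\<gamma> \<circ> Inl} \<times> B. g \<gamma> * b \<gamma> (snd \<kappa>) * h \<kappa> \<theta> (($) x))"
          by (simp add: sum.cartesian_product' flip: sum.cartesian_product)
        also have "\<dots> = (\<Sum>\<kappa>\<in>B'. (if \<gamma> \<circ> Inl = fst \<kappa> then g \<gamma> * b \<gamma> (snd \<kappa>) else 0) * h \<kappa> \<theta> (($) x))"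
          by (rule sum.mono_neutral_cong_left) (use lr(1)[OF \<gamma>] finB' in \<open>auto simp: B'_def\<close>)
        finally show "g \<gamma> * mon \<gamma> (case_sum \<theta> (($) x)) =
          (\<Sum>\<kappa>\<in>B'. (if \<gamma> \<circ> Inl = fst \<kappa> then g \<gamma> * b \<gamma> (snd \<kappa>) else 0) * h \<kappa> \<theta> (($) x))" .
      qed
      also have "\<dots> = (\<Sum>\<kappa>\<in>B'. u \<kappa> * h \<kappa> \<theta> (($) x))"
        unfolding u_def sum_distrib_right by (rule sum.swap)
      finally show "F \<mu> \<theta> (($) x) = (\<Sum>\<kappa>\<in>B'. u \<kappa> * h \<kappa> \<theta> (($) x))" .
    qed
    then show ?thesis by blast
  qed
  then obtain u where u: "\<And>\<mu>. \<mu> \<in> M \<Longrightarrow> rep (F \<mu>) (u \<mu>)" by metis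
  \<comment> \<open>A constant times \<open>(\<Delta> + 1) ^ q\<close> against
    \<open>(\<Delta> + 1) ^ (q + 1)\<close>; the hypothesis on \<open>\<Delta>\<close> makes it
    exceed the constant.\<close>
  have "card B' < card M"
  proof -
    have Tc: "card T = card T' + card Zc"
    proof -
      have "T = T' \<union> Zc \<times> {j}" "T' \<inter> Zc \<times> {j} = {}"
        using J by (auto simp: T'_def T_def tvars_def Zc_def)
      then show ?thesis using card_Un_disjoint[of T' "Zc \<times> {j}"] by (simp add: card_cartesian_product)
    qed
    have qT: "q = card T' + \<delta>" by (simp add: q T'_def T_def Zc_def)
    have "card B' \<le> (D + 1) ^ card T' * (A * (D + 1) ^ \<delta>)"
      unfolding B'_def card_cartesian_product box_exps_finite_card(2)[OF fin(2)]
      by (rule mult_left_mono[OF B(2)]) simp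
    also have "\<dots> = A * (D + 1) ^ q" by (simp add: qT power_add)
    also have "\<dots> \<le> A * ((\<Lambda> + 1) * (\<Delta> + 1)) ^ q"
      by (intro mult_left_mono power_mono) (auto simp: D_def algebra_simps)
    also have "\<dots> = (A * (\<Lambda> + 1) ^ q) * (\<Delta> + 1) ^ q" by (simp only: power_mult_distrib mult.assoc)
    also have "\<dots> < (\<Delta> + 1) * (\<Delta> + 1) ^ q" by (rule mult_strict_right_mono) (use \<Delta> in auto)
    also have "\<dots> = (\<Delta> + 1) ^ Suc q" by simp
    also have "\<dots> \<le> (\<Delta> + 1) ^ (card T + card J)"
      by (rule power_increasing) (use dim in \<open>auto simp: qT Tc Zc_def\<close>)
    finally show ?thesis by (simp add: finM)
  qed
  then obtain s where s: "\<exists>\<mu>\<in>M. s \<mu> \<noteq> 0" "\<forall>\<kappa>\<in>B'. (\<Sum>\<mu>\<in>M. s \<mu> * u \<mu> \<kappa>) = 0"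
    using nontrivial_solution[OF finB' finM(1), of u] by blast
  have vanish: "(\<Sum>\<mu>\<in>M. s \<mu> * F \<mu> \<theta> (($) x)) = 0" if "x \<in> W" "x \<in> tflat X Y z1 a \<theta>" for \<theta> x
  proof -
    have "(\<Sum>\<mu>\<in>M. s \<mu> * F \<mu> \<theta> (($) x)) = (\<Sum>\<mu>\<in>M. \<Sum>\<kappa>\<in>B'. s \<mu> * u \<mu> \<kappa> * h \<kappa> \<theta> (($) x))"
      using u that by (intro sum.cong) (auto simp: rep_def sum_distrib_left mult.assoc)
    also have "\<dots> = (\<Sum>\<kappa>\<in>B'. \<Sum>\<mu>\<in>M. s \<mu> * u \<mu> \<kappa> * h \<kappa> \<theta> (($) x))" by (rule sum.swap)
    also have "\<dots> = (\<Sum>\<kappa>\<in>B'. (\<Sum>\<mu>\<in>M. s \<mu> * u \<mu> \<kappa>) * h \<kappa> \<theta> (($) x))" by (simp add: sum_distrib_right)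
    also have "\<dots> = 0" using s(2) by simp
    finally show ?thesis .
  qed
  \<comment> \<open>A nonzero coefficient of the relation; the hypersurface is given by the part of
    the relation at the monomial \<open>\<tau>0\<close> in the coordinates of
    \<open>J\<close>.\<close>
  obtain \<nu>0 \<tau>0 where 0: "\<nu>0 \<in> box_exps T \<Delta>" "\<tau>0 \<in> box_exps J \<Delta>" "s (\<nu>0, \<tau>0) \<noteq> 0"
    using s(1) by (auto simp: M_def)
  have "(\<Sum>\<nu>\<in>box_exps T \<Delta>. s (\<nu>, \<tau>0) * mon \<nu> \<theta>) = 0"
    if ind: "\<forall>c. \<not> dependent_on c J (($) ` (W \<inter> tflat X Y z1 a \<theta>))" for \<theta>
  proof -
    define C where "C \<tau> = (\<Sum>\<nu>\<in>box_exps T \<Delta>. s (\<nu>, \<tau>) * mon \<nu> \<theta>)" for \<tau>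
    define g1 where "g1 x = x j ^ p" for x :: "'n \<Rightarrow> real"
    define g2 where "g2 x = (\<Sum>\<tau>\<in>box_exps J \<Delta>. C \<tau> * mon \<tau> x)" for x :: "'n \<Rightarrow> real"
    have p1: "pol J p g1" unfolding g1_def using pol_power[OF fin(3) pol_var[OF fin(3) J(1)], of p] by simp
    have p2: "pol J (card J * \<Delta>) g2" unfolding g2_def
      by (intro pol_sum pol_mon fin box_exps_expo)
    have "g1 (($) x) * g2 (($) x) = 0" if x: "x \<in> W \<inter> tflat X Y z1 a \<theta>" for x
    proof -
      have "g1 (($) x) * g2 (($) x) = (\<Sum>\<tau>\<in>box_exps J \<Delta>. \<Sum>\<nu>\<in>box_exps T \<Delta>. s (\<nu>, \<tau>) * F (\<nu>, \<tau>) \<theta> (($) x))"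
        by (simp add: g1_def g2_def C_def F_def sum_distrib_left sum_distrib_right mult_ac)
      also have "\<dots> = (\<Sum>\<nu>\<in>box_exps T \<Delta>. \<Sum>\<tau>\<in>box_exps J \<Delta>. s (\<nu>, \<tau>) * F (\<nu>, \<tau>) \<theta> (($) x))"
        by (rule sum.swap)
      also have "\<dots> = (\<Sum>\<mu>\<in>M. s \<mu> * F \<mu> \<theta> (($) x))"
        by (simp add: M_def sum.cartesian_product case_prod_beta)
      finally show ?thesis using vanish x by simp
    qed
    then have "\<forall>x\<in>($) ` (W \<inter> tflat X Y z1 a \<theta>). g1 x * g2 x = 0" by blast
    moreover have "pol J (p + card J * \<Delta>) (\<lambda>x. g1 x * g2 x)" by (rule pol_mult[OF fin(3) p1 p2])
    ultimately have all0: "\<And>x. g1 x * g2 x = 0" using ind unfolding dependent_on_def by blast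
    \<comment> \<open>The factor \<open>g1\<close>, left over from clearing denominators, can be
      cancelled because polynomials have no zero divisors.\<close>
    have "g2 x = 0" for x
    proof (rule ccontr)
      assume "g2 x \<noteq> 0"
      moreover have "g1 (\<lambda>_. 1) \<noteq> 0" by (simp add: g1_def)
      ultimately show False using pol_mult_nonzero[OF fin(3) p1 _ p2] all0 by blast
    qed
    then have "C \<tau>0 = 0"
      using mon_coeffs_zero[OF fin(3) box_exps_finite_card(1)[OF fin(3)], of \<Delta> C \<tau>0] 0(2) box_exps_supp
      unfolding g2_def by blast
    then show ?thesis by (simp add: C_def)
  qed
  then show ?thesis using 0 unfolding T_def
    by (intro exI[of _ "\<lambda>\<nu>. s (\<nu>, \<tau>0)"] conjI bexI[of _ \<nu>0] allI impI) auto
qed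

text \<open>A bad parameter lies on the hypersurface of some
  \<open>J \<subseteq> X \<union> Y\<close> with \<open>k'\<close> elements, and there are at most
  \<open>2 ^ CARD('n)\<close> such \<open>J\<close>. As \<open>k' > card X\<close>, each
  \<open>J\<close> meets \<open>Y\<close>, which provides the column to eliminate. Along the curve
  of powers of \<open>b\<close>, each hypersurface has boundedly many points by Kronecker
  substitution.\<close>

lemma few_bad_parameters:
  fixes X Y :: "'n::finite set" and c \<delta> k' :: nat
  assumes XY: "X \<inter> Y = {}" "z1 \<notin> X \<union> Y" and k: "card X < k'" "\<delta> < k' + card (- (X \<union> Y))"
    and idx: "inj_on idx (tvars X Y z1)"
  shows "\<exists>\<Delta>0. \<forall>\<Delta>\<ge>\<Delta>0. \<forall>E>\<Delta>. \<forall>a (W :: (real ^ 'n) set).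
    defined_in_degree c W \<longrightarrow> variety_dim W = ereal (real \<delta>) \<longrightarrow>
    finite {b. variety_dim (W \<inter> tflat X Y z1 a (\<lambda>v. b ^ E ^ idx v)) = ereal (real k')} \<and>
    card {b. variety_dim (W \<inter> tflat X Y z1 a (\<lambda>v. b ^ E ^ idx v)) = ereal (real k')}
      \<le> 2 ^ CARD('n) * (\<Sum>v\<in>tvars X Y z1. E * E ^ idx v)"
proof -
  define T where "T = tvars X Y z1"
  define Zc where "Zc = - (X \<union> Y)"
  obtain c' where c': "\<And>(W :: (real ^ 'n) set) (I :: 'n set) \<delta>. defined_in_degree c W \<Longrightarrow>
    variety_dim W = ereal (real \<delta>) \<Longrightarrow> card I = Suc \<delta> \<Longrightarrow> dependent_on c' I (($) ` W)"
    using bounded_degree_dependence[where 'n = 'n, of c] by blast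
  obtain A where A: "\<And>(Z :: ('n \<Rightarrow> real) set) K D.
    \<forall>I\<subseteq>K. card I = Suc \<delta> \<longrightarrow> dependent_on c' I Z \<Longrightarrow> spanned K D (A * (D + 1) ^ \<delta>) Z"
    using standard_monomials[where 'n = 'n, of \<delta> c'] by blast
  define q where "q j = card (T - Zc \<times> {j}) + \<delta>" for j
  define \<Lambda> where "\<Lambda> J j = card (T - Zc \<times> {j}) + 2 * card Zc + card J" for J :: "'n set" and j
  \<comment> \<open>A sum over all \<open>J\<close> and \<open>j\<close>, so that one threshold
    serves every hypersurface at once; neither \<open>W\<close> nor \<open>a\<close> enters.\<close>
  define \<Delta>0 where "\<Delta>0 = (\<Sum>(J, j)\<in>UNIV. A * (\<Lambda> J j + 1) ^ q j)"
  define \<J> where "\<J> = {J. J \<subseteq> X \<union> Y \<and> card J = k'}"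
  show ?thesis
  proof (intro exI[of _ \<Delta>0] allI impI)
    fix \<Delta> E :: nat and a and W :: "(real ^ 'n) set"
    assume \<Delta>: "\<Delta>0 \<le> \<Delta>" and E: "\<Delta> < E"
      and W: "defined_in_degree c W" "variety_dim W = ereal (real \<delta>)"
    have sp: "spanned UNIV D (A * (D + 1) ^ \<delta>) (($) ` W)" for D
      by (rule A) (use c'[OF W] in blast)
    let ?F = "\<lambda>b. tflat X Y z1 a (\<lambda>v. b ^ E ^ idx v)"
    define hyp where "hyp J C \<longleftrightarrow> (\<exists>\<nu>\<in>box_exps T \<Delta>. C \<nu> \<noteq> 0) \<and>
      (\<forall>\<theta>. (\<forall>c. \<not> dependent_on c J (($) ` (W \<inter> tflat X Y z1 a \<theta>))) \<longrightarrow>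
        (\<Sum>\<nu>\<in>box_exps T \<Delta>. C \<nu> * mon \<nu> \<theta>) = 0)" for J C
    have "\<forall>J\<in>\<J>. \<exists>C. hyp J C"
    proof
      fix J assume J: "J \<in> \<J>"
      have "\<not> J \<subseteq> X"
      proof
        assume "J \<subseteq> X"
        then have "card J \<le> card X" by (intro card_mono) auto
        then show False using J k(1) by (simp add: \<J>_def)
      qed
      then obtain j where j: "j \<in> J" "j \<in> Y" using J by (auto simp: \<J>_def)
      have "A * (\<Lambda> J j + 1) ^ q j \<le> \<Delta>0"
        unfolding \<Delta>0_def using member_le_sum[of "(J, j)" UNIV "\<lambda>(J, j). A * (\<Lambda> J j + 1) ^ q j"] by simp
      with \<Delta> have le: "A * (\<Lambda> J j + 1) ^ q j \<le> \<Delta>" by simp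
      have "\<delta> < card J + card (- (X \<union> Y))" using J k(2) by (simp add: \<J>_def)
      from bad_parameters_hypersurface[OF XY j sp this q_def[of j, unfolded T_def Zc_def]
          \<Lambda>_def[of J j, unfolded T_def Zc_def] le, of a]
      show "\<exists>C. hyp J C" unfolding hyp_def T_def .
    qed
    then obtain C where C: "\<And>J. J \<in> \<J> \<Longrightarrow> hyp J (C J)" by metis
    define Rt where "Rt J = {t. (\<Sum>\<nu>\<in>box_exps T \<Delta>. C J \<nu> * mon \<nu> (\<lambda>v. t ^ E ^ idx v)) = 0}" for J
    have Rt: "finite (Rt J)" "card (Rt J) \<le> (\<Sum>v\<in>T. E * E ^ idx v)" if J: "J \<in> \<J>" for J
    proof -
      obtain \<nu> where \<nu>: "\<nu> \<in> box_exps T \<Delta>" "C J \<nu> \<noteq> 0" using C[OF J] by (auto simp: hyp_def)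
      have fin: "finite T" "finite (box_exps T \<Delta>)" by (simp_all add: T_def box_exps_finite_card)
      have lt: "\<alpha> v < E" if "\<alpha> \<in> box_exps T \<Delta>" for \<alpha> v
        using box_exps_le[OF that, of v] E by simp
      note kr = kronecker_roots[where a = "C J" and \<alpha> = \<nu>, OF fin(1) idx[folded T_def] fin(2) box_exps_supp _ \<nu>]
      show "finite (Rt J)" unfolding Rt_def by (rule kr(1)) (use lt in auto)
      show "card (Rt J) \<le> (\<Sum>v\<in>T. E * E ^ idx v)" unfolding Rt_def by (rule kr(2)) (use lt in auto)
    qed
    have sub: "{b. variety_dim (W \<inter> ?F b) = ereal (real k')} \<subseteq> (\<Union>J\<in>\<J>. Rt J)"
    proof
      fix b assume "b \<in> {b. variety_dim (W \<inter> ?F b) = ereal (real k')}"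
      then have chain: "has_irreducible_chain (W \<inter> ?F b) k'" using variety_dim_chain by simp
      obtain r where r: "k' = Suc r" using k(1) by (cases k') auto
      define \<theta> where "\<theta> v = b ^ E ^ idx v" for v
      \<comment> \<open>On the flat every coordinate is an affine function of those in
        \<open>X \<union> Y\<close>, so independent coordinates can be sought there.\<close>
      define L where "L i x = (if i \<in> X \<union> Y then x i else
        (if i = z1 then \<theta> (z1, z1) + (\<Sum>l\<in>X. a l * x l) else 0) + (\<Sum>y\<in>Y. \<theta> (i, y) * x y))" for i x
      have var: "pol (X \<union> Y) 1 (\<lambda>x. x i)" if "i \<in> X \<union> Y" for i by (rule pol_var) (use that in auto)
      have "pol (X \<union> Y) 1 (L i)" for i
      proof (cases "i \<in> X \<union> Y")
        case True
        then show ?thesis using var by (simp add: L_def[abs_def])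
      next
        case False
        have "pol (X \<union> Y) 1 (\<lambda>x. if i = z1 then \<theta> (z1, z1) + (\<Sum>l\<in>X. a l * x l) else 0)"
        proof (cases "i = z1")
          case True
          have "pol (X \<union> Y) 1 (\<lambda>x. \<theta> (z1, z1) + (\<Sum>l\<in>X. a l * x l))"
            by (intro pol_add pol_sum pol_cmult pol_const var) auto
          then show ?thesis using True by simp
        qed (simp add: pol_const)
        moreover have "pol (X \<union> Y) 1 (\<lambda>x. \<Sum>y\<in>Y. \<theta> (i, y) * x y)"
          by (intro pol_sum pol_cmult var) auto
        ultimately show ?thesis using False pol_add unfolding L_def[abs_def] by simp
      qed
      moreover have "x $ i = L i (($) x)" if "x \<in> W \<inter> ?F b" for x i
        using that by (simp add: L_def tflat_def \<theta>_def)
      ultimately obtain J where J: "J \<subseteq> X \<union> Y" "card J = k'" "\<forall>c. \<not> dependent_on c J (($) ` (W \<inter> ?F b))"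
        using chain_imp_independent[of "W \<inter> ?F b" r "X \<union> Y" L] chain unfolding r by blast
      then have "J \<in> \<J>" by (simp add: \<J>_def)
      with C[of J] J(3) have "b \<in> Rt J" by (simp add: hyp_def Rt_def)
      with \<open>J \<in> \<J>\<close> show "b \<in> (\<Union>J\<in>\<J>. Rt J)" by blast
    qed
    have finJ: "finite \<J>" by simp
    have finU: "finite (\<Union>J\<in>\<J>. Rt J)" using finJ Rt(1) by (rule finite_UN_I)
    have "card (\<Union>J\<in>\<J>. Rt J) \<le> (\<Sum>J\<in>\<J>. card (Rt J))" by (rule card_UN_le[OF finJ])
    also have "\<dots> \<le> of_nat (card \<J>) * (\<Sum>v\<in>T. E * E ^ idx v)" by (rule sum_bounded_above) (rule Rt(2))
    also have "\<dots> \<le> 2 ^ CARD('n) * (\<Sum>v\<in>T. E * E ^ idx v)"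
    proof (rule mult_right_mono)
      have "card \<J> \<le> card (Pow (UNIV :: 'n set))" by (rule card_mono) auto
      then show "of_nat (card \<J>) \<le> (2 :: nat) ^ CARD('n)" by (simp add: card_Pow)
    qed simp
    finally have "card (\<Union>J\<in>\<J>. Rt J) \<le> 2 ^ CARD('n) * (\<Sum>v\<in>T. E * E ^ idx v)" .
    then show "finite {b. variety_dim (W \<inter> ?F b) = ereal (real k')} \<and>
        card {b. variety_dim (W \<inter> ?F b) = ereal (real k')} \<le> 2 ^ CARD('n) * (\<Sum>v\<in>tvars X Y z1. E * E ^ idx v)"
      using finite_subset[OF sub finU] order_trans[OF card_mono[OF finU sub]] unfolding T_def by blast
  qed
qed

lemma flat_tflat:
  fixes X Y :: "'n::finite set"
  assumes XY: "X \<inter> Y = {}"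
  shows "flat (card (X \<union> Y)) (tflat X Y z1 a \<theta>)"
proof -
  define S where "S = {x :: real ^ 'n. \<forall>i. i \<notin> X \<union> Y \<longrightarrow> x $ i = 0}"
  define g where "g x = (\<chi> z. if z \<in> X \<union> Y then x $ z else
      (if z = z1 then (\<Sum>i\<in>X. a i * x $ i) else 0) + (\<Sum>y\<in>Y. \<theta> (z, y) * x $ y))" for x :: "real ^ 'n"
  define v where "v = (\<chi> z. if z \<notin> X \<union> Y \<and> z = z1 then \<theta> (z1, z1) else (0 :: real))"
  have lin: "linear g"
  proof (rule linearI)
    show "g (x + y) = g x + g y" for x y
      by (auto simp: g_def vec_eq_iff distrib_left sum.distrib)
    show "g (r *\<^sub>R x) = r *\<^sub>R g x" for r x
      by (auto simp: g_def vec_eq_iff distrib_left sum_distrib_left mult_ac)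
  qed
  have S: "subspace S" unfolding S_def by (auto simp: subspace_def)
  have dimS: "dim S = card (X \<union> Y)"
    using dim_substandard_cart[where 'a = real and d = "X \<union> Y"] by (simp add: S_def dim_vec_eq)
  have inj: "inj_on g S"
  proof (rule inj_onI)
    fix x y assume xy: "x \<in> S" "y \<in> S" "g x = g y"
    have "x $ i = y $ i" for i
    proof (cases "i \<in> X \<union> Y")
      case True
      then show ?thesis using arg_cong[OF xy(3), of "\<lambda>w. w $ i"] by (simp add: g_def)
    next
      case False
      then show ?thesis using xy by (simp add: S_def)
    qed
    then show "x = y" by (simp add: vec_eq_iff)
  qed
  have eq: "tflat X Y z1 a \<theta> = (+) v ` (g ` S)"
  proof
    show "(+) v ` (g ` S) \<subseteq> tflat X Y z1 a \<theta>" by (auto simp: tflat_def v_def g_def)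
    show "tflat X Y z1 a \<theta> \<subseteq> (+) v ` (g ` S)"
    proof
      fix x assume x: "x \<in> tflat X Y z1 a \<theta>"
      define x0 where "x0 = (\<chi> i. if i \<in> X \<union> Y then x $ i else 0)"
      have "(\<Sum>i\<in>X. a i * x0 $ i) = (\<Sum>i\<in>X. a i * x $ i)" by (rule sum.cong) (auto simp: x0_def)
      moreover have "(\<Sum>y\<in>Y. \<theta> (z, y) * x0 $ y) = (\<Sum>y\<in>Y. \<theta> (z, y) * x $ y)" for z
        by (rule sum.cong) (auto simp: x0_def)
      ultimately have "x = v + g x0" using x by (auto simp: vec_eq_iff g_def v_def tflat_def x0_def)
      moreover have "x0 \<in> S" by (simp add: x0_def S_def)
      ultimately show "x \<in> (+) v ` (g ` S)" by blast
    qed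
  qed
  have sub: "subspace (g ` S)" by (rule linear_subspace_image[OF lin S])
  have "span S = S" using S by (rule span_eq_iff[THEN iffD2])
  then have "inj_on g (span S)" using inj by (simp only:)
  then have "dim (g ` S) = dim S" by (rule dim_image_eq[OF lin])
  then have "aff_dim (tflat X Y z1 a \<theta>) = int (card (X \<union> Y))"
    unfolding eq aff_dim_translation_eq using aff_dim_subspace[OF sub] dimS by simp
  moreover have "affine (tflat X Y z1 a \<theta>)"
    unfolding eq using subspace_imp_affine[OF sub] affine_translation by blast
  ultimately show ?thesis by (simp add: flat_def)
qed

section \<open>Exponents in the bound\<close>

lemma significantD:
  assumes "\<sigma> \<in> S_set k d"
  shows "\<sigma> \<noteq> []" "\<sigma> ! 0 = (k, d)"
    "\<And>j. j < length \<sigma> \<Longrightarrow> fst (\<sigma> ! j) < snd (\<sigma> ! j)"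
    "\<And>j. j < length \<sigma> \<Longrightarrow> snd (\<sigma> ! j) \<le> d"
    "\<And>j. Suc j < length \<sigma> \<Longrightarrow> real (fst (\<sigma> ! j)) / real (snd (\<sigma> ! j)) < real (fst (\<sigma> ! Suc j)) / real (snd (\<sigma> ! Suc j))"
proof -
  show ne: "\<sigma> \<noteq> []" and z: "\<sigma> ! 0 = (k, d)"
    and "\<And>j. j < length \<sigma> \<Longrightarrow> fst (\<sigma> ! j) < snd (\<sigma> ! j)"
    and "\<And>j. Suc j < length \<sigma> \<Longrightarrow> real (fst (\<sigma> ! j)) / real (snd (\<sigma> ! j)) < real (fst (\<sigma> ! Suc j)) / real (snd (\<sigma> ! Suc j))"
    using assms by (auto simp: S_set_def significant_def hd_conv_nth)
  show "snd (\<sigma> ! j) \<le> d" if "j < length \<sigma>" for j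
    using that
  proof (induction j)
    case (Suc j)
    have "snd (\<sigma> ! Suc j) < snd (\<sigma> ! j)" using assms Suc.prems by (auto simp: S_set_def significant_def)
    then show ?case using Suc by simp
  qed (simp add: z)
qed

lemma codim_ratio_mono:
  assumes "fst x < snd x" "fst y < snd y" "real (fst x) / real (snd x) < real (fst y) / real (snd y)"
  shows "codim_ratio x \<le> codim_ratio y"
proof -
  have pos: "real (snd x) > 0" "real (snd y) > 0" "real (snd x) - real (fst x) > 0" "real (snd y) - real (fst y) > 0"
    using assms by auto
  have "real (fst x) * real (snd y) < real (fst y) * real (snd x)" using assms pos by (simp add: field_simps)
  then show ?thesis using pos unfolding codim_ratio_def by (simp add: field_simps)
qed

lemma codim_ratio_le:
  assumes "fst x < snd x" "snd x \<le> d" shows "codim_ratio x \<le> real d"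
proof -
  have "real (snd x) - real (fst x) \<ge> 1" using assms(1) by linarith
  then have "codim_ratio x \<le> real (snd x) / 1" unfolding codim_ratio_def by (intro divide_left_mono) auto
  then show ?thesis using assms(2) by simp
qed

text \<open>\<open>codim_ratio\<close> takes values with denominator at most \<open>d\<close>, hence stays away from the
  integer \<open>d'\<close>.\<close>

lemma codim_ratio_gap:
  assumes x: "fst x < snd x" "snd x \<le> d" and d': "0 < d'"
    and less: "real (fst x) / real (snd x) < (real d' - 1) / real d'"
  shows "codim_ratio x \<le> real d' - 1 / real d"
proof -
  define l where "l = snd x - fst x"
  have l: "1 \<le> l" "l \<le> d" "real l = real (snd x) - real (fst x)" using x by (auto simp: l_def)
  have "real (fst x) * real d' < (real d' - 1) * real (snd x)" using less x d' by (simp add: field_simps)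
  moreover have "real d' * real l = real d' * real (snd x) - real d' * real (fst x)"
    by (simp add: l(3) right_diff_distrib)
  ultimately have "real (snd x) < real (d' * l)" by (simp add: algebra_simps)
  then have "snd x + 1 \<le> d' * l" by linarith
  then have "real (snd x) \<le> real d' * real l - 1" by (metis le_diff_eq of_nat_1 of_nat_add of_nat_le_iff of_nat_mult)
  then have "codim_ratio x \<le> (real d' * real l - 1) / real l"
    unfolding codim_ratio_def l(3)[symmetric] using l(1) by (intro divide_right_mono) auto
  also have "\<dots> = real d' - 1 / real l" using l(1) by (simp add: field_simps)
  also have "\<dots> \<le> real d' - 1 / real d" using l by (intro diff_left_mono divide_left_mono) auto
  finally show ?thesis .
qed

text \<open>The product telescopes. \<open>Y\<close> collects the increments at pairs that carry
  weight \<open>n\<close> and never exceeds the current ratio; so at a pair of small slope it is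
  below \<open>d' - 1 / d\<close> by \<open>codim_ratio_gap\<close>. The other pairs add only powers
  of \<open>q0\<close>.\<close>

lemma weight_product_bound:
  fixes q :: "nat \<times> nat \<Rightarrow> nat" and n d' q0 :: nat and N :: real
  assumes \<sigma>: "\<sigma> \<in> S_set k d" and d': "0 < d'" and kd: "real k / real d < (real d' - 1) / real d'"
    and n: "1 \<le> n" "real n \<le> N" and q0: "1 \<le> q0"
    and q: "\<And>x. q x = (if real (fst x) / real (snd x) < (real d' - 1) / real d' then n else q0)"
    and l: "l < length \<sigma>"
  shows "\<exists>Y\<le>real d' - 1 / real d. Y \<le> codim_ratio (\<sigma> ! l) \<and>
    real n powr codim_ratio (\<sigma> ! 0) *
      (\<Prod>j = 1..<Suc l. real (q (\<sigma> ! j)) powr (codim_ratio (\<sigma> ! j) - codim_ratio (\<sigma> ! (j - 1))))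
    \<le> N powr Y * real q0 powr (codim_ratio (\<sigma> ! l) - codim_ratio (\<sigma> ! 0))"
  using l
proof (induction l)
  case 0
  note s = significantD[OF \<sigma>]
  have "codim_ratio (\<sigma> ! 0) \<le> real d' - 1 / real d"
    by (rule codim_ratio_gap) (use s(2) s(3)[of 0] 0 d' kd in auto)
  moreover have "real n powr codim_ratio (\<sigma> ! 0) \<le> N powr codim_ratio (\<sigma> ! 0)"
    using n s(3)[OF 0] by (intro powr_mono2) (auto simp: codim_ratio_def)
  ultimately show ?case using q0 by (intro exI[of _ "codim_ratio (\<sigma> ! 0)"]) simp
next
  case (Suc l)
  note s = significantD[OF \<sigma>]
  let ?a = "\<lambda>j. codim_ratio (\<sigma> ! j)"
  let ?P = "\<lambda>l. \<Prod>j = 1..<Suc l. real (q (\<sigma> ! j)) powr (?a j - ?a (j - 1))"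
  from Suc obtain Y where Y: "Y \<le> real d' - 1 / real d" "Y \<le> ?a l"
    "real n powr ?a 0 * ?P l \<le> N powr Y * real q0 powr (?a l - ?a 0)" by auto
  have mono: "?a l \<le> ?a (Suc l)" by (rule codim_ratio_mono) (use s(3,5) Suc.prems in auto)
  have N1: "N \<ge> 1" using n by linarith
  have step: "?P (Suc l) = ?P l * real (q (\<sigma> ! Suc l)) powr (?a (Suc l) - ?a l)" by simp
  show ?case
  proof (cases "real (fst (\<sigma> ! Suc l)) / real (snd (\<sigma> ! Suc l)) < (real d' - 1) / real d'")
    case True
    define Y' where "Y' = Y + (?a (Suc l) - ?a l)"
    have "Y' \<le> ?a (Suc l)" using Y by (simp add: Y'_def)
    moreover have "?a (Suc l) \<le> real d' - 1 / real d"
      by (rule codim_ratio_gap[OF _ _ d' True]) (use s(3,4) Suc.prems in auto)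
    moreover have "real n powr ?a 0 * ?P (Suc l) \<le> N powr Y' * real q0 powr (?a (Suc l) - ?a 0)"
    proof -
      have "real n powr ?a 0 * ?P (Suc l) = (real n powr ?a 0 * ?P l) * real n powr (?a (Suc l) - ?a l)"
        unfolding step using True by (simp add: q mult.assoc)
      also have "\<dots> \<le> (N powr Y * real q0 powr (?a l - ?a 0)) * N powr (?a (Suc l) - ?a l)"
        by (rule mult_mono[OF Y(3) powr_mono2]) (use n mono in auto)
      also have "\<dots> = N powr Y' * real q0 powr (?a l - ?a 0)" by (simp add: Y'_def powr_add mult_ac)
      also have "\<dots> \<le> N powr Y' * real q0 powr (?a (Suc l) - ?a 0)"
        using q0 mono by (intro mult_left_mono powr_mono) auto
      finally show ?thesis .
    qed
    ultimately show ?thesis by (intro exI[of _ Y']) auto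
  next
    case False
    have "real n powr ?a 0 * ?P (Suc l) = (real n powr ?a 0 * ?P l) * real q0 powr (?a (Suc l) - ?a l)"
      unfolding step using False by (simp add: q mult.assoc)
    also have "\<dots> \<le> (N powr Y * real q0 powr (?a l - ?a 0)) * real q0 powr (?a (Suc l) - ?a l)"
      using Y(3) by (intro mult_right_mono) auto
    also have "\<dots> = N powr Y * real q0 powr (?a (Suc l) - ?a 0)" by (simp add: mult.assoc flip: powr_add)
    finally show ?thesis using Y mono by (intro exI[of _ Y]) auto
  qed
qed

text \<open>With \<open>e = (du - ku) / (du + ku)\<close> the term is at most a constant times
  \<open>K\<close> to the power \<open>d' * (1 - e + \<epsilon>) + (d' - 1 / d) * e\<close>, that is
  \<open>d' - e / d + d' * \<epsilon>\<close>. Since \<open>e \<ge> 1 / (2 * d)\<close>, the saving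
  is at least \<open>1 / (2 * d^2)\<close>, of which \<open>d' * \<epsilon>\<close> takes
  half.\<close>

lemma bound_term_le:
  fixes q :: "nat \<times> nat \<Rightarrow> nat" and n d' q0 K \<kappa> :: nat
  assumes \<sigma>: "\<sigma> \<in> S_set k d" and d': "0 < d'" and kd: "real k / real d < (real d' - 1) / real d'"
    and n: "1 \<le> n" "n \<le> \<kappa> * K" and q0: "1 \<le> q0"
    and q: "\<And>x. q x = (if real (fst x) / real (snd x) < (real d' - 1) / real d' then n else q0)"
    and \<epsilon>: "\<epsilon> = 1 / (4 * (real d)\<^sup>2 * real d')"
  shows "bound_term (K ^ d') n q \<epsilon> \<sigma> \<le>
    real \<kappa> powr real d' * real q0 powr real d * real K powr (real d' - 1 / (4 * (real d)\<^sup>2))"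
proof -
  note s = significantD[OF \<sigma>]
  define u where "u = length \<sigma> - 1"
  have u: "u < length \<sigma>" "Suc u = length \<sigma>" "last \<sigma> = \<sigma> ! u" "hd \<sigma> = \<sigma> ! 0"
    using s(1) by (auto simp: u_def last_conv_nth hd_conv_nth)
  define ku du where "ku = real (fst (\<sigma> ! u))" and "du = real (snd (\<sigma> ! u))"
  define e where "e = (du - ku) / (du + ku)"
  have K1: "1 \<le> K" "1 \<le> \<kappa>" using n by (cases K; cases \<kappa>; simp)+
  have dku: "du - ku \<ge> 1" "du \<le> d" "ku \<ge> 0" using s(3,4)[OF u(1)] by (auto simp: ku_def du_def)
  have d1: "real d \<ge> 1" using dku by linarith
  have e: "1 / (2 * real d) \<le> e" "e \<le> 1"
  proof -
    have "1 / (2 * real d) \<le> 1 / (du + ku)" using dku by (intro divide_left_mono) auto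
    also have "\<dots> \<le> e" unfolding e_def using dku by (intro divide_right_mono) auto
    finally show "1 / (2 * real d) \<le> e" .
    show "e \<le> 1" unfolding e_def using dku by (simp add: field_simps)
  qed
  have e0: "e > 0" using e(1) d1 by (smt (verit) divide_pos_pos)
  have e2: "2 * ku / (du + ku) = 1 - e" unfolding e_def using dku by (simp add: field_simps)
  have nN: "real n \<le> real (\<kappa> * K)" using n by linarith
  obtain Y where Y: "Y \<le> real d' - 1 / real d"
    "real n powr codim_ratio (\<sigma> ! 0) *
      (\<Prod>j = 1..<Suc u. real (q (\<sigma> ! j)) powr (codim_ratio (\<sigma> ! j) - codim_ratio (\<sigma> ! (j - 1))))
     \<le> real (\<kappa> * K) powr Y * real q0 powr (codim_ratio (\<sigma> ! u) - codim_ratio (\<sigma> ! 0))"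
    using weight_product_bound[OF \<sigma> d' kd n(1) nN q0 q u(1)] by blast
  define B where "B = real n powr codim_ratio (\<sigma> ! 0) *
      (\<Prod>j = 1..<length \<sigma>. real (q (\<sigma> ! j)) powr (codim_ratio (\<sigma> ! j) - codim_ratio (\<sigma> ! (j - 1))))"
  define H where "H = real \<kappa> powr real d' * real q0 powr real d"
  define Y0 where "Y0 = real d' - 1 / real d"
  have H1: "H \<ge> 1" unfolding H_def using K1 q0 by (simp add: ge_one_powr_ge_zero mult_ge1_I)
  have "B \<le> real (\<kappa> * K) powr Y * real q0 powr (codim_ratio (\<sigma> ! u) - codim_ratio (\<sigma> ! 0))"
    using Y(2) u(2) by (simp add: B_def)
  also have "\<dots> \<le> real (\<kappa> * K) powr Y0 * real q0 powr real d"
  proof (intro mult_mono powr_mono)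
    have "codim_ratio (\<sigma> ! u) \<le> real d" using s(3,4)[OF u(1)] by (rule codim_ratio_le)
    moreover have "codim_ratio (\<sigma> ! 0) \<ge> 0" using s(1) s(3)[of 0]
      by (auto simp: codim_ratio_def intro!: divide_nonneg_nonneg)
    ultimately show "codim_ratio (\<sigma> ! u) - codim_ratio (\<sigma> ! 0) \<le> real d" by linarith
    show "1 \<le> real (\<kappa> * K)" using nN n(1) by linarith
  qed (use Y q0 in \<open>auto simp: Y0_def\<close>)
  also have "real (\<kappa> * K) powr Y0 = real \<kappa> powr Y0 * real K powr Y0" by (simp add: powr_mult)
  also have "real \<kappa> powr Y0 * real K powr Y0 * real q0 powr real d \<le> real \<kappa> powr real d' * real K powr Y0 * real q0 powr real d"
    using K1 by (intro mult_right_mono powr_mono) (auto simp: Y0_def)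
  finally have B: "B \<le> H * real K powr Y0" by (simp add: H_def mult_ac)
  have B0: "B \<ge> 0" unfolding B_def by (intro mult_nonneg_nonneg prod_nonneg) auto
  have "B powr e \<le> (H * real K powr Y0) powr e" using B B0 e0 by (intro powr_mono2) auto
  also have "\<dots> = H powr e * real K powr (Y0 * e)" using H1 by (simp add: powr_mult powr_powr)
  also have "\<dots> \<le> H powr 1 * real K powr (Y0 * e)" using H1 e by (intro mult_right_mono powr_mono) auto
  also have "H powr 1 = H" using H1 by simp
  finally have Be: "B powr e \<le> H * real K powr (Y0 * e)" .
  have "bound_term (K ^ d') n q \<epsilon> \<sigma> = real (K ^ d') powr (1 - e + \<epsilon>) * B powr e"
    unfolding bound_term_def Let_def u(3,4) B_def e2[symmetric] unfolding e_def ku_def du_def by simp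
  also have "real (K ^ d') powr (1 - e + \<epsilon>) = real K powr (real d' * (1 - e + \<epsilon>))"
    using K1 by (simp add: powr_realpow[symmetric] powr_powr)
  also have "\<dots> * B powr e \<le> real K powr (real d' * (1 - e + \<epsilon>)) * (H * real K powr (Y0 * e))"
    by (rule mult_left_mono[OF Be]) simp
  also have "\<dots> = H * real K powr (real d' * (1 - e + \<epsilon>) + Y0 * e)" by (simp add: powr_add)
  also have "\<dots> \<le> H * real K powr (real d' - 1 / (4 * (real d)\<^sup>2))"
  proof (intro mult_left_mono powr_mono)
    have "real d' * (1 - e + \<epsilon>) + Y0 * e = real d' - e / real d + real d' * \<epsilon>"
      by (simp add: Y0_def algebra_simps)
    also have "real d' * \<epsilon> = 1 / (4 * (real d)\<^sup>2)" using d' by (simp add: \<epsilon>)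
    also have "real d' - e / real d \<le> real d' - (1 / (2 * real d)) / real d"
      using e(1) d1 by (intro diff_left_mono divide_right_mono) auto
    also have "(1 / (2 * real d)) / real d = 2 * (1 / (4 * (real d)\<^sup>2))" by (simp add: power2_eq_square)
    finally show "real d' * (1 - e + \<epsilon>) + Y0 * e \<le> real d' - 1 / (4 * (real d)\<^sup>2)" by linarith
  qed (use K1 H1 in auto)
  finally show ?thesis by (simp add: H_def)
qed

section \<open>The configuration\<close>

definition grid_points :: "'n set \<Rightarrow> nat \<Rightarrow> (real ^ 'n::finite) set" where
  "grid_points I K = (\<lambda>f. \<chi> i. if i \<in> I then real (f i) else 0) ` PiE I (\<lambda>_. {1..K})"

lemma finite_card_grid_points:
  "finite (grid_points (I :: 'n::finite set) K)" "card (grid_points I K) = K ^ card I"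
proof -
  have "inj_on (\<lambda>f. (\<chi> i. if i \<in> I then real (f i) else 0) :: real ^ 'n) (PiE I (\<lambda>_. {1..K}))"
  proof (rule inj_onI)
    fix f g assume fg: "f \<in> PiE I (\<lambda>_. {1..K})" "g \<in> PiE I (\<lambda>_. {1..K})"
      and eq: "(\<chi> i. if i \<in> I then real (f i) else 0) = ((\<chi> i. if i \<in> I then real (g i) else 0) :: real ^ 'n)"
    show "f = g"
    proof (rule PiE_ext[OF fg])
      fix i assume "i \<in> I"
      then show "f i = g i" using arg_cong[OF eq, of "\<lambda>x. x $ i"] by simp
    qed
  qed
  then have "card (grid_points I K) = card (PiE I (\<lambda>_. {1..K}))" unfolding grid_points_def by (rule card_image)
  then show "card (grid_points I K) = K ^ card I" by (simp add: card_PiE)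
  have "finite (PiE I (\<lambda>_. {1..K}))" by (rule finite_PiE) auto
  then show "finite (grid_points I K)" by (simp add: grid_points_def)
qed

lemma grid_pointsD:
  assumes "x \<in> grid_points I K"
  shows "\<And>i. i \<notin> I \<Longrightarrow> x $ i = 0" "\<And>i. i \<in> I \<Longrightarrow> \<exists>l\<in>{1..K}. x $ i = real l"
  using assms by (auto simp: grid_points_def PiE_iff)

text \<open>The columns over \<open>Y\<close> do not act on the span of \<open>X\<close> and
  \<open>z1\<close>, so generic choices there leave the incidences with the grid unchanged.\<close>

lemma in_tflat_iff:
  assumes XY: "X \<inter> Y = {}" "z1 \<notin> X \<union> Y" and x: "\<And>i. i \<notin> insert z1 X \<Longrightarrow> x $ i = 0"
  shows "x \<in> tflat X Y z1 a \<theta> \<longleftrightarrow> x $ z1 = \<theta> (z1, z1) + (\<Sum>i\<in>X. a i * x $ i)"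
proof -
  have Y: "(\<Sum>y\<in>Y. \<theta> (z, y) * x $ y) = 0" for z
  proof (rule sum.neutral, rule ballI)
    fix y assume "y \<in> Y"
    then have "y \<notin> insert z1 X" using XY by blast
    then show "\<theta> (z, y) * x $ y = 0" using x by simp
  qed
  show ?thesis using XY x unfolding tflat_def by (auto simp: Y)
qed

text \<open>\<open>s\<close> is the direction and \<open>b\<close> the offset of the hyperplane that the flat cuts out in the span of
  the coordinates \<open>X \<union> {z1}\<close>.\<close>

definition curve_flat :: "'n set \<Rightarrow> 'n set \<Rightarrow> 'n \<Rightarrow> ('n \<Rightarrow> nat) \<Rightarrow> nat \<Rightarrow> ('n \<times> 'n \<Rightarrow> nat) \<Rightarrow>
    nat \<Rightarrow> int \<Rightarrow> (real ^ 'n::finite) set" where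
  "curve_flat X Y z1 ix E idx s b = tflat X Y z1 (\<lambda>i. real s ^ ix i) (\<lambda>v. real_of_int b ^ E ^ idx v)"

text \<open>Numbering \<open>X\<close> from 1 puts the normals on the moment curve, with powers
  \<open>s, s^2, ...\<close>; the index 0 of \<open>(z1, z1)\<close> makes the offset
  \<open>b ^ E ^ 0 = b\<close> itself.\<close>

context
  fixes X Y :: "'n::finite set" and z1 :: 'n and ix :: "'n \<Rightarrow> nat" and E :: nat
    and idx :: "'n \<times> 'n \<Rightarrow> nat"
  assumes XY: "X \<inter> Y = {}" "z1 \<notin> X \<union> Y" and ix: "bij_betw ix X {1..card X}" and X: "X \<noteq> {}"
    and idx: "idx (z1, z1) = 0"
begin

lemma in_curve_flat_iff:
  assumes "\<And>i. i \<notin> insert z1 X \<Longrightarrow> x $ i = 0"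
  shows "x \<in> curve_flat X Y z1 ix E idx s b \<longleftrightarrow> x $ z1 = real_of_int b + (\<Sum>i\<in>X. real s ^ ix i * x $ i)"
  unfolding curve_flat_def by (subst in_tflat_iff[OF XY assms]) (simp_all add: idx)

text \<open>Two test points read off the parameters: \<open>p0\<close> sees only the offset, and
  \<open>p1\<close>, with a unit coordinate at the index where \<open>ix\<close> is 1, sees
  \<open>b + s\<close>.\<close>

lemma curve_flat_inject:
  assumes "curve_flat X Y z1 ix E idx s b = curve_flat X Y z1 ix E idx s' b'"
  shows "s = s' \<and> b = b'"
proof -
  let ?F = "curve_flat X Y z1 ix E idx"
  have "1 \<in> {1..card X}" using X by (simp add: Suc_le_eq card_gt_0_iff)
  then obtain i0 where i0: "i0 \<in> X" "ix i0 = 1" using ix by (metis bij_betw_imp_surj_on imageE)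
  have z1: "z1 \<notin> X" using XY by simp
  define p0 :: "real ^ 'n" where "p0 = (\<chi> i. if i = z1 then real_of_int b else 0)"
  have p0: "(\<Sum>i\<in>X. c i * p0 $ i) = 0" for c by (rule sum.neutral) (use z1 in \<open>auto simp: p0_def\<close>)
  have out0: "\<And>i. i \<notin> insert z1 X \<Longrightarrow> p0 $ i = 0" by (simp add: p0_def)
  have m0: "p0 \<in> ?F r c \<longleftrightarrow> real_of_int b = real_of_int c" for r c
    using in_curve_flat_iff[OF out0, of r c] p0[of "\<lambda>i. real r ^ ix i"] by (simp add: p0_def)
  have "p0 \<in> ?F s b" by (simp add: m0)
  then have "p0 \<in> ?F s' b'" using assms by simp
  then have b: "b = b'" by (simp add: m0)
  define p1 :: "real ^ 'n" where "p1 = (\<chi> i. if i = z1 then real_of_int b + real s else if i = i0 then 1 else 0)"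
  have p1: "(\<Sum>i\<in>X. c i * p1 $ i) = c i0" for c
  proof -
    have "(\<Sum>i\<in>X. c i * p1 $ i) = (\<Sum>i\<in>X. if i = i0 then c i else 0)"
      by (rule sum.cong) (use z1 in \<open>auto simp: p1_def\<close>)
    then show ?thesis using i0 by simp
  qed
  have out1: "\<And>i. i \<notin> insert z1 X \<Longrightarrow> p1 $ i = 0" using i0 by (auto simp: p1_def)
  have m1: "p1 \<in> ?F r c \<longleftrightarrow> real_of_int b + real s = real_of_int c + real r" for r c
    using in_curve_flat_iff[OF out1, of r c] p1[of "\<lambda>i. real r ^ ix i"] i0(2) by (simp add: p1_def)
  have "p1 \<in> ?F s b" by (simp add: m1)
  then have "p1 \<in> ?F s' b'" using assms by simp
  then have "real_of_int b + real s = real_of_int b' + real s'" by (simp add: m1)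
  with b show ?thesis by simp
qed

text \<open>The difference \<open>w\<close> of the two points gives a nonzero polynomial
  \<open>Q\<close> of degree at most \<open>card X\<close> that vanishes at the direction
  \<open>s\<close> of every common flat. A direction and one of the points determine the offset, so
  at most \<open>card X\<close> flats are common.\<close>

lemma K2t_free_curve_flats:
  assumes V: "\<V> \<subseteq> {curve_flat X Y z1 ix E idx s b |s b. True}"
  shows "K2t_free (card X + 1) (grid_points (insert z1 X) K) \<V>"
  unfolding K2t_free_def
proof
  let ?F = "curve_flat X Y z1 ix E idx" and ?P = "grid_points (insert z1 X) K"
  assume "\<exists>p\<in>?P. \<exists>p'\<in>?P. \<exists>T. p \<noteq> p' \<and> T \<subseteq> \<V> \<and> finite T \<and> card T = card X + 1 \<and> (\<forall>F\<in>T. p \<in> F \<and> p' \<in> F)"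
  then obtain p p' T where p: "p \<in> ?P" "p' \<in> ?P" "p \<noteq> p'" and T: "T \<subseteq> \<V>" "finite T" "card T = card X + 1"
    "\<And>F. F \<in> T \<Longrightarrow> p \<in> F \<and> p' \<in> F" by blast
  have z1: "z1 \<notin> X" using XY by simp
  define w where "w = p - p'"
  have w0: "w $ i = 0" if "i \<notin> insert z1 X" for i
    using grid_pointsD(1)[OF p(1) that] grid_pointsD(1)[OF p(2) that] by (simp add: w_def)
  have "w \<noteq> 0" using p(3) by (simp add: w_def)
  \<comment> \<open>\<open>ix\<close> avoids 0, so \<open>w $ z1\<close> is the constant term and no
    two entries of \<open>w\<close> share a coefficient.\<close>
  define Q where "Q = (\<Sum>i\<in>X. Polynomial.monom (w $ i) (ix i)) - [:w $ z1:]"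
  have inj: "inj_on ix X" and ix_ran: "\<And>i. i \<in> X \<Longrightarrow> ix i \<in> {1..card X}"
    using ix by (auto simp: bij_betw_def)
  have coeff: "coeff Q (ix j) = w $ j" if "j \<in> X" for j
  proof -
    have "coeff (\<Sum>i\<in>X. Polynomial.monom (w $ i) (ix i)) (ix j) = (\<Sum>i\<in>X. if i = j then w $ i else 0)"
      unfolding coeff_sum coeff_monom by (rule sum.cong) (use inj that in \<open>auto simp: inj_on_def\<close>)
    moreover have "coeff [:w $ z1:] (ix j) = 0" using ix_ran[OF that] by (cases "ix j") auto
    ultimately show ?thesis using that by (simp add: Q_def)
  qed
  have "Q \<noteq> 0"
  proof
    assume Q: "Q = 0"
    then have wX: "w $ i = 0" if "i \<in> X" for i using coeff[OF that] by simp
    then have "Q = - [:w $ z1:]" by (simp add: Q_def)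
    then have "w $ z1 = 0" using Q by simp
    with wX w0 have "w = 0" by (metis insert_iff vec_eq_iff zero_index)
    with \<open>w \<noteq> 0\<close> show False by simp
  qed
  have degQ: "degree Q \<le> card X"
    unfolding Q_def using ix_ran
    by (intro degree_diff_le degree_sum_le) (auto intro: order_trans[OF degree_monom_le])
  have "\<forall>F\<in>T. \<exists>s b. F = ?F s b" using T(1) V by blast
  then obtain sF bF where F: "\<And>F. F \<in> T \<Longrightarrow> F = ?F (sF F) (bF F)" by metis
  have mem: "p $ z1 = real_of_int (bF F) + (\<Sum>i\<in>X. real (sF F) ^ ix i * p $ i)"
    "p' $ z1 = real_of_int (bF F) + (\<Sum>i\<in>X. real (sF F) ^ ix i * p' $ i)" if "F \<in> T" for F
    using in_curve_flat_iff[OF grid_pointsD(1)[OF p(1)], of "sF F" "bF F"]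
      in_curve_flat_iff[OF grid_pointsD(1)[OF p(2)], of "sF F" "bF F"] T(4)[OF that] F[OF that] by auto
  have inj_s: "inj_on (\<lambda>F. real (sF F)) T"
  proof (rule inj_onI)
    fix F F' assume FF: "F \<in> T" "F' \<in> T" "real (sF F) = real (sF F')"
    then have "sF F = sF F'" by simp
    moreover have "bF F = bF F'" using mem(1)[OF FF(1)] mem(1)[OF FF(2)] FF(3) by simp
    ultimately show "F = F'" using F FF by metis
  qed
  have "(\<lambda>F. real (sF F)) ` T \<subseteq> {s. poly Q s = 0}"
  proof
    fix s assume "s \<in> (\<lambda>F. real (sF F)) ` T"
    then obtain F where F: "F \<in> T" "s = real (sF F)" by blast
    have "w $ z1 = (\<Sum>i\<in>X. s ^ ix i * w $ i)"
      using mem[OF F(1)] F(2) by (simp add: w_def right_diff_distrib sum_subtractf)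
    then show "s \<in> {s. poly Q s = 0}" by (simp add: Q_def poly_sum poly_monom mult.commute)
  qed
  then have "card ((\<lambda>F. real (sF F)) ` T) \<le> card {s. poly Q s = 0}"
    by (rule card_mono[OF poly_roots_finite[OF \<open>Q \<noteq> 0\<close>]])
  also have "\<dots> \<le> card X" using card_poly_roots_bound[OF \<open>Q \<noteq> 0\<close>] degQ by linarith
  finally show False using card_image[OF inj_s] T(3) by simp
qed

text \<open>Points and directions are integral, so the offset that sends a flat of direction
  \<open>s\<close> through a grid point is an integer, and \<open>R\<close> is large enough to
  include it. Every point thus has an incidence in each of the \<open>S\<close> directions.\<close>

lemma incidences_curve_flats:
  fixes S K R :: nat
  assumes R: "K * (1 + card X * S ^ card X) \<le> R"
  defines "\<V> \<equiv> (\<lambda>(s, b). curve_flat X Y z1 ix E idx s b) ` ({1..S} \<times> {- int R..int R})"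
  shows "S * K ^ (card X + 1) \<le> incidences (grid_points (insert z1 X) K) \<V>"
proof -
  let ?F = "curve_flat X Y z1 ix E idx" and ?P = "grid_points (insert z1 X) K"
  have z1: "z1 \<notin> X" using XY by simp
  have "\<exists>b\<in>{- int R..int R}. p \<in> ?F s b" if p: "p \<in> ?P" and s: "s \<in> {1..S}" for p s
  proof -
    have "\<forall>i\<in>insert z1 X. \<exists>l\<in>{1..K}. p $ i = real l" using grid_pointsD(2)[OF p] by blast
    then obtain l where l: "\<And>i. i \<in> insert z1 X \<Longrightarrow> l i \<in> {1..K} \<and> p $ i = real (l i)" by metis
    define b where "b = int (l z1) - int (\<Sum>i\<in>X. s ^ ix i * l i)"
    have "real_of_int b = p $ z1 - (\<Sum>i\<in>X. real s ^ ix i * p $ i)"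
      using l by (simp add: b_def)
    then have "p \<in> ?F s b" by (subst in_curve_flat_iff[OF grid_pointsD(1)[OF p]]) auto
    moreover have "(\<Sum>i\<in>X. s ^ ix i * l i) \<le> of_nat (card X) * (S ^ card X * K)"
    proof (rule sum_bounded_above)
      fix i assume i: "i \<in> X"
      then have "ix i \<le> card X" using ix by (auto simp: bij_betw_def)
      then have "s ^ ix i \<le> S ^ card X"
        using s by (metis atLeastAtMost_iff order_trans power_increasing power_mono zero_le)
      then show "s ^ ix i * l i \<le> S ^ card X * K" using l[of i] i by (intro mult_mono) auto
    qed
    then have sR: "(\<Sum>i\<in>X. s ^ ix i * l i) + K \<le> R" using R by (simp add: algebra_simps)
    have "l z1 \<le> K" using l[of z1] by simp
    with sR have "l z1 \<le> R" "(\<Sum>i\<in>X. s ^ ix i * l i) \<le> R" by linarith+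
    then have "b \<in> {- int R..int R}" unfolding b_def by (simp del: of_nat_sum)
    ultimately show ?thesis by blast
  qed
  then obtain b where b: "\<And>p s. p \<in> ?P \<Longrightarrow> s \<in> {1..S} \<Longrightarrow> b p s \<in> {- int R..int R} \<and> p \<in> ?F s (b p s)"
    by metis
  let ?h = "\<lambda>(p, s). (p, ?F s (b p s))"
  have "inj_on ?h (?P \<times> {1..S})" using curve_flat_inject by (auto simp: inj_on_def)
  moreover have "?h ` (?P \<times> {1..S}) \<subseteq> {(p, F). p \<in> ?P \<and> F \<in> \<V> \<and> p \<in> F}"
    using b by (fastforce simp: \<V>_def)
  moreover have "finite {(p, F). p \<in> ?P \<and> F \<in> \<V> \<and> p \<in> F}"
    by (rule finite_subset[of _ "?P \<times> \<V>"]) (auto simp: \<V>_def finite_card_grid_points)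
  ultimately have "card (?P \<times> {1..S}) \<le> incidences ?P \<V>"
    unfolding incidences_def by (rule card_inj_on_le)
  then show ?thesis using z1 by (simp add: card_cartesian_product finite_card_grid_points mult.commute)
qed

end

lemma defined_in_degree_of_degree:
  assumes "variety W" "real (variety_degree W) \<le> c"
  shows "defined_in_degree (nat \<lfloor>c\<rfloor>) W"
proof -
  obtain D where "defined_in_degree D W" using assms(1) variety_iff_defined_in_degree by blast
  then have "defined_in_degree (variety_degree W) W" unfolding variety_degree_def by (rule LeastI)
  then obtain A where A: "finite A" "\<forall>f\<in>A. poly_fun_deg_le (variety_degree W) f" "W = {x. \<forall>f\<in>A. f x = 0}"
    by (auto simp: defined_in_degree_def)
  have "variety_degree W \<le> nat \<lfloor>c\<rfloor>" using assms(2) by (simp add: le_nat_floor)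
  then have "\<forall>f\<in>A. poly_fun_deg_le (nat \<lfloor>c\<rfloor>) f" using A(2) poly_fun_deg_le_mono by blast
  then show ?thesis using A unfolding defined_in_degree_def by blast
qed

text \<open>If \<open>k' \<le> d' - 1\<close>, then \<open>\<delta>' \<ge> k' + 1\<close> bounds the
  slope by \<open>(d' - 1) / d'\<close>, with equality only at the excluded pair. Moreover
  \<open>\<delta>' - k' < \<delta>' * (1 - k / d) \<le> d - k\<close>. These are the two hypotheses
  on dimensions in \<open>few_bad_parameters\<close>.\<close>

lemma steep_pair:
  assumes R: "(k', \<delta>') \<in> R_set k d" and ne: "(k', \<delta>') \<noteq> (d' - 1, d')" and d': "2 \<le> d'"
    and steep: "\<not> real k' / real \<delta>' < (real d' - 1) / real d'"
  shows "d' \<le> k'" "\<delta>' + k < k' + d"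
proof -
  have r: "1 \<le> k'" "k' \<le> k" "2 \<le> \<delta>'" "\<delta>' \<le> d" "real k / real d < real k' / real \<delta>'" "real k' / real \<delta>' < 1"
    using R by (auto simp: R_set_def)
  have kd: "k' < \<delta>'" using r by (simp add: field_simps)
  have "(real d' - 1) * real \<delta>' \<le> real k' * real d'"
    using steep r d' by (simp add: field_simps not_less)
  then have "real ((d' - 1) * \<delta>') \<le> real (k' * d')" using d' by (simp add: of_nat_diff)
  then have s: "(d' - 1) * \<delta>' \<le> k' * d'" by linarith
  show "d' \<le> k'"
  proof (rule ccontr)
    assume "\<not> d' \<le> k'"
    then have le: "k' \<le> d' - 1" by simp
    have "(d' - 1) * (k' + 1) \<le> (d' - 1) * \<delta>'" using kd by (intro mult_left_mono) auto
    with s have "(d' - 1) * (k' + 1) \<le> k' * d'" by simp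
    then have "d' - 1 \<le> k'" using d' by (cases d') (auto simp: algebra_simps)
    with le have k': "k' = d' - 1" by simp
    with s have "(d' - 1) * \<delta>' \<le> (d' - 1) * d'" by simp
    then have "\<delta>' \<le> d'" using d' by simp
    with kd k' d' have "\<delta>' = d'" by simp
    with k' ne show False by simp
  qed
  have d0: "0 < d" using r(3,4) by simp
  moreover have "real k / real d < 1" using r(5,6) by linarith
  ultimately have kd: "k < d" by (simp add: divide_less_eq)
  have "real k * real \<delta>' < real k' * real d" using r(3,5) d0 by (simp add: field_simps)
  then have "real (k * \<delta>') < real (k' * d)" by simp
  then have a: "k * \<delta>' < k' * d" by linarith
  have "(d - k) * \<delta>' \<le> (d - k) * d" using r(4) by (rule mult_left_mono) simp
  then have "int (d - k) * int \<delta>' \<le> int (d - k) * int d" by (metis of_nat_le_iff of_nat_mult)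
  then have "(int d - int k) * int \<delta>' \<le> (int d - int k) * int d" using kd by (simp add: of_nat_diff)
  moreover have "int k * int \<delta>' < int k' * int d" using a by (metis of_nat_less_iff of_nat_mult)
  ultimately have "int d * (int \<delta>' + int k) < int d * (int k' + int d)" by (simp add: algebra_simps)
  then have "int \<delta>' + int k < int k' + int d" using d0 by simp
  then show "\<delta>' + k < k' + d" by linarith
qed

lemma finite_R_set: "finite (R_set k d)"
  by (rule finite_subset[of _ "{..k} \<times> {..d}"]) (auto simp: R_set_def)

theorem theorem1p5:
  fixes k d d' :: nat
  assumes "CARD('n::finite) = d"
    and "0 < k" and "0 < d'" and "k < d" and "d' - 1 \<le> k"
    and "(real d' - 1) / real d' > real k / real d"
  shows "\<exists>(t::nat) (\<epsilon>::real). 0 < t \<and> 0 < \<epsilon> \<and>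
    (\<forall>(c::real) (C::real). 0 < c \<and> 0 < C \<longrightarrow>
      (\<exists>(m::nat) (n::nat) (P :: (real ^ 'n) set) (\<V> :: (real ^ 'n) set set) (q :: nat \<times> nat \<Rightarrow> nat).
        0 < m \<and> 0 < n \<and>
        finite P \<and> card P = m \<and>
        finite \<V> \<and> card \<V> = n \<and> (\<forall>F\<in>\<V>. flat k F) \<and>
        (\<forall>x \<in> R_set k d - {(d' - 1, d')}. 0 < q x) \<and>
        K2t_free t P \<V> \<and>
        (\<forall>(k', \<delta>') \<in> R_set k d - {(d' - 1, d')}. \<forall>W :: (real ^ 'n) set.
           variety W \<and> variety_dim W = ereal (real \<delta>') \<and> real (variety_degree W) \<le> c \<longrightarrow>
           card {F \<in> \<V>. variety_dim (W \<inter> F) = ereal (real k')} \<le> q (k', \<delta>')) \<and>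
        real (incidences P \<V>) >
          C * ((\<Sum>\<sigma> \<in> {\<sigma> \<in> S_set k d. (d' - 1, d') \<notin> set \<sigma>}. bound_term m n q \<epsilon> \<sigma>)
               + real m + real n)))"
proof -
  define r' where "r' = (real d' - 1) / real d'"
  have d'2: "2 \<le> d'"
  proof (rule ccontr)
    assume "\<not> 2 \<le> d'"
    with \<open>0 < d'\<close> have "d' = 1" by simp
    with assms(6) have "real k / real d < 0" by simp
    then show False by (simp add: divide_less_0_iff)
  qed
  have kd: "real k / real d < r'" using assms(6) by (simp add: r'_def)
  have d1: "1 \<le> d" using assms by simp
  \<comment> \<open>\<open>X\<close> and the later \<open>z1\<close> span the space \<open>G\<close>
    of the grid; \<open>X\<close> and \<open>Y\<close> together are the \<open>k\<close> coordinates
    over which the flats are graphs.\<close>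
  obtain X :: "'n set" where X: "card X = d' - 1"
    using obtain_subset_with_card_n[of "d' - 1" "UNIV :: 'n set"] assms by auto
  have "card (- X) = d - (d' - 1)" using X assms(1) by (simp add: Compl_eq_Diff_UNIV card_Diff_subset)
  then have "k - (d' - 1) \<le> card (- X)" using assms(4) by simp
  then obtain Y where Y: "Y \<subseteq> - X" "card Y = k - (d' - 1)"
    using obtain_subset_with_card_n by metis
  have XY: "X \<inter> Y = {}" using Y by auto
  have cXY: "card (X \<union> Y) = k" using card_Un_disjoint[of X Y] XY X Y assms(5) by simp
  then have cZ: "card (- (X \<union> Y)) = d - k" using assms(1) by (simp add: Compl_eq_Diff_UNIV card_Diff_subset)
  then have "- (X \<union> Y) \<noteq> {}" using assms(4) by (metis card.empty diff_is_0_eq not_less)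
  then obtain z1 where z1: "z1 \<notin> X \<union> Y" by blast
  have Xne: "X \<noteq> {}" using X d'2 by auto
  obtain ix where ix: "bij_betw ix X {1..card X}"
    using finite_same_card_bij[of X "{1..card X}"] by auto
  define T where "T = tvars X Y z1"
  obtain f0 :: "'n \<times> 'n \<Rightarrow> nat" where f0: "inj_on f0 T" using finite_imp_inj_to_nat_seg[of T] by auto
  \<comment> \<open>\<open>Suc\<close> reserves the index 0 for the offset.\<close>
  define idx where "idx v = (if v = (z1, z1) then 0 else Suc (f0 v))" for v
  have idx: "inj_on idx (tvars X Y z1)" "idx (z1, z1) = 0"
    using f0 by (auto simp: inj_on_def idx_def T_def)
  define \<epsilon> where "\<epsilon> = 1 / (4 * (real d)\<^sup>2 * real d')"
  have \<epsilon>0: "0 < \<epsilon>" using d1 d'2 by (simp add: \<epsilon>_def)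
  show ?thesis
  proof (rule exI[of _ d'], rule exI[of _ \<epsilon>], intro conjI allI impI)
    show "0 < d'" by fact
    show "0 < \<epsilon>" by fact
    fix c C :: real assume cC: "0 < c \<and> 0 < C"
    define cn where "cn = nat \<lfloor>c\<rfloor>"
    \<comment> \<open>The pairs that get the constant weight; those of slope exactly
      \<open>r'\<close> are among them.\<close>
    define \<B> where "\<B> = {(k', \<delta>') \<in> R_set k d. (k', \<delta>') \<noteq> (d' - 1, d') \<and> \<not> real k' / real \<delta>' < r'}"
    have finB: "finite \<B>" by (rule finite_subset[OF _ finite_R_set[of k d]]) (auto simp: \<B>_def)
    define bad where "bad W k' E a = {b. variety_dim (W \<inter> tflat X Y z1 a (\<lambda>v. b ^ E ^ idx v)) = ereal (real k')}"
      for W :: "(real ^ 'n) set" and k' E a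
    define Q0 where "Q0 E = 2 ^ CARD('n) * (\<Sum>v\<in>tvars X Y z1. E * E ^ idx v)" for E :: nat
    define few where "few k' \<delta>' \<Delta>0 \<longleftrightarrow> (\<forall>\<Delta>\<ge>\<Delta>0. \<forall>E>\<Delta>. \<forall>a W. defined_in_degree cn W \<longrightarrow>
      variety_dim W = ereal (real \<delta>') \<longrightarrow> finite (bad W k' E a) \<and> card (bad W k' E a) \<le> Q0 E)" for k' \<delta>' \<Delta>0
    have "\<forall>x\<in>\<B>. \<exists>\<Delta>0. few (fst x) (snd x) \<Delta>0"
    proof
      fix x assume "x \<in> \<B>"
      then obtain k' \<delta>' where x: "x = (k', \<delta>')" "(k', \<delta>') \<in> R_set k d" "(k', \<delta>') \<noteq> (d' - 1, d')"
        "\<not> real k' / real \<delta>' < (real d' - 1) / real d'" by (auto simp: \<B>_def r'_def)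
      note sp = steep_pair[OF x(2,3) d'2 x(4)]
      have "card X < k'" "\<delta>' < k' + card (- (X \<union> Y))" using sp X cZ d'2 assms(4) by auto
      from few_bad_parameters[OF XY z1 this idx(1), of cn]
      show "\<exists>\<Delta>0. few (fst x) (snd x) \<Delta>0" unfolding few_def bad_def Q0_def x(1) fst_conv snd_conv .
    qed
    then obtain \<Delta>0 where \<Delta>0: "\<And>x. x \<in> \<B> \<Longrightarrow> few (fst x) (snd x) (\<Delta>0 x)" by metis
    \<comment> \<open>The sum of the thresholds dominates each of them, so it can play the part of
      \<open>\<Delta>\<close> for all pairs in \<open>\<B>\<close> at once.\<close>
    define E where "E = Suc (sum \<Delta>0 \<B>)"
    have fewE: "finite (bad W k' E a) \<and> card (bad W k' E a) \<le> Q0 E"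
      if "(k', \<delta>') \<in> \<B>" "defined_in_degree cn W" "variety_dim W = ereal (real \<delta>')" for k' \<delta>' a W
    proof -
      have "\<Delta>0 (k', \<delta>') \<le> sum \<Delta>0 \<B>" using finB that(1) by (simp add: member_le_sum)
      then show ?thesis using \<Delta>0[OF that(1)] that(2,3) unfolding few_def E_def by auto
    qed
    \<comment> \<open>The \<open>S * m\<close> incidences must beat \<open>C * m\<close> and two
      further amounts of at most \<open>m\<close>, coming from the sum of the terms and from
      \<open>n\<close>; the third unit makes the inequality strict.\<close>
    define S where "S = nat \<lceil>C\<rceil> + 3"
    have S: "real S \<ge> C + 3" unfolding S_def using real_nat_ceiling_ge[of C] by simp
    \<comment> \<open>Each of the \<open>S\<close> directions has at most \<open>Q0 E\<close> bad
      offsets; the summand 1 keeps the weight positive.\<close>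
    define q0 where "q0 = S * Q0 E + 1"
    define R0 where "R0 = 1 + card X * S ^ card X"
    \<comment> \<open>From \<open>n \<le> S * (2 * R + 1) \<le> 3 * S * R\<close> with
      \<open>R = K * R0\<close>.\<close>
    define \<kappa> where "\<kappa> = 3 * S * R0"
    define G where "G = real \<kappa> powr real d' * real q0 powr real d"
    define \<eta> where "\<eta> = 1 / (4 * (real d)\<^sup>2)"
    have \<eta>0: "\<eta> > 0" using d1 by (simp add: \<eta>_def)
    define \<S> where "\<S> = {\<sigma> \<in> S_set k d. (d' - 1, d') \<notin> set \<sigma>}"
    define H where "H = C * real (card \<S>) * G"
    have G0: "G \<ge> 0" by (simp add: G_def)
    have H0: "H \<ge> 0" using cC G0 by (simp add: H_def)
    \<comment> \<open>The first summand gives \<open>H \<le> K powr \<eta>\<close>, which absorbs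
      the constants in front of the terms; the second gives \<open>C * \<kappa> \<le> K\<close>,
      which controls \<open>n\<close>.\<close>
    define K where "K = nat \<lceil>H powr (1 / \<eta>)\<rceil> + nat \<lceil>C * real \<kappa>\<rceil> + 1"
    have K1: "1 \<le> K" by (simp add: K_def)
    have KC: "C * real \<kappa> \<le> real K" unfolding K_def of_nat_add
      using real_nat_ceiling_ge[of "C * real \<kappa>"] of_nat_0_le_iff[of "nat \<lceil>H powr (1 / \<eta>)\<rceil>", where 'a = real] by linarith
    have KH: "H \<le> real K powr \<eta>"
    proof -
      have "H powr (1 / \<eta>) \<le> real K" unfolding K_def of_nat_add
        using real_nat_ceiling_ge[of "H powr (1 / \<eta>)"] of_nat_0_le_iff[of "nat \<lceil>C * real \<kappa>\<rceil>", where 'a = real] by linarith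
      then have "(H powr (1 / \<eta>)) powr \<eta> \<le> real K powr \<eta>" using \<eta>0 by (intro powr_mono2) auto
      then show ?thesis using H0 \<eta>0 by (simp add: powr_powr)
    qed
    define R where "R = K * R0"
    define fl where "fl = curve_flat X Y z1 ix E idx"
    define \<V> where "\<V> = (\<lambda>(s, b). fl s b) ` ({1..S} \<times> {- int R..int R})"
    define P where "P = grid_points (insert z1 X) K"
    define m where "m = K ^ d'"
    define n where "n = card \<V>"
    define q where "q x = (if real (fst x) / real (snd x) < r' then n else q0)" for x :: "nat \<times> nat"
    have cX: "card X + 1 = d'" "card (insert z1 X) = d'" using X d'2 z1 by auto
    have P: "finite P" "card P = m" by (simp_all add: P_def m_def finite_card_grid_points cX)
    have finV: "finite \<V>" by (simp add: \<V>_def)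
    have n1: "1 \<le> n"
    proof -
      have "fl 1 0 \<in> \<V>" unfolding \<V>_def by (rule image_eqI[of _ _ "(1, 0)"]) (auto simp: S_def)
      then have "card \<V> > 0" using finV card_gt_0_iff by blast
      then show ?thesis by (simp add: n_def)
    qed
    have nK: "n \<le> \<kappa> * K"
    proof -
      have "n \<le> card ({1..S} \<times> {- int R..int R})" unfolding n_def \<V>_def by (rule card_image_le) simp
      also have "\<dots> = S * (2 * R + 1)" by (simp add: card_cartesian_product nat_add_distrib nat_mult_distrib)
      also have "\<dots> \<le> S * (3 * R)" using K1 by (intro mult_left_mono) (auto simp: R_def R0_def)
      finally show ?thesis by (simp add: R_def \<kappa>_def mult_ac)
    qed
    have R': "K * (1 + card X * S ^ card X) \<le> R" by (simp add: R_def R0_def)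
    have inc: "S * m \<le> incidences P \<V>"
      using incidences_curve_flats[where X = X and Y = Y and ?z1.0 = z1 and ix = ix and idx = idx
          and E = E and K = K and S = S and R = R, OF XY z1 ix Xne idx(2) R']
      unfolding \<V>_def fl_def P_def m_def cX(1) .
    have few_flats: "card {F \<in> \<V>. variety_dim (W \<inter> F) = ereal (real k')} \<le> q (k', \<delta>')"
      if x: "(k', \<delta>') \<in> R_set k d - {(d' - 1, d')}" and W: "variety W" "variety_dim W = ereal (real \<delta>')"
        "real (variety_degree W) \<le> c" for k' \<delta>' W
    proof (cases "real k' / real \<delta>' < r'")
      case True
      have "card {F \<in> \<V>. variety_dim (W \<inter> F) = ereal (real k')} \<le> card \<V>"
        by (rule card_mono[OF finV]) auto
      then show ?thesis using True by (simp add: q_def n_def)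
    next
      case False
      then have B: "(k', \<delta>') \<in> \<B>" using x by (simp add: \<B>_def)
      have W': "defined_in_degree cn W" unfolding cn_def by (rule defined_in_degree_of_degree[OF W(1,3)])
      let ?bad = "\<lambda>s. bad W k' E (\<lambda>i. real s ^ ix i)"
      \<comment> \<open>Bad offsets were counted among the reals; only the integral ones index flats
        of the family.\<close>
      let ?BB = "\<lambda>s. real_of_int -` ?bad s"
      have fb: "finite (?bad s)" "card (?bad s) \<le> Q0 E" for s using fewE[OF B W' W(2)] by auto
      have "finite (?BB s)" for s by (rule finite_vimageI[OF fb(1)]) (simp add: inj_on_def)
      moreover have "card (?BB s) \<le> Q0 E" for s
        using card_vimage_inj_on_le[of real_of_int UNIV "?bad s"] fb[of s] by (simp add: inj_on_def)
      ultimately have img: "finite (fl s ` ?BB s)" "card (fl s ` ?BB s) \<le> Q0 E" for s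
        using card_image_le order_trans by blast+
      have "{F \<in> \<V>. variety_dim (W \<inter> F) = ereal (real k')} \<subseteq> (\<Union>s\<in>{1..S}. fl s ` ?BB s)"
        by (auto simp: \<V>_def bad_def fl_def curve_flat_def)
      then have "card {F \<in> \<V>. variety_dim (W \<inter> F) = ereal (real k')} \<le> card (\<Union>s\<in>{1..S}. fl s ` ?BB s)"
        by (intro card_mono finite_UN_I img) auto
      also have "\<dots> \<le> (\<Sum>s\<in>{1..S}. card (fl s ` ?BB s))" by (rule card_UN_le) simp
      also have "\<dots> \<le> of_nat (card {1..S}) * Q0 E" by (rule sum_bounded_above) (rule img(2))
      also have "\<dots> \<le> q0" by (simp add: q0_def)
      finally show ?thesis using False by (simp add: q_def)
    qed
    have "real (incidences P \<V>) > C * ((\<Sum>\<sigma>\<in>\<S>. bound_term m n q \<epsilon> \<sigma>) + real m + real n)"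
    proof -
      have "bound_term m n q \<epsilon> \<sigma> \<le> G * real K powr (real d' - \<eta>)" if "\<sigma> \<in> \<S>" for \<sigma>
        unfolding m_def G_def \<eta>_def
        by (rule bound_term_le[OF _ assms(3) kd[unfolded r'_def] n1 nK])
           (use that in \<open>auto simp: \<S>_def q0_def q_def r'_def \<epsilon>_def\<close>)
      then have "(\<Sum>\<sigma>\<in>\<S>. bound_term m n q \<epsilon> \<sigma>) \<le> of_nat (card \<S>) * (G * real K powr (real d' - \<eta>))"
        by (rule sum_bounded_above)
      then have "C * (\<Sum>\<sigma>\<in>\<S>. bound_term m n q \<epsilon> \<sigma>) \<le> C * (of_nat (card \<S>) * (G * real K powr (real d' - \<eta>)))"
        using cC by (intro mult_left_mono) auto
      also have "\<dots> = H * real K powr (real d' - \<eta>)" by (simp add: H_def)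
      also have "\<dots> \<le> real K powr \<eta> * real K powr (real d' - \<eta>)" by (intro mult_right_mono KH) simp
      also have "\<dots> = real m" using K1 by (simp add: m_def powr_realpow flip: powr_add)
      finally have t: "C * (\<Sum>\<sigma>\<in>\<S>. bound_term m n q \<epsilon> \<sigma>) \<le> real m" .
      have "C * real n \<le> C * (real \<kappa> * real K)" using cC nK
        by (intro mult_left_mono) (metis of_nat_le_iff of_nat_mult, simp)
      also have "\<dots> = (C * real \<kappa>) * real K" by simp
      also have "\<dots> \<le> real K * real K" by (intro mult_right_mono KC) simp
      also have "\<dots> = real (K ^ 2)" by (simp add: power2_eq_square)
      \<comment> \<open>Here \<open>d' \<ge> 2\<close> enters: \<open>C * n\<close> is at most
        \<open>K ^ 2\<close>, which must not exceed \<open>m = K ^ d'\<close>.\<close>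
      also have "\<dots> \<le> real m" unfolding m_def of_nat_le_iff using K1 d'2 by (intro power_increasing) auto
      finally have u: "C * real n \<le> real m" .
      have m1: "real m \<ge> 1" using K1 by (simp add: m_def)
      have "C * ((\<Sum>\<sigma>\<in>\<S>. bound_term m n q \<epsilon> \<sigma>) + real m + real n) \<le> real m + C * real m + real m"
        using t u by (simp add: distrib_left)
      also have "\<dots> < (C + 3) * real m" using m1 by (simp add: algebra_simps)
      also have "\<dots> \<le> real S * real m" using S by (intro mult_right_mono) auto
      also have "\<dots> \<le> real (incidences P \<V>)" using inc by (metis of_nat_le_iff of_nat_mult)
      finally show ?thesis .
    qed
    moreover have "K2t_free d' P \<V>"
    proof -
      have "\<V> \<subseteq> {curve_flat X Y z1 ix E idx s b |s b. True}" by (auto simp: \<V>_def fl_def)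
      from K2t_free_curve_flats[where X = X and Y = Y and ?z1.0 = z1 and ix = ix and idx = idx
          and E = E and K = K and \<V> = \<V>, OF XY z1 ix Xne idx(2) this]
      show ?thesis unfolding P_def cX .
    qed
    moreover have "\<forall>F\<in>\<V>. flat k F"
      using flat_tflat[OF XY] cXY by (auto simp: \<V>_def fl_def curve_flat_def)
    moreover have "\<forall>x\<in>R_set k d - {(d' - 1, d')}. 0 < q x" using n1 by (auto simp: q_def q0_def)
    moreover have "\<forall>(k', \<delta>') \<in> R_set k d - {(d' - 1, d')}. \<forall>W :: (real ^ 'n) set.
        variety W \<and> variety_dim W = ereal (real \<delta>') \<and> real (variety_degree W) \<le> c \<longrightarrow>
        card {F \<in> \<V>. variety_dim (W \<inter> F) = ereal (real k')} \<le> q (k', \<delta>')"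
      using few_flats by blast
    moreover have "0 < m" "0 < n" using K1 n1 by (auto simp: m_def)
    ultimately show "\<exists>(m::nat) (n::nat) (P :: (real ^ 'n) set) (\<V> :: (real ^ 'n) set set) (q :: nat \<times> nat \<Rightarrow> nat).
        0 < m \<and> 0 < n \<and>
        finite P \<and> card P = m \<and>
        finite \<V> \<and> card \<V> = n \<and> (\<forall>F\<in>\<V>. flat k F) \<and>
        (\<forall>x \<in> R_set k d - {(d' - 1, d')}. 0 < q x) \<and>
        K2t_free d' P \<V> \<and>
        (\<forall>(k', \<delta>') \<in> R_set k d - {(d' - 1, d')}. \<forall>W :: (real ^ 'n) set.
           variety W \<and> variety_dim W = ereal (real \<delta>') \<and> real (variety_degree W) \<le> c \<longrightarrow>
           card {F \<in> \<V>. variety_dim (W \<inter> F) = ereal (real k')} \<le> q (k', \<delta>')) \<and>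
        real (incidences P \<V>) >
          C * ((\<Sum>\<sigma> \<in> {\<sigma> \<in> S_set k d. (d' - 1, d') \<notin> set \<sigma>}. bound_term m n q \<epsilon> \<sigma>)
               + real m + real n)"
      unfolding \<S>_def[symmetric] using P finV n_def[symmetric]
      by (intro exI[of _ m] exI[of _ n] exI[of _ P] exI[of _ \<V>] exI[of _ q] conjI)
  qed
qed

end
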